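(* Every combinatorial 4-PPT can be stretched to a (geometric) 4-PPT with the given assignment of angles: there is a straight-line plane embedding of the graph, realizing the given combinatorial embedding and outer face, which is a pointed pseudo-triangulation of its vertex set with all interior faces of size 3 or 4, in which the angles tagged reflex are exactly the angles greater than $\pi$. Furthermore, every combinatorial 4-PPT has the generalized Laman property.
   Context: An angle of a plane embedded graph is a vertex–face incidence. A combinatorial pseudo-triangulation is a combinatorial embedding in the plane (rotation system with designated outer face) of a connected planar simple graph with a tag "reflex" or "convex" on each angle such that every interior face has exactly three convex angles, all angles of the outer face are reflex, and no vertex is incident to more than one reflex angle; a vertex is pointed if it is incident to a reflex angle, and the pseudo-triangulation is pointed if all vertices are pointed. A combinatorial 4-PPT is a combinatorial pointed pseudo-triangulation whose interior faces all have size 3 or 4 (outer face of arbitrary size). Geometrically, a pseudo-triangle is a simple polygon with exactly three interior angles smaller than $\pi$; a pseudo-triangulation of a finite point set $S$ is a partition of the convex hull of $S$ into pseudo-triangles whose vertex set is $S$; it is pointed if every vertex is incident to an angle larger than $\pi$. A combinatorial pseudo-triangulation has the generalized Laman property if every set of $x$ non-pointed and $y$ pointed vertices with $x+y\ge 2$ induces a subgraph with at most $3x+2y-3$ edges. *)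

theory Defs
  imports "HOL-Analysis.Analysis"
begin

section \<open>Combinatorial embeddings (rotation systems)\<close>

text \<open>A graph is given by a finite vertex set V and an edge relation E.
  A rotation system rot gives, for each vertex v, the cyclic CLOCKWISE order
  of the neighbours of v: rot v u is the neighbour following u clockwise.
  Darts are ordered pairs (u,v) with E u v. The face successor of dart (u,v)
  is (v, rot v u); faces are the orbits of this permutation (each face lies to
  the left of its darts). An angle (corner) is represented by a dart (u,v): it
  is the corner at vertex v between the edges vu and v(rot v u), inside the
  face of the dart (u,v).\<close>

definition simple_graph :: "'a set \<Rightarrow> ('a \<Rightarrow> 'a \<Rightarrow> bool) \<Rightarrow> bool" where
  "simple_graph V E \<longleftrightarrow> finite V \<and>
     (\<forall>u v. E u v \<longrightarrow> u \<in> V \<and> v \<in> V \<and> u \<noteq> v \<and> E v u)"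

definition graph_connected :: "'a set \<Rightarrow> ('a \<Rightarrow> 'a \<Rightarrow> bool) \<Rightarrow> bool" where
  "graph_connected V E \<longleftrightarrow> (\<forall>u\<in>V. \<forall>v\<in>V. (u, v) \<in> {(a, b). E a b}\<^sup>*)"

definition darts :: "'a set \<Rightarrow> ('a \<Rightarrow> 'a \<Rightarrow> bool) \<Rightarrow> ('a \<times> 'a) set" where
  "darts V E = {(u, v). u \<in> V \<and> v \<in> V \<and> E u v}"

definition graph_edges :: "('a \<Rightarrow> 'a \<Rightarrow> bool) \<Rightarrow> 'a set set" where
  "graph_edges E = {{u, v} | u v. E u v}"

definition induced_edges :: "('a \<Rightarrow> 'a \<Rightarrow> bool) \<Rightarrow> 'a set \<Rightarrow> 'a set set" where
  "induced_edges E X = {{u, v} | u v. u \<in> X \<and> v \<in> X \<and> E u v}"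

definition rotation_system :: "'a set \<Rightarrow> ('a \<Rightarrow> 'a \<Rightarrow> bool) \<Rightarrow> ('a \<Rightarrow> 'a \<Rightarrow> 'a) \<Rightarrow> bool" where
  "rotation_system V E rot \<longleftrightarrow>
     (\<forall>v\<in>V. (\<forall>u. E v u \<longrightarrow> E v (rot v u)) \<and>
             inj_on (rot v) {u. E v u} \<and>
             (\<forall>u w. E v u \<longrightarrow> E v w \<longrightarrow> (\<exists>n. (rot v ^^ n) u = w)))"

definition fsucc :: "('a \<Rightarrow> 'a \<Rightarrow> 'a) \<Rightarrow> 'a \<times> 'a \<Rightarrow> 'a \<times> 'a" where
  "fsucc rot d = (snd d, rot (snd d) (fst d))"

definition dart_face :: "('a \<Rightarrow> 'a \<Rightarrow> 'a) \<Rightarrow> 'a \<times> 'a \<Rightarrow> ('a \<times> 'a) set" where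
  "dart_face rot d = range (\<lambda>n. (fsucc rot ^^ n) d)"

definition faces :: "'a set \<Rightarrow> ('a \<Rightarrow> 'a \<Rightarrow> bool) \<Rightarrow> ('a \<Rightarrow> 'a \<Rightarrow> 'a) \<Rightarrow> ('a \<times> 'a) set set" where
  "faces V E rot = dart_face rot ` darts V E"

text \<open>Plane combinatorial embedding of a connected simple graph: a rotation
  system of genus 0 (Euler's formula), with a designated outer face given by
  one of its darts.\<close>
definition plane_comb_embedding ::
  "'a set \<Rightarrow> ('a \<Rightarrow> 'a \<Rightarrow> bool) \<Rightarrow> ('a \<Rightarrow> 'a \<Rightarrow> 'a) \<Rightarrow> 'a \<times> 'a \<Rightarrow> bool" where
  "plane_comb_embedding V E rot outer \<longleftrightarrow>
     simple_graph V E \<and> graph_connected V E \<and> rotation_system V E rot \<and>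
     outer \<in> darts V E \<and>
     int (card V) - int (card (graph_edges E)) + int (card (faces V E rot)) = 2"

section \<open>Combinatorial pseudo-triangulations\<close>

definition pointed_vertex ::
  "'a set \<Rightarrow> ('a \<Rightarrow> 'a \<Rightarrow> bool) \<Rightarrow> ('a \<times> 'a \<Rightarrow> bool) \<Rightarrow> 'a \<Rightarrow> bool" where
  "pointed_vertex V E reflex v \<longleftrightarrow> (\<exists>d\<in>darts V E. snd d = v \<and> reflex d)"

definition comb_pt ::
  "'a set \<Rightarrow> ('a \<Rightarrow> 'a \<Rightarrow> bool) \<Rightarrow> ('a \<Rightarrow> 'a \<Rightarrow> 'a) \<Rightarrow> 'a \<times> 'a \<Rightarrow> ('a \<times> 'a \<Rightarrow> bool) \<Rightarrow> bool" where
  "comb_pt V E rot outer reflex \<longleftrightarrow>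
     plane_comb_embedding V E rot outer \<and>
     (\<forall>F\<in>faces V E rot. F \<noteq> dart_face rot outer \<longrightarrow> card {d\<in>F. \<not> reflex d} = 3) \<and>
     (\<forall>d\<in>dart_face rot outer. reflex d) \<and>
     (\<forall>v\<in>V. card {d\<in>darts V E. snd d = v \<and> reflex d} \<le> 1)"

definition comb_4ppt ::
  "'a set \<Rightarrow> ('a \<Rightarrow> 'a \<Rightarrow> bool) \<Rightarrow> ('a \<Rightarrow> 'a \<Rightarrow> 'a) \<Rightarrow> 'a \<times> 'a \<Rightarrow> ('a \<times> 'a \<Rightarrow> bool) \<Rightarrow> bool" where
  "comb_4ppt V E rot outer reflex \<longleftrightarrow>
     comb_pt V E rot outer reflex \<and>
     (\<forall>v\<in>V. pointed_vertex V E reflex v) \<and>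
     (\<forall>F\<in>faces V E rot. F \<noteq> dart_face rot outer \<longrightarrow> card F = 3 \<or> card F = 4)"

definition generalized_laman ::
  "'a set \<Rightarrow> ('a \<Rightarrow> 'a \<Rightarrow> bool) \<Rightarrow> ('a \<times> 'a \<Rightarrow> bool) \<Rightarrow> bool" where
  "generalized_laman V E reflex \<longleftrightarrow>
     (\<forall>X\<subseteq>V.
        let x = card {v\<in>X. \<not> pointed_vertex V E reflex v};
            y = card {v\<in>X. pointed_vertex V E reflex v}
        in x + y \<ge> 2 \<longrightarrow>
           int (card (induced_edges E X)) \<le> 3 * int x + 2 * int y - 3)"

section \<open>Geometric realisation in the plane (identified with the complex numbers)\<close>

text \<open>Counterclockwise angle from direction a to direction b, in (0, 2*pi].\<close>
definition ccw_angle :: "complex \<Rightarrow> complex \<Rightarrow> real" where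
  "ccw_angle a b = (if Arg (b / a) > 0 then Arg (b / a) else Arg (b / a) + 2 * pi)"

text \<open>Size of the angle represented by dart (u,v): the angle at p v swept
  counterclockwise from the edge towards rot v u to the edge towards u.\<close>
definition corner_angle :: "('a \<Rightarrow> complex) \<Rightarrow> ('a \<Rightarrow> 'a \<Rightarrow> 'a) \<Rightarrow> 'a \<times> 'a \<Rightarrow> real" where
  "corner_angle p rot d =
     ccw_angle (p (rot (snd d) (fst d)) - p (snd d)) (p (fst d) - p (snd d))"

definition straight_line_plane_embedding ::
  "'a set \<Rightarrow> ('a \<Rightarrow> 'a \<Rightarrow> bool) \<Rightarrow> ('a \<Rightarrow> complex) \<Rightarrow> bool" where
  "straight_line_plane_embedding V E p \<longleftrightarrow> inj_on p V \<and>
     (\<forall>u v x y. E u v \<longrightarrow> E x y \<longrightarrow> {u, v} \<noteq> {x, y} \<longrightarrow>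
        closed_segment (p u) (p v) \<inter> closed_segment (p x) (p y) \<subseteq> p ` ({u, v} \<inter> {x, y}))"

text \<open>The straight-line embedding realises the rotation system: rot v u is the
  neighbour of v met first when turning clockwise from the edge vu.\<close>
definition realizes_rotation ::
  "'a set \<Rightarrow> ('a \<Rightarrow> 'a \<Rightarrow> bool) \<Rightarrow> ('a \<Rightarrow> 'a \<Rightarrow> 'a) \<Rightarrow> ('a \<Rightarrow> complex) \<Rightarrow> bool" where
  "realizes_rotation V E rot p \<longleftrightarrow>
     (\<forall>v\<in>V. \<forall>u x. E v u \<longrightarrow> E v x \<longrightarrow>
        ccw_angle (p (rot v u) - p v) (p u - p v) \<le> ccw_angle (p x - p v) (p u - p v))"

text \<open>Geometric pointed pseudo-triangulation of p ` V with the given faces: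
  the outer face is the boundary of the convex hull (all of p ` V lies in the
  hull of the outer-face vertices, and all outer angles exceed pi), every
  interior face is a pseudo-triangle (a simple polygon, i.e. its boundary walk
  visits distinct vertices, with exactly three angles smaller than pi), and
  every vertex is incident to an angle larger than pi.\<close>
definition geometric_ppt ::
  "'a set \<Rightarrow> ('a \<Rightarrow> 'a \<Rightarrow> bool) \<Rightarrow> ('a \<Rightarrow> 'a \<Rightarrow> 'a) \<Rightarrow> 'a \<times> 'a \<Rightarrow> ('a \<Rightarrow> complex) \<Rightarrow> bool" where
  "geometric_ppt V E rot outer p \<longleftrightarrow>
     p ` V \<subseteq> convex hull (p ` snd ` dart_face rot outer) \<and>
     (\<forall>d\<in>dart_face rot outer. corner_angle p rot d > pi) \<and>
     (\<forall>F\<in>faces V E rot. F \<noteq> dart_face rot outer \<longrightarrow>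
        inj_on snd F \<and> card {d\<in>F. corner_angle p rot d < pi} = 3) \<and>
     (\<forall>v\<in>V. \<exists>d\<in>darts V E. snd d = v \<and> corner_angle p rot d > pi)"

text \<open>p stretches the combinatorial data to a geometric 4-PPT with the given
  assignment of angles.\<close>
definition stretches_to_4ppt ::
  "'a set \<Rightarrow> ('a \<Rightarrow> 'a \<Rightarrow> bool) \<Rightarrow> ('a \<Rightarrow> 'a \<Rightarrow> 'a) \<Rightarrow> 'a \<times> 'a \<Rightarrow> ('a \<times> 'a \<Rightarrow> bool)
     \<Rightarrow> ('a \<Rightarrow> complex) \<Rightarrow> bool" where
  "stretches_to_4ppt V E rot outer reflex p \<longleftrightarrow>
     straight_line_plane_embedding V E p \<and>
     realizes_rotation V E rot p \<and>
     geometric_ppt V E rot outer p \<and>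
     (\<forall>F\<in>faces V E rot. F \<noteq> dart_face rot outer \<longrightarrow> card F = 3 \<or> card F = 4) \<and>
     (\<forall>d\<in>darts V E. reflex d \<longleftrightarrow> corner_angle p rot d > pi)"

end

theory Submission
  imports Defs "HOL-Analysis.Analysis" "HOL-Computational_Algebra.Polynomial"
begin

text \<open>Every interior vertex \<open>v\<close> has its reflex angle in a unique quadrilateral \<open>a v b c\<close>; place
  the outer vertices on a circle and every such \<open>v\<close> at a positive convex combination of its
  ``fathers'' \<open>a\<close>, \<open>b\<close>, \<open>c\<close>. Euler's formula shows that every nonempty set \<open>X\<close> of interior
  vertices has at least three fathers outside \<open>X\<close>; by Hall's theorem any three vertices are then
  joined to the outer cycle by disjoint paths of fathers, so that for suitable weights no three
  vertices are collinear.

  Split every quadrilateral along \<open>v c\<close>. For a generic linear functional each triangle has exactly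
  one median vertex, each interior vertex is the median of at least two triangles, and all but two
  outer vertices are the median of at least one. There are exactly as many triangles as this
  requires, so these bounds are equalities. Comparing two functionals that differ only in the
  order of the ends of one edge, the two triangles at that edge lie on opposite sides of it. Hence
  all faces are positively oriented. The angles then add up to \<open>2 \<pi>\<close> times the number of vertices,
  which gives the rotation system, and a signed count of edges crossed by a ray shows that no
  point is covered twice, which excludes crossings.

  For the Laman property, a self-stress of the framework is lifted (Maxwell) to heights in which
  every interior vertex is the same convex combination of its fathers and the outer vertices have
  height 0; by the maximum principle the heights and the stress vanish. So the rows of the
  rigidity matrix are independent.\<close>

section \<open>Linear systems and systems of distinct representatives\<close>

text \<open>Planarity is given only as Euler's formula for a rotation system, so there is no drawing
  to which topological arguments could be applied. Their substitute is \<open>dual_exact\<close>: an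
  antisymmetric function on darts whose sum at every vertex vanishes is a difference of face
  functions. The Euler inequality for subgraphs, from which the number of fathers is estimated, and
  the Maxwell lifting both rest on it. Placing \<open>v\<close> inside the triangle of its fathers
  makes the angle of its own quadrilateral reflex, but says nothing about the other faces at
  \<open>v\<close>. Their orientation therefore has to come from a global count. The count is tight
  because an outer face of size h leaves exactly h - 2 triangles, the quadrilaterals being balanced
  by the interior vertices. The diagonal from \<open>v\<close> to \<open>c\<close> is the right one
  to cut: as \<open>v\<close> lies inside the triangle \<open>a b c\<close>, both halves inherit the
  orientation of that triangle. Without general position a triangle could have area zero and its
  orientation would be undefined. An outer face with fewer than three darts belongs to a single
  edge, which is treated apart.\<close>

lemma homogeneous_system_nontrivial:
  fixes a :: "'j \<Rightarrow> 'i \<Rightarrow> 'b::idom"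
  assumes "finite J" "finite I" "card J < card I"
  shows "\<exists>x. (\<exists>i\<in>I. x i \<noteq> 0) \<and> (\<forall>j\<in>J. (\<Sum>i\<in>I. a j i * x i) = 0)"
  using assms
proof (induction J arbitrary: I a rule: finite_induct)
  case empty
  then have "I \<noteq> {}" by auto
  then show ?case by (intro exI[of _ "\<lambda>_. 1"]) auto
next
  case (insert j J)
  show ?case
  proof (cases "\<forall>i\<in>I. a j i = 0")
    case True
    from insert.IH[of I a] insert.prems insert.hyps obtain x where
      x: "\<exists>i\<in>I. x i \<noteq> 0" "\<forall>j\<in>J. (\<Sum>i\<in>I. a j i * x i) = 0" by auto
    then show ?thesis using True by (intro exI[of _ x]) auto
  next
    case False
    then obtain i0 where i0: "i0 \<in> I" "a j i0 \<noteq> 0" by auto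
    let ?I = "I - {i0}"
    \<comment> \<open>Elimination by cross-multiplication avoids division, so that the lemma also
      applies over a polynomial ring.\<close>
    define b where "b j' i = a j i0 * a j' i - a j' i0 * a j i" for j' i
    have "card J < card ?I" using insert.prems insert.hyps i0 by simp
    from insert.IH[of ?I b, OF _ this] insert.prems obtain y where
      y: "\<exists>i\<in>?I. y i \<noteq> 0" "\<forall>j\<in>J. (\<Sum>i\<in>?I. b j i * y i) = 0" by auto
    define x where "x i = (if i = i0 then - (\<Sum>i\<in>?I. a j i * y i) else a j i0 * y i)" for i
    have split: "(\<Sum>i\<in>I. a j' i * x i) = a j' i0 * x i0 + a j i0 * (\<Sum>i\<in>?I. a j' i * y i)" for j'
    proof -
      have "(\<Sum>i\<in>I. a j' i * x i) = a j' i0 * x i0 + (\<Sum>i\<in>?I. a j' i * x i)"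
        using i0 insert.prems by (simp add: sum.remove)
      also have "(\<Sum>i\<in>?I. a j' i * x i) = (\<Sum>i\<in>?I. a j i0 * (a j' i * y i))"
        by (rule sum.cong) (auto simp: x_def mult_ac)
      finally show ?thesis by (simp add: sum_distrib_left)
    qed
    have "(\<Sum>i\<in>I. a j i * x i) = 0" unfolding split by (simp add: x_def)
    moreover have "(\<Sum>i\<in>I. a j' i * x i) = 0" if "j' \<in> J" for j'
    proof -
      have "0 = (\<Sum>i\<in>?I. b j' i * y i)" using y that by simp
      also have "\<dots> = (\<Sum>i\<in>?I. a j i0 * (a j' i * y i)) - (\<Sum>i\<in>?I. a j' i0 * (a j i * y i))"
        by (simp add: b_def algebra_simps sum_subtractf)
      also have "\<dots> = (\<Sum>i\<in>I. a j' i * x i)" unfolding split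
        by (simp add: x_def sum_distrib_left)
      finally show ?thesis by simp
    qed
    moreover have "\<exists>i\<in>I. x i \<noteq> 0" using y i0 by (auto simp: x_def)
    ultimately show ?thesis by auto
  qed
qed

text \<open>Either some proper nonempty set of indices is tight and splits the problem, or any choice
  for one index leaves Hall's condition intact for the others.\<close>
lemma hall_marriage:
  assumes "finite I" "\<And>i. i \<in> I \<Longrightarrow> finite (S i)"
    "\<And>X. X \<subseteq> I \<Longrightarrow> card X \<le> card (\<Union>i\<in>X. S i)"
  shows "\<exists>f. inj_on f I \<and> (\<forall>i\<in>I. f i \<in> S i)"
  using assms
proof (induction "card I" arbitrary: I S rule: less_induct)
  case less
  note hall = less.prems(3)
  have fin: "finite X" "finite (\<Union>i\<in>X. S i)" if "X \<subseteq> I" for X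
    using that less.prems finite_subset[OF that] by auto
  show ?case
  proof (cases "\<exists>X. X \<noteq> {} \<and> X \<subset> I \<and> card X = card (\<Union>i\<in>X. S i)")
    case True
    then obtain X where X: "X \<noteq> {}" "X \<subset> I" "card X = card (\<Union>i\<in>X. S i)" by auto
    let ?U = "\<Union>i\<in>X. S i"
    have "\<exists>f. inj_on f X \<and> (\<forall>i\<in>X. f i \<in> S i)"
      using X less.prems psubset_card_mono[OF \<open>finite I\<close> X(2)] fin[of X]
      by (intro less.hyps) auto
    then obtain f where f: "inj_on f X" "\<forall>i\<in>X. f i \<in> S i" by auto
    have "\<exists>g. inj_on g (I - X) \<and> (\<forall>i\<in>I - X. g i \<in> S i - ?U)"
    proof (rule less.hyps)
      show "card (I - X) < card I" using X less.prems(1) by (intro psubset_card_mono) auto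
      show "card Y \<le> card (\<Union>i\<in>Y. S i - ?U)" if "Y \<subseteq> I - X" for Y
      proof -
        have "card Y + card X = card (Y \<union> X)"
          using that X fin[of X] fin[of Y] by (subst card_Un_disjoint) auto
        also have "\<dots> \<le> card (\<Union>i\<in>Y \<union> X. S i)" using that X by (intro hall) auto
        also have "(\<Union>i\<in>Y \<union> X. S i) = (\<Union>i\<in>Y. S i - ?U) \<union> ?U" by auto
        also have "card \<dots> \<le> card (\<Union>i\<in>Y. S i - ?U) + card ?U" by (rule card_Un_le)
        finally show ?thesis using X by simp
      qed
    qed (use less.prems in auto)
    then obtain g where g: "inj_on g (I - X)" "\<forall>i\<in>I - X. g i \<in> S i - ?U" by auto
    let ?h = "\<lambda>i. if i \<in> X then f i else g i"
    have "?h ` X \<inter> ?h ` (I - X) = {}" using f g by auto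
    moreover have "inj_on ?h X" "inj_on ?h (I - X)" using f g by (auto simp: inj_on_def)
    ultimately have "inj_on ?h (X \<union> (I - X))" unfolding inj_on_Un by blast
    moreover have "X \<union> (I - X) = I" using X by auto
    ultimately have "inj_on ?h I" by metis
    then show ?thesis using f g by (intro exI[of _ ?h]) auto
  next
    case False
    show ?thesis
    proof (cases "I = {}")
      case True
      then show ?thesis by simp
    next
      case False
      then obtain i where i: "i \<in> I" by auto
      have "card {i} \<le> card (S i)" using hall[of "{i}"] i by auto
      then obtain s where s: "s \<in> S i" by (cases "S i = {}") auto
      have "\<exists>g. inj_on g (I - {i}) \<and> (\<forall>k\<in>I - {i}. g k \<in> S k - {s})"
      proof (rule less.hyps)
        show "card (I - {i}) < card I" using i less.prems(1) by (intro psubset_card_mono) auto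
        show "card Y \<le> card (\<Union>k\<in>Y. S k - {s})" if Y: "Y \<subseteq> I - {i}" for Y
        proof (cases "Y = {}")
          case False
          have "Y \<subset> I" using Y i by auto
          then have "card Y \<noteq> card (\<Union>k\<in>Y. S k)" "card Y \<le> card (\<Union>k\<in>Y. S k)"
            using False \<open>\<not> (\<exists>X. _ X)\<close> hall[of Y] by auto
          moreover have "(\<Union>k\<in>Y. S k - {s}) = (\<Union>k\<in>Y. S k) - {s}" by auto
          moreover have "card (\<Union>k\<in>Y. S k) \<le> Suc (card ((\<Union>k\<in>Y. S k) - {s}))"
            by (simp add: card_Diff_singleton_if) linarith
          ultimately show ?thesis by simp
        qed auto
      qed (use less.prems in auto)
      then obtain g where g: "inj_on g (I - {i})" "\<forall>k\<in>I - {i}. g k \<in> S k - {s}" by auto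
      have "inj_on (g(i := s)) I" using g i by (fastforce simp: inj_on_def)
      then show ?thesis using g s by (intro exI[of _ "g(i := s)"]) auto
    qed
  qed
qed

section \<open>Weighted barycentric positions\<close>

text \<open>The surplus 3 in \<open>expand\<close> is what allows up to three vertices to be deleted
  from all father sets without violating Hall's condition.\<close>

locale father_system =
  fixes V I :: "'a set" and fa fb fc :: "'a \<Rightarrow> 'a"
  assumes finite_V: "finite V" and I_V: "I \<subseteq> V"
    and fathers_V: "v \<in> I \<Longrightarrow> fa v \<in> V \<and> fb v \<in> V \<and> fc v \<in> V"
    and expand: "X \<subseteq> I \<Longrightarrow> X \<noteq> {} \<Longrightarrow> card X + 3 \<le> card (X \<union> fa ` X \<union> fb ` X \<union> fc ` X)"
begin

definition harmonic :: "('a \<Rightarrow> real) \<Rightarrow> ('a \<Rightarrow> real) \<Rightarrow> ('a \<Rightarrow> real) \<Rightarrow> ('a \<Rightarrow> real) \<Rightarrow> bool" where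
  "harmonic la lb lc f \<longleftrightarrow>
     (\<forall>v\<in>I. f v = la v * f (fa v) + lb v * f (fb v) + lc v * f (fc v))"

definition weights :: "('a \<Rightarrow> real) \<Rightarrow> ('a \<Rightarrow> real) \<Rightarrow> ('a \<Rightarrow> real) \<Rightarrow> bool" where
  "weights la lb lc \<longleftrightarrow>
     (\<forall>v\<in>I. la v \<ge> 0 \<and> lb v \<ge> 0 \<and> lc v \<ge> 0 \<and> la v + lb v + lc v = 1)"

text \<open>No set of interior vertices traps the random walk with the given transition weights.\<close>
definition escaping :: "('a \<Rightarrow> real) \<Rightarrow> ('a \<Rightarrow> real) \<Rightarrow> ('a \<Rightarrow> real) \<Rightarrow> bool" where
  "escaping la lb lc \<longleftrightarrow>
     (\<forall>Z\<subseteq>I. (\<forall>v\<in>Z. (la v > 0 \<longrightarrow> fa v \<in> Z) \<and> (lb v > 0 \<longrightarrow> fb v \<in> Z) \<and> (lc v > 0 \<longrightarrow> fc v \<in> Z))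
       \<longrightarrow> Z = {})"

definition positive :: "('a \<Rightarrow> real) \<Rightarrow> ('a \<Rightarrow> real) \<Rightarrow> ('a \<Rightarrow> real) \<Rightarrow> bool" where
  "positive la lb lc \<longleftrightarrow> (\<forall>v\<in>I. la v > 0 \<and> lb v > 0 \<and> lc v > 0)"

lemma no_closed_set:
  assumes "Z \<subseteq> I" "\<forall>v\<in>Z. fa v \<in> Z \<and> fb v \<in> Z \<and> fc v \<in> Z"
  shows "Z = {}"
proof (rule ccontr)
  assume "Z \<noteq> {}"
  moreover have "Z \<union> fa ` Z \<union> fb ` Z \<union> fc ` Z = Z" using assms by auto
  ultimately show False using expand[of Z] assms by auto
qed

lemma positive_escaping: "positive la lb lc \<Longrightarrow> escaping la lb lc"
  unfolding escaping_def positive_def using no_closed_set by (meson subsetD)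

lemma convex_comb_max:
  fixes m :: real
  assumes "m = a * x + b * y + c * z" "a \<ge> 0" "b \<ge> 0" "c \<ge> 0" "a + b + c = 1"
    "x \<le> m" "y \<le> m" "z \<le> m" "a > 0"
  shows "x = m"
proof (rule ccontr)
  assume "x \<noteq> m"
  then have "a * x < a * m" using assms by auto
  moreover have "b * y \<le> b * m" "c * z \<le> c * m" using assms by (auto intro: mult_left_mono)
  ultimately have "m < (a + b + c) * m" using assms(1) by (simp add: algebra_simps)
  then show False using assms by simp
qed

text \<open>Where \<open>f\<close> is maximal, so are all fathers of positive weight. If the maximum
  exceeded every boundary value, its level set would trap the walk. Escape is assumed rather than
  positivity because the weights of a routing are 0 or 1 along the paths.\<close>

lemma max_principle:
  assumes w: "weights la lb lc" "escaping la lb lc" "harmonic la lb lc f"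
    and bd: "\<And>v. v \<in> V - I \<Longrightarrow> f v \<le> M" and v: "v \<in> V"
  shows "f v \<le> M"
proof (rule ccontr)
  assume less: "\<not> f v \<le> M"
  define m where "m = Max (f ` V)"
  have le: "f u \<le> m" if "u \<in> V" for u using that finite_V by (auto simp: m_def)
  have "m \<in> f ` V" using finite_V v by (auto simp: m_def intro!: Max_in)
  have "m > M" using le[OF v] less by simp
  define Z where "Z = {u\<in>V. f u = m}"
  have ZI: "Z \<subseteq> I" using bd \<open>m > M\<close> by (fastforce simp: Z_def)
  have "(la u > 0 \<longrightarrow> fa u \<in> Z) \<and> (lb u > 0 \<longrightarrow> fb u \<in> Z) \<and> (lc u > 0 \<longrightarrow> fc u \<in> Z)" if u: "u \<in> Z" for u
  proof -
    have uI: "u \<in> I" using u ZI by auto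
    have eq: "m = la u * f (fa u) + lb u * f (fb u) + lc u * f (fc u)"
      using w(3) uI u by (auto simp: harmonic_def Z_def)
    have c: "la u \<ge> 0" "lb u \<ge> 0" "lc u \<ge> 0" "la u + lb u + lc u = 1"
      using w(1) uI by (auto simp: weights_def)
    have l: "f (fa u) \<le> m" "f (fb u) \<le> m" "f (fc u) \<le> m" using le fathers_V[OF uI] by auto
    have "la u > 0 \<Longrightarrow> f (fa u) = m"
      by (rule convex_comb_max[OF eq]) (use c l in auto)
    moreover have "lb u > 0 \<Longrightarrow> f (fb u) = m"
      by (rule convex_comb_max[of m "lb u" "f (fb u)" "la u" "f (fa u)" "lc u"
          "f (fc u)"]) (use c l eq in auto)
    moreover have "lc u > 0 \<Longrightarrow> f (fc u) = m"
      by (rule convex_comb_max[of m "lc u" "f (fc u)" "la u" "f (fa u)" "lb u"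
          "f (fb u)"]) (use c l eq in auto)
    ultimately show ?thesis using fathers_V[OF uI] by (auto simp: Z_def)
  qed
  then have "Z = {}" using w(2) ZI unfolding escaping_def by blast
  then show False using \<open>m \<in> f ` V\<close> by (auto simp: Z_def)
qed

lemma harmonic_uminus: "harmonic la lb lc f \<Longrightarrow> harmonic la lb lc (\<lambda>v. - f v)"
  by (auto simp: harmonic_def algebra_simps)

lemma harmonic_divide: "harmonic la lb lc f \<Longrightarrow> harmonic la lb lc (\<lambda>v. f v / c)"
  unfolding harmonic_def by (simp add: add_divide_distrib)

lemma harmonic_zero:
  assumes w: "weights la lb lc" "escaping la lb lc" "harmonic la lb lc f"
    and bd: "\<And>v. v \<in> V - I \<Longrightarrow> f v = 0" and v: "v \<in> V"
  shows "f v = 0"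
  using max_principle[OF w, of 0 v] max_principle[OF w(1,2) harmonic_uminus[OF w(3)], of 0 v] bd v
  by fastforce

lemma harmonic_unique:
  assumes w: "weights la lb lc" "escaping la lb lc" "harmonic la lb lc f" "harmonic la lb lc g"
    and bd: "\<And>v. v \<in> V - I \<Longrightarrow> f v = g v" and v: "v \<in> V"
  shows "f v = g v"
proof -
  have "harmonic la lb lc (\<lambda>v. f v - g v)"
    using w(3,4) unfolding harmonic_def by (simp add: algebra_simps)
  from harmonic_zero[OF w(1,2) this, of v] bd v show ?thesis by auto
qed

abbreviation interp :: "real \<Rightarrow> ('a \<Rightarrow> real) \<Rightarrow> ('a \<Rightarrow> real) \<Rightarrow> 'a \<Rightarrow> real" where
  "interp t l l' \<equiv> \<lambda>v. (1 - t) * l v + t * l' v"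

lemma interp_weights:
  assumes "weights la lb lc" "weights la' lb' lc'" "t \<in> {0..1}"
  shows "weights (interp t la la') (interp t lb lb') (interp t lc lc')"
proof -
  have "(1 - t) * la v + t * la' v + ((1 - t) * lb v + t * lb' v) + ((1 - t) * lc v + t * lc' v) = 1"
    if "v \<in> I" for v
  proof -
    have "(1 - t) * la v + t * la' v + ((1 - t) * lb v + t * lb' v) + ((1 - t) * lc v + t * lc' v)
      = (1 - t) * (la v + lb v + lc v) + t * (la' v + lb' v + lc' v)" by (simp add: algebra_simps)
    then show ?thesis using assms that by (simp add: weights_def)
  qed
  then show ?thesis using assms by (auto simp: weights_def)
qed

text \<open>The end \<open>t = 1\<close> is excluded because the target weights may vanish.\<close>

lemma interp_positive:
  assumes "positive la lb lc" "weights la' lb' lc'" "0 \<le> t" "t < 1"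
  shows "positive (interp t la la') (interp t lb lb') (interp t lc lc')"
  using assms by (auto simp: weights_def positive_def intro!: add_pos_nonneg)

text \<open>Along a segment of weights the harmonic extension is rational in \<open>t\<close>. A solution \<open>(P, S)\<close>
  over the polynomials with \<open>S\<close> of least degree has no zero of the denominator \<open>S\<close> in \<open>[0, 1]\<close>: by
  the uniqueness of harmonic extensions such a zero would be common to all \<open>P v\<close> and could be
  divided out.\<close>
lemma harmonic_family:
  assumes w: "weights la lb lc" "weights la' lb' lc'"
    and esc: "\<And>t. t \<in> {0..1} \<Longrightarrow> escaping (interp t la la') (interp t lb lb') (interp t lc lc')"
  shows "\<exists>P S. (\<forall>t\<in>{0..1}. poly S t \<noteq> 0) \<and> (\<forall>v\<in>V - I. P v = smult (g v) S) \<and>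
    (\<forall>t\<in>{0..1}. harmonic (interp t la la') (interp t lb lb') (interp t lc lc') (\<lambda>v. poly (P v) t))"
proof -
  define La where "La v = [:la v, la' v - la v:]" for v
  define Lb where "Lb v = [:lb v, lb' v - lb v:]" for v
  define Lc where "Lc v = [:lc v, lc' v - lc v:]" for v
  define Sol where "Sol P S \<longleftrightarrow> (\<forall>v\<in>V - I. P v = smult (g v) S) \<and>
    (\<forall>v\<in>I. P v = La v * P (fa v) + Lb v * P (fb v) + Lc v * P (fc v))" for P S
  have pL: "poly (La v) t = interp t la la' v" "poly (Lb v) t = interp t lb lb' v"
    "poly (Lc v) t = interp t lc lc' v" for v t
    by (auto simp: La_def Lb_def Lc_def algebra_simps)
  have harm: "harmonic (interp t la la') (interp t lb lb') (interp t lc lc') (\<lambda>v. poly (P v) t)"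
    if "Sol P S" for P S t
    unfolding harmonic_def
  proof
    fix v assume "v \<in> I"
    then have "P v = La v * P (fa v) + Lb v * P (fb v) + Lc v * P (fc v)"
      using that by (auto simp: Sol_def)
    then have "poly (P v) t = poly (La v * P (fa v) + Lb v * P (fb v) + Lc v * P (fc v)) t" by simp
    then show "poly (P v) t = interp t la la' v * poly (P (fa v)) t
       + interp t lb lb' v * poly (P (fb v)) t + interp t lc lc' v * poly (P (fc v)) t"
      by (simp add: pL)
  qed
  have zero: "poly (P v) t = 0" if "Sol P S" "poly S t = 0" "t \<in> {0..1}" "v \<in> V" for P S t v
  proof -
    have "poly (P u) t = 0" if "u \<in> V - I" for u
      using \<open>Sol P S\<close> \<open>poly S t = 0\<close> that by (simp add: Sol_def)
    from harmonic_zero[OF interp_weights[OF w that(3)] esc[OF that(3)] harm[OF that(1)] this that(4)]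
    show ?thesis .
  qed
  have ex: "\<exists>P S. Sol P S \<and> S \<noteq> 0"
  proof -
    \<comment> \<open>The unknown \<open>None\<close> is the common denominator and
      \<open>Some u\<close> the numerator at \<open>u\<close>: one unknown more than there are
      equations.\<close>
    define a where "a v i = (case i of None \<Rightarrow>
        - (La v * (if fa v \<in> I then 0 else [:g (fa v):])
            + Lb v * (if fb v \<in> I then 0 else [:g (fb v):])
           + Lc v * (if fc v \<in> I then 0 else [:g (fc v):]))
      | Some u \<Rightarrow> (if u = v then 1 else 0) - (La v * (if fa v = u then 1 else 0)
           + Lb v * (if fb v = u then 1 else 0) + Lc v * (if fc v = u then 1 else 0)))" for v i
    have finI: "finite I" using finite_V I_V finite_subset by auto
    let ?I = "insert None (Some ` I)"
    have "card I < card ?I" using finI by (simp add: card_image)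
    from homogeneous_system_nontrivial[OF finI _ this, of a] finI obtain x where
      x: "\<exists>i\<in>?I. x i \<noteq> 0" "\<forall>v\<in>I. (\<Sum>i\<in>?I. a v i * x i) = 0" by auto
    define P where "P v = (if v \<in> I then x (Some v) else smult (g v) (x None))" for v
    have sel: "(\<Sum>u\<in>I. (if w = u then 1 else 0) * x (Some u)) = (if w \<in> I then x (Some w) else 0)"
        for w
      using finI by (simp add: if_distrib[of "\<lambda>y. y * _"] sum.delta cong: if_cong)
    have PP: "(if w \<in> I then 0 else [:g w:]) * x None + (if w \<in> I then x (Some w) else 0) = P w" for w
      by (simp add: P_def)
    have "P v = La v * P (fa v) + Lb v * P (fb v) + Lc v * P (fc v)" if v: "v \<in> I" for v
    proof -
      have "0 = a v None * x None + (\<Sum>u\<in>I. a v (Some u) * x (Some u))"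
        using x(2) v finI by (simp add: sum.reindex)
      also have "(\<Sum>u\<in>I. a v (Some u) * x (Some u)) = (\<Sum>u\<in>I. (if v = u then 1 else 0) * x (Some u))
        - (La v * (\<Sum>u\<in>I. (if fa v = u then 1 else 0) * x (Some u))
         + Lb v * (\<Sum>u\<in>I. (if fb v = u then 1 else 0) * x (Some u))
         + Lc v * (\<Sum>u\<in>I. (if fc v = u then 1 else 0) * x (Some u)))"
        unfolding sum_distrib_left sum.distrib[symmetric] sum_subtractf[symmetric]
        by (rule sum.cong) (auto simp: a_def algebra_simps)
      also have "a v None * x None + \<dots> = P v - (La v * P (fa v) + Lb v * P (fb v) + Lc v * P (fc v))"
        unfolding sel PP[symmetric] using v by (simp add: a_def algebra_simps)
      finally show ?thesis by simp
    qed
    then have sol: "Sol P (x None)" by (auto simp: Sol_def P_def)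
    \<comment> \<open>With denominator zero the boundary values vanish, so every numerator is zero
      on all of [0, 1]; having infinitely many roots it is the zero polynomial, and the solution
      would be trivial.\<close>
    moreover have "x None \<noteq> 0"
    proof
      assume 0: "x None = 0"
      have "P v = 0" if "v \<in> I" for v
      proof (rule ccontr)
        assume "P v \<noteq> 0"
        then have "finite {t. poly (P v) t = 0}" by (rule poly_roots_finite)
        moreover have "{0..1} \<subseteq> {t. poly (P v) t = 0}" using zero[OF sol] 0 that I_V by auto
        ultimately have "finite {0..1::real}" using finite_subset by blast
        then show False using infinite_Icc[of 0 "1::real"] by simp
      qed
      then show False using x(1) 0 by (auto simp: P_def)
    qed
    ultimately show ?thesis by blast
  qed
  define Q where "Q n \<longleftrightarrow> (\<exists>P S. Sol P S \<and> S \<noteq> 0 \<and> degree S = n)" for n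
  have "\<exists>n. Q n" using ex by (auto simp: Q_def)
  then have "Q (LEAST n. Q n)" by (rule LeastI_ex)
  then obtain P S where PS: "Sol P S" "S \<noteq> 0" "degree S = (LEAST n. Q n)" by (auto simp: Q_def)
  have "poly S t \<noteq> 0" if t: "t \<in> {0..1}" for t
  proof
    assume 0: "poly S t = 0"
    let ?L = "[:- t, 1:]"
    have L0: "?L \<noteq> 0" by simp
    have dS: "?L * (S div ?L) = S"
        using 0 by (intro dvd_mult_div_cancel) (simp add: poly_eq_0_iff_dvd)
    define P' where "P' v = P v div ?L" for v
    have dP: "P v = ?L * P' v" if "v \<in> V" for v
      using zero[OF PS(1) 0 t that] unfolding P'_def
      by (intro dvd_mult_div_cancel[symmetric]) (simp add: poly_eq_0_iff_dvd)
    have "P' v = smult (g v) (S div ?L)" if "v \<in> V - I" for v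
    proof -
      have "?L * P' v = ?L * smult (g v) (S div ?L)"
        using dP[of v] that PS(1) dS by (simp only: Sol_def mult_smult_right) auto
      then show ?thesis using L0 by (simp only: mult_cancel_left) simp
    qed
    moreover have "P' v = La v * P' (fa v) + Lb v * P' (fb v) + Lc v * P' (fc v)" if v: "v \<in> I" for v
    proof -
      have "?L * P' v = P v" using dP v I_V by auto
      also have "\<dots> = La v * P (fa v) + Lb v * P (fb v) + Lc v * P (fc v)"
        using PS(1) v by (auto simp: Sol_def)
      also have "\<dots> = ?L * (La v * P' (fa v) + Lb v * P' (fb v) + Lc v * P' (fc v))"
        using dP fathers_V[OF v] by (simp only: distrib_left mult.left_commute)
      finally show ?thesis using L0 by (simp only: mult_cancel_left) simp
    qed
    ultimately have "Sol P' (S div ?L)" by (auto simp: Sol_def)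
    moreover have S'0: "S div ?L \<noteq> 0" using dS PS(2) by auto
    ultimately have "Q (degree (S div ?L))" by (auto simp: Q_def)
    then have "(LEAST n. Q n) \<le> degree (S div ?L)" by (rule Least_le)
    moreover have "degree S = degree (S div ?L) + 1"
    proof -
      have "degree (?L * (S div ?L)) = degree ?L + degree (S div ?L)"
        by (rule degree_mult_eq[OF L0 S'0])
      then show ?thesis unfolding dS by simp
    qed
    ultimately show False using PS(3) by simp
  qed
  then show ?thesis using PS harm[OF PS(1)] by (intro exI[of _ P] exI[of _ S]) (auto simp: Sol_def)
qed

text \<open>A system of representatives \<open>s\<close> that avoids \<open>T\<close> routes the elements of \<open>T\<close> along disjoint
  \<open>s\<close>-paths to the boundary; putting all weight of a vertex on its successor transports the
  boundary values along them.\<close>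
lemma routing_weights:
  assumes T: "T \<subseteq> V" "card T \<le> 3"
  shows "\<exists>la lb lc e. weights la lb lc \<and> escaping la lb lc \<and> inj_on e T \<and> e ` T \<subseteq> V - I \<and>
    (\<forall>f. harmonic la lb lc f \<longrightarrow> (\<forall>x\<in>T. f x = f (e x)))"
proof -
  \<comment> \<open>A vertex may represent itself, so that the union of these sets is the set
    counted in \<open>expand\<close>; such a vertex lies on no path. Removing \<open>T\<close> keeps
    paths from entering \<open>T\<close> after their start.\<close>
  define S where "S v = {v, fa v, fb v, fc v} - T" for v
  have finI: "finite I" using finite_V I_V finite_subset by auto
  have finT: "finite T" using T finite_V finite_subset by auto
  have "\<exists>s. inj_on s I \<and> (\<forall>v\<in>I. s v \<in> S v)"
  proof (rule hall_marriage[OF finI])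
    show "finite (S v)" for v by (auto simp: S_def)
    show "card X \<le> card (\<Union>v\<in>X. S v)" if X: "X \<subseteq> I" for X
    proof (cases "X = {}")
      case False
      let ?N = "X \<union> fa ` X \<union> fb ` X \<union> fc ` X"
      have "(\<Union>v\<in>X. S v) = ?N - T" by (auto simp: S_def)
      moreover have "card ?N - card T \<le> card (?N - T)" using finT by (rule diff_card_le_card_Diff)
      ultimately show ?thesis using expand[OF X False] T by simp
    qed simp
  qed
  then obtain s0 where s0: "inj_on s0 I" "\<And>v. v \<in> I \<Longrightarrow> s0 v \<in> S v" by auto
  define s where "s v = (if v \<in> I then s0 v else v)" for v
  have sI: "v \<in> I \<Longrightarrow> s v \<in> {v, fa v, fb v, fc v} - T" for v using s0 by (auto simp: s_def S_def)
  have s_inj: "u \<in> I \<Longrightarrow> v \<in> I \<Longrightarrow> s u = s v \<Longrightarrow> u = v" for u v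
    using s0 by (auto simp: s_def inj_on_def)
  \<comment> \<open>Two meeting paths can be wound back in step by injectivity of \<open>s\<close>.
    The shorter one arrives at its start in \<open>T\<close>, which is no value of \<open>s\<close>
    on \<open>I\<close>, so the other has arrived too.\<close>
  have cancel: "i = j \<and> x = y" if "x \<in> T" "y \<in> T" "\<forall>k<i. (s ^^ k) x \<in> I" "\<forall>k<j. (s ^^ k) y \<in> I"
     "(s ^^ i) x = (s ^^ j) y" "i \<le> j" for i j x y
    using that
  proof (induction i arbitrary: j)
    case 0
    show ?case
    proof (cases j)
      case (Suc k)
      then have "(s ^^ k) y \<in> I" using 0 by auto
      from sI[OF this] 0 Suc show ?thesis by auto
    qed (use 0 in auto)
  next
    case (Suc i)
    then obtain k where k: "j = Suc k" by (cases j) auto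
    have "(s ^^ i) x \<in> I" "(s ^^ k) y \<in> I" using Suc.prems k by auto
    then have "(s ^^ i) x = (s ^^ k) y" using Suc.prems k by (auto intro!: s_inj)
    then show ?case using Suc.IH[of k] Suc.prems k by auto
  qed
  have ex: "\<exists>n. (s ^^ n) x \<notin> I" if x: "x \<in> T" for x
  proof (rule ccontr)
    assume a: "\<nexists>n. (s ^^ n) x \<notin> I"
    then have "range (\<lambda>n. (s ^^ n) x) \<subseteq> I" by auto
    then have "finite (range (\<lambda>n. (s ^^ n) x))" using finI finite_subset by auto
    then have "\<not> inj (\<lambda>n. (s ^^ n) x)" using finite_imageD infinite_UNIV_nat by blast
    then obtain i j where "i \<noteq> j" "(s ^^ i) x = (s ^^ j) x" by (auto simp: inj_def)
    then obtain i j where ij: "i < j" "(s ^^ i) x = (s ^^ j) x" by (metis linorder_neqE_nat)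
    from cancel[OF x x _ _ ij(2)] a ij show False by auto
  qed
  define n where "n x = (LEAST n. (s ^^ n) x \<notin> I)" for x
  have n1: "(s ^^ n x) x \<notin> I" if "x \<in> T" for x
    using ex[OF that] unfolding n_def by (rule LeastI_ex)
  have n2: "(s ^^ k) x \<in> I" if "k < n x" for k x
    using not_less_Least[of k "\<lambda>n. (s ^^ n) x \<notin> I"] that by (auto simp: n_def)
  define e where "e x = (s ^^ n x) x" for x
  have inV: "(s ^^ k) x \<in> V" if "x \<in> T" for k x
  proof (induction k)
    case 0
    then show ?case using that T by auto
  next
    case (Suc k)
    have "s u \<in> V" if "u \<in> V" for u
      using that fathers_V[of u] sI[of u] by (cases "u \<in> I") (auto simp: s_def)
    then show ?case using Suc by simp
  qed
  define P where "P = {(s ^^ i) x | i x. x \<in> T \<and> i < n x}"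
  have P: "v \<in> I \<and> s v \<in> {fa v, fb v, fc v}" if "v \<in> P" for v
  proof -
    from that obtain i x where ix: "x \<in> T" "i < n x" "v = (s ^^ i) x" by (auto simp: P_def)
    then have vI: "v \<in> I" using n2 by auto
    have "s v \<noteq> v"
    proof
      assume "s v = v"
      then have "(s ^^ i) x = (s ^^ Suc i) x" using ix by auto
      from cancel[OF ix(1) ix(1) _ _ this] show False using ix n2[of _ x] by auto
    qed
    then show ?thesis using sI[OF vI] vI by auto
  qed
  \<comment> \<open>Off the paths all three weights are 1/3; only their positivity is used, in the
    proof of escape.\<close>
  define la where "la v = (if v \<in> P then if s v = fa v then 1 else 0 else 1/3::real)" for v
  define lb where "lb v = (if v \<in> P then if s v = fa v then 0 else
      if s v = fb v then 1 else 0 else 1/3::real)" for v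
  define lc where "lc v = (if v \<in> P then
      if s v = fa v \<or> s v = fb v then 0 else 1 else 1/3::real)" for v
  have "weights la lb lc" by (auto simp: weights_def la_def lb_def lc_def)
  moreover have "escaping la lb lc"
    unfolding escaping_def
  proof (intro allI impI)
    fix Z assume Z: "Z \<subseteq> I" "\<forall>v\<in>Z. (0 < la v \<longrightarrow> fa v \<in> Z) \<and> (0 < lb v \<longrightarrow> fb v \<in> Z) \<and> (0 < lc v \<longrightarrow>
        fc v \<in> Z)"
    have sZ: "s v \<in> Z" if "v \<in> Z" "v \<in> P" for v
      using bspec[OF Z(2) that(1)] P[OF that(2)] that(2)
          by (auto simp: la_def lb_def lc_def split: if_splits)
    \<comment> \<open>A trapped set that meets a path contains the rest of it, including its end
      outside \<open>I\<close>. So it avoids all paths, and there every father has positive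
      weight.\<close>
    have "v \<notin> P" if v: "v \<in> Z" for v
    proof
      assume "v \<in> P"
      then obtain i x where ix: "x \<in> T" "i < n x" "v = (s ^^ i) x" by (auto simp: P_def)
      have "i + k \<le> n x \<Longrightarrow> (s ^^ (i + k)) x \<in> Z" for k
      proof (induction k)
        case 0
        then show ?case using ix v by auto
      next
        case (Suc k)
        then have "(s ^^ (i + k)) x \<in> Z" using ix by auto
        moreover have "(s ^^ (i + k)) x \<in> P" unfolding P_def using ix Suc.prems
          by (intro CollectI exI[of _ "i + k"] exI[of _ x]) auto
        ultimately have "s ((s ^^ (i + k)) x) \<in> Z" by (rule sZ)
        then show ?case by simp
      qed
      from this[of "n x - i"] ix n1[of x] Z show False by auto
    qed
    then show "Z = {}" using Z by (intro no_closed_set) (auto simp: la_def lb_def lc_def)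
  qed
  moreover have "inj_on e T"
  proof (rule inj_onI)
    fix x y assume xy: "x \<in> T" "y \<in> T" "e x = e y"
    have eq: "(s ^^ n x) x = (s ^^ n y) y" using xy by (simp add: e_def)
    show "x = y"
    proof (cases "n x \<le> n y")
      case True
      then show ?thesis using cancel[OF xy(1,2) _ _ eq] n2 by blast
    next
      case False
      then show ?thesis using cancel[OF xy(2,1) _ _ eq[symmetric]] n2 by fastforce
    qed
  qed
  moreover have "e ` T \<subseteq> V - I" using n1 inV by (auto simp: e_def)
  moreover have "f x = f (e x)" if f: "harmonic la lb lc f" and x: "x \<in> T" for f x
  proof -
    have step: "f v = f (s v)" if "v \<in> P" for v
    proof -
      have "f v = la v * f (fa v) + lb v * f (fb v) + lc v * f (fc v)"
        using f P[OF that] by (auto simp: harmonic_def)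
      then show ?thesis using P[OF that] that by (auto simp: la_def lb_def lc_def split: if_splits)
    qed
    have "k \<le> n x \<Longrightarrow> f x = f ((s ^^ k) x)" for k
    proof (induction k)
      case (Suc k)
      then have "(s ^^ k) x \<in> P" unfolding P_def using x
        by (intro CollectI exI[of _ k] exI[of _ x]) auto
      from step[OF this] Suc show ?case by auto
    qed simp
    then show ?thesis by (simp add: e_def)
  qed
  ultimately show ?thesis by blast
qed

definition area :: "('a \<Rightarrow> real) \<Rightarrow> ('a \<Rightarrow> real) \<Rightarrow> 'a \<Rightarrow> 'a \<Rightarrow> 'a \<Rightarrow> real" where
  "area X Y a b c = (X b - X a) * (Y c - Y a) - (Y b - Y a) * (X c - X a)"

text \<open>Triples are made non-collinear one at a time. For a new triple, move the current weights
  towards weights that route it to three boundary vertices. All areas are rational in the parameter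
  \<open>t\<close>: those of earlier triples are nonzero at 0, that of the new one at 1. Hence only
  finitely many \<open>t\<close> spoil any of them, and for \<open>t < 1\<close> the weights stay
  positive.\<close>

lemma general_position:
  fixes X0 Y0 :: "'a \<Rightarrow> real"
  assumes bd: "\<And>a b c. {a, b, c} \<subseteq> V - I \<Longrightarrow> card {a, b, c} = 3 \<Longrightarrow> area X0 Y0 a b c \<noteq> 0"
  shows "\<exists>la lb lc X Y. weights la lb lc \<and> positive la lb lc \<and> harmonic la lb lc X \<and>
      harmonic la lb lc Y \<and>
    (\<forall>v\<in>V - I. X v = X0 v \<and> Y v = Y0 v) \<and>
    (\<forall>a b c. {a, b, c} \<subseteq> V \<and> card {a, b, c} = 3 \<longrightarrow> area X Y a b c \<noteq> 0)"
proof -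
  define good where "good la lb lc X Y \<longleftrightarrow> weights la lb lc \<and> escaping la lb lc \<and>
      harmonic la lb lc X \<and> harmonic la lb lc Y \<and> (\<forall>v\<in>V - I. X v = X0 v \<and> Y v = Y0 v)"
          for la lb lc X Y
  have ex: "\<exists>X Y. good la lb lc X Y" if w: "weights la lb lc" "escaping la lb lc" for la lb lc
  proof -
    have "\<exists>X. harmonic la lb lc X \<and> (\<forall>v\<in>V - I. X v = g v)" for g
    proof -
      \<comment> \<open>A constant segment of weights turns the lemma on families into the existence
        of a single harmonic extension.\<close>
      have "escaping (interp t la la) (interp t lb lb) (interp t lc lc)" for t
      proof -
        have "interp t l l = l" for l by (rule ext) (simp add: left_diff_distrib)
        then show ?thesis using w by metis
      qed
      from harmonic_family[OF w(1,1) this, of g] obtain P S where PS: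
        "\<forall>t\<in>{0..1}. poly S t \<noteq> 0" "\<forall>v\<in>V - I. P v = smult (g v) S"
        and H: "\<forall>t\<in>{0..1}. harmonic (interp t la la) (interp t lb lb) (interp t lc lc) (\<lambda>v. poly (P v)
            t)"
        by blast
      have PS3: "harmonic (interp 0 la la) (interp 0 lb lb) (interp 0 lc lc) (\<lambda>v. poly (P v) 0)"
        by (rule bspec[OF H]) simp
      have "poly S 0 \<noteq> 0" using PS(1) by simp
      moreover have "harmonic la lb lc (\<lambda>v. poly (P v) 0 / poly S 0)"
        using harmonic_divide[OF PS3] by simp
      ultimately show ?thesis using PS(2)
        by (intro exI[of _ "\<lambda>v. poly (P v) 0 / poly S 0"]) simp
    qed
    from this[of X0] this[of Y0] show ?thesis using w by (auto simp: good_def)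
  qed
  define TT where "TT = {(a, b, c). {a, b, c} \<subseteq> V \<and> card {a, b, c} = 3}"
  have "finite TT" by (rule finite_subset[of _ "V \<times> V \<times> V"]) (auto simp: TT_def finite_V)
  have "\<exists>la lb lc X Y. good la lb lc X Y \<and> positive la lb lc \<and> (\<forall>(a, b, c)\<in>U. area X Y a b c \<noteq> 0)"
    if "U \<subseteq> TT" "finite U" for U
    using that(2,1)
  proof (induction U rule: finite_induct)
    case empty
    let ?l = "\<lambda>_. 1/3 :: real"
    have p: "positive ?l ?l ?l" "weights ?l ?l ?l" by (auto simp: positive_def weights_def)
    with ex[OF p(2) positive_escaping[OF p(1)]] show ?case by blast
  next
    case (insert tr U)
    obtain x y z where tr: "tr = (x, y, z)" by (cases tr)
    from insert obtain la lb lc X Y where g0: "good la lb lc X Y" "positive la lb lc"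
      "\<forall>(a, b, c)\<in>U. area X Y a b c \<noteq> 0" by auto
    from insert.prems tr have T: "{x, y, z} \<subseteq> V" "card {x, y, z} = 3" by (auto simp: TT_def)
    from routing_weights[OF T(1) eq_refl[OF T(2)]] obtain la' lb' lc' e where r:
      "weights la' lb' lc' \<and> escaping la' lb' lc' \<and> inj_on e {x, y, z} \<and> e ` {x, y, z} \<subseteq> V - I \<and>
      (\<forall>f. harmonic la' lb' lc' f \<longrightarrow> (\<forall>u\<in>{x, y, z}. f u = f (e u)))"
      by (elim exE) (rule that, assumption)
    note r5 = r[THEN conjunct2, THEN conjunct2, THEN conjunct2, THEN conjunct2]
    note r = r[THEN conjunct1] r[THEN conjunct2, THEN conjunct1] r[THEN conjunct2, THEN conjunct2,
        THEN conjunct1]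
      r[THEN conjunct2, THEN conjunct2, THEN conjunct2, THEN conjunct1]
    from ex[OF r(1,2)] obtain X' Y' where g1: "good la' lb' lc' X' Y'" by auto
    have "area X' Y' x y z = area X' Y' (e x) (e y) (e z)"
      using r5[rule_format, of X'] r5[rule_format, of Y'] g1 by (simp add: area_def good_def)
    also have "\<dots> = area X0 Y0 (e x) (e y) (e z)"
      using g1 r(4) by (simp add: area_def good_def)
    also have "\<dots> \<noteq> 0"
    proof (rule bd)
      show "{e x, e y, e z} \<subseteq> V - I" using r(4) by auto
      show "card {e x, e y, e z} = 3" using card_image[OF r(3)] T by simp
    qed
    finally have ar1: "area X' Y' x y z \<noteq> 0" .
    let ?la = "\<lambda>t. interp t la la'" and ?lb = "\<lambda>t. interp t lb lb'" and ?lc = "\<lambda>t. interp t lc lc'"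
    have w: "weights la lb lc" "weights la' lb' lc'" using g0 r by (auto simp: good_def)
    have pos: "positive (?la t) (?lb t) (?lc t)" if "t \<in> {0..1}" "t \<noteq> 1" for t
      using that by (intro interp_positive g0 r) auto
    have esc: "escaping (?la t) (?lb t) (?lc t)" if "t \<in> {0..1}" for t
      using r positive_escaping[OF pos[OF that]] by (cases "t = 1") auto
    from harmonic_family[OF w esc, of X0] obtain P S where PS':
      "\<forall>t\<in>{0..1}. poly S t \<noteq> 0" "\<forall>v\<in>V - I. P v = smult (X0 v) S"
      "\<forall>t\<in>{0..1}. harmonic (?la t) (?lb t) (?lc t) (\<lambda>v. poly (P v) t)" by blast
    note PS = bspec[OF PS'(1)] bspec[OF PS'(2)] bspec[OF PS'(3)]
    from harmonic_family[OF w esc, of Y0] obtain Q R where QR':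
      "\<forall>t\<in>{0..1}. poly R t \<noteq> 0" "\<forall>v\<in>V - I. Q v = smult (Y0 v) R"
      "\<forall>t\<in>{0..1}. harmonic (?la t) (?lb t) (?lc t) (\<lambda>v. poly (Q v) t)" by blast
    note QR = bspec[OF QR'(1)] bspec[OF QR'(2)] bspec[OF QR'(3)]
    define Xt where "Xt t v = poly (P v) t / poly S t" for t v
    define Yt where "Yt t v = poly (Q v) t / poly R t" for t v
    have gt: "good (?la t) (?lb t) (?lc t) (Xt t) (Yt t)" if t: "t \<in> {0..1}" for t
    proof -
      have "harmonic (?la t) (?lb t) (?lc t) (Xt t)"
        unfolding Xt_def by (rule harmonic_divide[OF PS(3)[OF t]])
      moreover have "harmonic (?la t) (?lb t) (?lc t) (Yt t)"
        unfolding Yt_def by (rule harmonic_divide[OF QR(3)[OF t]])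
      ultimately show ?thesis
        using interp_weights[OF w t] esc[OF t] PS(1)[OF t] PS(2) QR(1)[OF t] QR(2)
        by (auto simp: good_def Xt_def Yt_def)
    qed
    define A where "A = (\<lambda>(a, b, c). (P b - P a) * (Q c - Q a) - (Q b - Q a) * (P c - P a))"
    have A: "poly (A (a, b, c)) t = poly S t * poly R t * area (Xt t) (Yt t) a b c"
        if t: "t \<in> {0..1}" for a b c t
      using PS(1)[OF t] QR(1)[OF t] by (simp add: A_def area_def Xt_def Yt_def field_simps)
    have uniq: "area X1 Y1 a b c = area X2 Y2 a b c"
      if "good ma mb mc X1 Y1" "good ma mb mc X2 Y2" "{a, b, c} \<subseteq> V" for ma mb mc X1 Y1 X2 Y2 a b c
    proof -
      have "X1 v = X2 v" "Y1 v = Y2 v" if "v \<in> V" for v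
        using harmonic_unique[of ma mb mc X1 X2 v] harmonic_unique[of ma mb mc Y1 Y2 v]
          \<open>good ma mb mc X1 Y1\<close> \<open>good ma mb mc X2 Y2\<close> that by (auto simp: good_def)
      then show ?thesis using that by (auto simp: area_def)
    qed
    \<comment> \<open>Evaluate at 0 for the triples handled before and at 1 for the new one.\<close>
    have "A s \<noteq> 0" if s: "s \<in> insert tr U" for s
    proof -
      obtain a b c where abc: "s = (a, b, c)" by (cases s)
      have V: "{a, b, c} \<subseteq> V" using s abc insert.prems by (auto simp: TT_def)
      show ?thesis
      proof (cases "s \<in> U")
        case True
        have "area (Xt 0) (Yt 0) a b c = area X Y a b c"
          using uniq[OF _ g0(1) V] gt[of 0] by simp
        also have "\<dots> \<noteq> 0" using g0(3) True abc by auto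
        finally have "poly (A s) 0 \<noteq> 0" using A[of 0 a b c] PS(1)[of 0] QR(1)[of 0] abc by simp
        then show ?thesis by auto
      next
        case False
        then have "s = (x, y, z)" using s tr by auto
        moreover have "area (Xt 1) (Yt 1) x y z = area X' Y' x y z"
          using uniq[OF _ g1 T(1)] gt[of 1] by simp
        ultimately have "poly (A s) 1 \<noteq> 0" using A[of 1 x y z] PS(1)[of 1] QR(1)[of 1] ar1 by simp
        then show ?thesis by auto
      qed
    qed
    then have "finite (\<Union>s\<in>insert tr U. {t. poly (A s) t = 0})"
      using insert.hyps by (intro finite_UN_I) (auto intro: poly_roots_finite)
    moreover have "infinite {0<..<1::real}" by simp
    ultimately have "\<not> {0<..<1} \<subseteq> (\<Union>s\<in>insert tr U. {t. poly (A s) t = 0})"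
      using finite_subset by blast
    then obtain t where t: "t \<in> {0<..<1}" "\<forall>s\<in>insert tr U. poly (A s) t \<noteq> 0" by blast
    have t': "t \<in> {0..1}" using t by auto
    have "area (Xt t) (Yt t) a b c \<noteq> 0" if "(a, b, c) \<in> insert tr U" for a b c
      using t(2) that A[OF t', of a b c] by auto
    moreover have "positive (?la t) (?lb t) (?lc t)" using t pos[OF t'] by auto
    ultimately show ?case using gt[OF t'] by blast
  qed
  from this[OF subset_refl \<open>finite TT\<close>] show ?thesis unfolding good_def TT_def by fast
qed

end

section \<open>Plane maps\<close>

text \<open>Orients every edge, so that the unknowns of a linear system can be counted by edges. It
  serves the whole graph, subgraphs and induced subgraphs alike, hence the abstract dart
  set.\<close>

lemma half_darts:
  assumes fin: "finite D" and sym: "\<And>d. d \<in> D \<Longrightarrow> prod.swap d \<in> D"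
    and irr: "\<And>d. d \<in> D \<Longrightarrow> fst d \<noteq> snd d"
  shows "\<exists>J\<subseteq>D. J \<inter> prod.swap ` J = {} \<and> D = J \<union> prod.swap ` J \<and>
    card J = card ((\<lambda>d. {fst d, snd d}) ` D)"
proof -
  let ?e = "\<lambda>d. {fst d, snd d}"
  define r where "r e = (SOME d. d \<in> D \<and> ?e d = e)" for e
  have r: "r e \<in> D \<and> ?e (r e) = e" if "e \<in> ?e ` D" for e
    unfolding r_def by (rule someI_ex) (use that in \<open>blast\<close>)
  define J where "J = r ` ?e ` D"
  have JD: "J \<subseteq> D" unfolding J_def using r by blast
  have eq: "d = d' \<or> d = prod.swap d'" if "?e d = ?e d'" for d d' :: "'a \<times> 'a"
    using that by (cases d; cases d') (auto simp: doubleton_eq_iff)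
  have 1: "card J = card (?e ` D)"
    unfolding J_def using r by (intro card_image inj_onI) metis
  have 2: "d \<in> J \<or> d \<in> prod.swap ` J" if "d \<in> D" for d
  proof -
    have "?e d = ?e (r (?e d))" using r[of "?e d"] that by blast
    from eq[OF this] consider "d = r (?e d)" | "d = prod.swap (r (?e d))" by blast
    then show ?thesis unfolding J_def using that by cases blast+
  qed
  have 3: "prod.swap ` J \<subseteq> D" using JD sym by blast
  have 4: "J \<inter> prod.swap ` J = {}"
  proof -
    have False if d: "d \<in> J" "d' \<in> J" "d = prod.swap d'" for d d'
    proof -
      have "?e d = ?e d'" using d(3) by auto
      moreover have "r (?e x) = x" if x: "x \<in> J" for x
      proof -
        from x obtain e where "e \<in> ?e ` D" "x = r e" unfolding J_def by (rule imageE)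
        then show ?thesis using r[of e] by simp
      qed
      ultimately have "d = d'" using d(1,2) by metis
      then have "fst d = snd d" using arg_cong[OF d(3), of fst] by simp
      moreover have "d \<in> D" using d(1) JD by blast
      ultimately show False using irr[of d] by simp
    qed
    note nf = this
    show ?thesis
    proof (rule equals0I)
      fix d assume a: "d \<in> J \<inter> prod.swap ` J"
      from IntD2[OF a] obtain d' where "d = prod.swap d'" "d' \<in> J" by (rule imageE)
      from nf[OF IntD1[OF a] this(2,1)] show False .
    qed
  qed
  have 5: "D = J \<union> prod.swap ` J"
  proof (intro equalityI Un_least JD 3 subsetI)
    fix d assume "d \<in> D"
    from 2[OF this] show "d \<in> J \<union> prod.swap ` J" unfolding Un_iff .
  qed
  show ?thesis by (rule exI[of _ J]) (intro conjI JD 1 4 5)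
qed

lemma not_both_halves:
  assumes "J \<inter> prod.swap ` J = {}" shows "\<not> (d \<in> J \<and> prod.swap d \<in> J)"
proof
  assume h: "d \<in> J \<and> prod.swap d \<in> J"
  then have "prod.swap (prod.swap d) \<in> prod.swap ` J" by blast
  then show False using assms h by auto
qed

locale plane_map =
  fixes V :: "'a set" and E :: "'a \<Rightarrow> 'a \<Rightarrow> bool" and rot :: "'a \<Rightarrow> 'a \<Rightarrow> 'a" and outer :: "'a \<times> 'a"
  assumes emb: "plane_comb_embedding V E rot outer"
begin

abbreviation D where "D \<equiv> darts V E"
abbreviation fs where "fs \<equiv> fsucc rot"
abbreviation Fs where "Fs \<equiv> faces V E rot"
definition N where "N v = {u. E v u}"

lemma finV: "finite V" and E_V: "E u v \<Longrightarrow> u \<in> V \<and> v \<in> V" and E_irr: "E u v \<Longrightarrow> u \<noteq> v"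
  and E_sym: "E u v \<Longrightarrow> E v u"
  using emb by (auto simp: plane_comb_embedding_def simple_graph_def)

lemma D_iff: "d \<in> D \<longleftrightarrow> E (fst d) (snd d)"
  using E_V by (cases d) (auto simp: darts_def)

lemma D_pair [simp]: "(u, v) \<in> D \<longleftrightarrow> E u v"
  using D_iff by simp

lemma finD: "finite D"
  by (rule finite_subset[of _ "V \<times> V"]) (auto simp: darts_def finV)

lemma swap_D: "d \<in> D \<Longrightarrow> prod.swap d \<in> D"
  using E_sym by (simp add: D_iff)

lemma swap_D_iff [simp]: "prod.swap d \<in> D \<longleftrightarrow> d \<in> D"
  using swap_D[of d] swap_D[of "prod.swap d"] by auto

lemma outer_D: "outer \<in> D"
  using emb by (simp add: plane_comb_embedding_def)

lemma finN: "finite (N v)"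
  by (rule finite_subset[of _ V]) (use E_V finV in \<open>auto simp: N_def\<close>)

lemma N_iff: "u \<in> N v \<longleftrightarrow> E v u" by (simp add: N_def)

lemma rot_E: "E v u \<Longrightarrow> E v (rot v u)"
  and rot_inj: "inj_on (rot v) (N v)"
  and rot_trans: "E v u \<Longrightarrow> E v w \<Longrightarrow> \<exists>n. (rot v ^^ n) u = w"
proof -
  have r: "rotation_system V E rot" using emb by (simp add: plane_comb_embedding_def)
  show "E v u \<Longrightarrow> E v (rot v u)" "E v u \<Longrightarrow> E v w \<Longrightarrow> \<exists>n. (rot v ^^ n) u = w"
    using r E_V unfolding rotation_system_def by blast+
  show "inj_on (rot v) (N v)"
    using r E_V unfolding rotation_system_def N_def by (cases "v \<in> V") (auto simp: inj_on_def)
qed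

lemma rot_bij: "bij_betw (rot v) (N v) (N v)"
  unfolding bij_betw_def using rot_inj rot_E finN
  by (metis N_iff endo_inj_surj image_subsetI)

lemma rot_eqD: "E v u \<Longrightarrow> E v w \<Longrightarrow> rot v u = rot v w \<Longrightarrow> u = w"
  using rot_inj by (auto simp: inj_on_def N_iff)

lemma rot_sum: "(\<Sum>u\<in>N v. g (rot v u)) = (\<Sum>u\<in>N v. g u)"
  using sum.reindex_bij_betw[OF rot_bij] .

lemma rot_closed:
  assumes "\<And>u. u \<in> N v \<Longrightarrow> P u \<Longrightarrow> P (rot v u)" "u0 \<in> N v" "P u0" "w \<in> N v"
  shows "P w"
proof -
  obtain n where n: "(rot v ^^ n) u0 = w" using rot_trans[of v u0 w] assms(2,4) by (auto simp: N_iff)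
  have "(rot v ^^ k) u0 \<in> N v \<and> P ((rot v ^^ k) u0)" for k
    by (induction k) (use assms rot_E in \<open>auto simp: N_iff\<close>)
  then show ?thesis using n by auto
qed

lemma fs_pair [simp]: "fs (u, v) = (v, rot v u)" by (simp add: fsucc_def)

lemma fs_D: "d \<in> D \<Longrightarrow> fs d \<in> D"
  using rot_E E_sym by (cases d) auto

lemma fs_inj: "inj_on fs D"
proof (rule inj_onI)
  fix d e assume "d \<in> D" "e \<in> D" "fs d = fs e"
  then show "d = e" using rot_eqD[of "snd d" "fst d" "fst e"] E_sym
    by (auto simp: fsucc_def D_iff prod_eq_iff)
qed

lemma fsn_D: "d \<in> D \<Longrightarrow> (fs ^^ n) d \<in> D"
  by (induction n) (auto intro: fs_D)

lemma fs_period: assumes "d \<in> D" shows "\<exists>n>0. (fs ^^ n) d = d"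
proof -
  have "finite (range (\<lambda>n. (fs ^^ n) d))"
    by (rule finite_subset[OF _ finD]) (use fsn_D assms in blast)
  then have "\<not> inj (\<lambda>n. (fs ^^ n) d)" using finite_imageD infinite_UNIV_nat by blast
  then obtain i j where ij: "i < j" "(fs ^^ i) d = (fs ^^ j) d"
    unfolding inj_def by (metis linorder_neqE_nat)
  from ij show ?thesis
  proof (induction i arbitrary: j)
    case 0
    then show ?case by (intro exI[of _ j]) auto
  next
    case (Suc i)
    then obtain k where k: "j = Suc k" by (cases j) auto
    have "(fs ^^ i) d = (fs ^^ k) d"
      using Suc.prems k fsn_D[OF assms] fs_inj by (auto simp: inj_on_def)
    then show ?case using Suc k by auto
  qed
qed

lemma face_self [simp]: "d \<in> dart_face rot d"
  unfolding dart_face_def by (rule range_eqI[of _ _ 0]) simp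

lemma face_fs: "e \<in> dart_face rot d \<Longrightarrow> fs e \<in> dart_face rot d"
  unfolding dart_face_def by (auto intro: range_eqI[of _ _ "Suc _"])

lemma face_subset:
  assumes "d \<in> S" "\<And>e. e \<in> S \<Longrightarrow> fs e \<in> S"
  shows "dart_face rot d \<subseteq> S"
proof -
  have "(fs ^^ n) d \<in> S" for n by (induction n) (use assms in auto)
  then show ?thesis by (auto simp: dart_face_def)
qed

lemma face_D: "d \<in> D \<Longrightarrow> dart_face rot d \<subseteq> D"
  by (rule face_subset) (auto intro: fs_D)

lemma face_sym:
  assumes "d \<in> D" "e \<in> dart_face rot d" shows "d \<in> dart_face rot e"
proof -
  obtain k where k: "e = (fs ^^ k) d" using assms by (auto simp: dart_face_def)
  obtain n where n: "n > 0" "(fs ^^ n) d = d" using fs_period[OF assms(1)] by auto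
  have per: "(fs ^^ (n * m)) d = d" for m
    by (induction m) (use n in \<open>auto simp: funpow_add\<close>)
  \<comment> \<open>A multiple of the period that is at least \<open>k\<close>, so that the
    subtraction is not truncated.\<close>
  have "(fs ^^ (n * Suc k - k)) e = (fs ^^ (n * Suc k - k + k)) d" by (simp add: k funpow_add)
  also have "n * Suc k - k + k = n * Suc k" using n by (cases n) auto
  finally show ?thesis using per[of "Suc k"]
      by (auto simp: dart_face_def intro: range_eqI[of _ _ "n * Suc k - k"])
qed

lemma face_eq:
  assumes "d \<in> D" "e \<in> dart_face rot d" shows "dart_face rot e = dart_face rot d"
proof
  show "dart_face rot e \<subseteq> dart_face rot d" using assms by (intro face_subset face_fs)
  show "dart_face rot d \<subseteq> dart_face rot e" using face_sym[OF assms] by (intro face_subset face_fs)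
qed

lemma face_fs_eq: "d \<in> D \<Longrightarrow> dart_face rot (fs d) = dart_face rot d"
  by (intro face_eq face_fs face_self)

lemma faces_memD: assumes "F \<in> Fs" "d \<in> F" shows "d \<in> D" "dart_face rot d = F" "fs d \<in> F"
proof -
  from assms obtain d0 where d0: "d0 \<in> D" "F = dart_face rot d0" by (auto simp: faces_def)
  show "d \<in> D" using face_D d0 assms by blast
  show "dart_face rot d = F" using face_eq d0 assms by blast
  show "fs d \<in> F" using face_fs d0 assms by blast
qed

lemma face_in_faces: "d \<in> D \<Longrightarrow> dart_face rot d \<in> Fs" by (auto simp: faces_def)

lemma finFs: "finite Fs" by (simp add: faces_def finD)

lemma Union_faces: "\<Union> Fs = D" using faces_memD(1) face_in_faces face_self by blast

lemma fin_face: "F \<in> Fs \<Longrightarrow> finite F" using Union_faces finD by (metis Union_upper finite_subset)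

lemma sum_faces: "(\<Sum>d\<in>D. g d) = (\<Sum>F\<in>Fs. \<Sum>d\<in>F. g d)"
proof -
  have "sum g (\<Union> Fs) = (sum \<circ> sum) g Fs"
    by (rule sum.Union_disjoint) (use fin_face faces_memD(2) in blast)+
  then show ?thesis by (simp add: Union_faces)
qed

lemma sum_darts: "(\<Sum>d\<in>D. g d) = (\<Sum>v\<in>V. \<Sum>u\<in>N v. g (u, v))"
proof -
  have "(\<Sum>v\<in>V. \<Sum>u\<in>N v. g (u, v)) = (\<Sum>(v, u)\<in>(SIGMA v:V. N v). g (u, v))"
    by (rule sum.Sigma) (auto simp: finV finN)
  also have "\<dots> = (\<Sum>d\<in>D. g d)"
    by (rule sum.reindex_bij_witness[of _ prod.swap prod.swap])
      (auto simp: N_iff darts_def dest: E_sym E_V)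
  finally show ?thesis ..
qed

lemma sum_swap: "(\<Sum>d\<in>D. g (prod.swap d)) = (\<Sum>d\<in>D. g d)"
  by (rule sum.reindex_bij_witness[of _ prod.swap prod.swap]) auto

lemma connected_V:
  assumes "\<And>u v. E u v \<Longrightarrow> P u \<Longrightarrow> P v" "u0 \<in> V" "P u0" "v \<in> V"
  shows "P v"
proof -
  have "(u0, v) \<in> {(a, b). E a b}\<^sup>*"
    using emb assms by (auto simp: plane_comb_embedding_def graph_connected_def)
  then show ?thesis by (induction rule: rtrancl_induct) (use assms in auto)
qed

text \<open>Face successor and reversal act transitively on darts: \<open>fs\<close> followed by
  reversal is the rotation about the head of a dart, and connectivity spreads the darts at one
  vertex to its neighbours.\<close>

lemma dart_closed:
  assumes "d0 \<in> D" "d0 \<in> S" "\<And>d. d \<in> D \<Longrightarrow> d \<in> S \<Longrightarrow> fs d \<in> S"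
    "\<And>d. d \<in> D \<Longrightarrow> d \<in> S \<Longrightarrow> prod.swap d \<in> S" "d \<in> D"
  shows "d \<in> S"
proof -
  have star: "(w, v) \<in> S" if "(u, v) \<in> S" "E u v" "E v w" for u v w
  proof (rule rot_closed[of v "\<lambda>u. (u, v) \<in> S" u w])
    fix x assume x: "x \<in> N v" "(x, v) \<in> S"
    then have "fs (x, v) \<in> S" using assms(3)[of "(x, v)"] by (auto simp: N_iff intro: E_sym)
    then show "(rot v x, v) \<in> S"
      using assms(4)[of "(v, rot v x)"] x by (auto simp: N_iff intro: rot_E)
  qed (use that in \<open>auto simp: N_iff intro: E_sym\<close>)
  have "\<forall>w. E (snd d) w \<longrightarrow> (w, snd d) \<in> S"
  proof (rule connected_V[of "\<lambda>v. \<forall>w. E v w \<longrightarrow> (w, v) \<in> S" "snd d0"])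
    fix u v assume uv: "E u v" "\<forall>w. E u w \<longrightarrow> (w, u) \<in> S"
    then have "(u, v) \<in> S" using assms(4)[of "(v, u)"] by (auto intro: E_sym)
    then show "\<forall>w. E v w \<longrightarrow> (w, v) \<in> S" using star uv by blast
  next
    show "\<forall>w. E (snd d0) w \<longrightarrow> (w, snd d0) \<in> S"
      using star[of "fst d0" "snd d0"] assms by (auto simp: D_iff)
  qed (use assms in \<open>auto simp: D_iff dest: E_V\<close>)
  then show ?thesis using assms(5) by (cases d) (auto intro: E_sym)
qed

lemma orientation:
  obtains J where "J \<subseteq> D" "J \<inter> prod.swap ` J = {}" "D = J \<union> prod.swap ` J"
    "card J = card ((\<lambda>d. {fst d, snd d}) ` D)"
proof -
  have "\<exists>J\<subseteq>D. J \<inter> prod.swap ` J = {} \<and> D = J \<union> prod.swap ` J \<and>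
    card J = card ((\<lambda>d. {fst d, snd d}) ` D)"
    by (rule half_darts[OF finD swap_D]) (simp_all add: D_iff E_irr)
  then show thesis by (elim exE conjE) (rule that)
qed

lemma euler: "2 * card V + 2 * card Fs = card D + 4"
proof -
  obtain J where J: "J \<subseteq> D" "J \<inter> prod.swap ` J = {}" "D = J \<union> prod.swap ` J"
    "card J = card ((\<lambda>d. {fst d, snd d}) ` D)" by (rule orientation)
  have "card D = card J + card (prod.swap ` J)"
    using J finD finite_subset by (metis card_Un_disjoint finite_imageI)
  then have "card D = 2 * card J" by (simp add: card_image)
  moreover have "(\<lambda>d. {fst d, snd d}) ` D = graph_edges E"
  proof -
    have "{u, v} \<in> (\<lambda>d. {fst d, snd d}) ` D" if "E u v" for u v
      by (rule image_eqI[of _ _ "(u, v)"]) (use that in auto)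
    moreover have "\<exists>u v. e = {u, v} \<and> E u v" if "e \<in> (\<lambda>d. {fst d, snd d}) ` D" for e
    proof -
      from that obtain d where d: "e = {fst d, snd d}" "d \<in> D" by (rule imageE)
      then have "E (fst d) (snd d)" using D_iff[of d] by simp
      then show ?thesis using d(1) by (intro exI[of _ "fst d"] exI[of _ "snd d"]) simp
    qed
    ultimately show ?thesis unfolding graph_edges_def by (intro equalityI subsetI) auto
  qed
  ultimately show ?thesis using J emb by (simp add: plane_comb_embedding_def)
qed

section \<open>Closed functions on darts and differences of face functions\<close>

text \<open>The rotation matches each incoming dart with an outgoing dart of the same face, so the
  sum cancels.\<close>

lemma face_boundary_closed:
  assumes "\<And>d. d \<in> D \<Longrightarrow> \<phi> (fs d) = \<phi> d" "v \<in> V"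
  shows "(\<Sum>u\<in>N v. \<phi> (u, v) - \<phi> (v, u) :: real) = 0"
proof -
  have "(\<Sum>u\<in>N v. \<phi> (u, v)) = (\<Sum>u\<in>N v. \<phi> (v, rot v u))"
  proof (rule sum.cong)
    fix u assume "u \<in> N v"
    then have "(u, v) \<in> D" by (simp add: N_iff E_sym)
    from assms(1)[OF this] show "\<phi> (u, v) = \<phi> (v, rot v u)" by simp
  qed simp
  also have "\<dots> = (\<Sum>u\<in>N v. \<phi> (v, u))" by (rule rot_sum)
  finally show ?thesis by (simp add: sum_subtractf)
qed

text \<open>Summation by parts: collecting the terms at each vertex produces the vanishing vertex
  sums of \<omega>.\<close>

lemma gradient_orthogonal:
  assumes anti: "\<And>d. d \<in> D \<Longrightarrow> \<omega> (prod.swap d) = - \<omega> d"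
    and closed: "\<And>v. v \<in> V \<Longrightarrow> (\<Sum>u\<in>N v. \<omega> (u, v) :: real) = 0"
  shows "(\<Sum>d\<in>D. (f (fst d) - f (snd d)) * \<omega> d) = 0"
proof -
  have "(\<Sum>d\<in>D. f (snd d) * \<omega> d) = (\<Sum>v\<in>V. f v * (\<Sum>u\<in>N v. \<omega> (u, v)))"
    unfolding sum_darts by (simp add: sum_distrib_left)
  also have "\<dots> = 0" using closed by simp
  finally have 1: "(\<Sum>d\<in>D. f (snd d) * \<omega> d) = 0" .
  have "(\<Sum>d\<in>D. f (fst d) * \<omega> d) = (\<Sum>d\<in>D. f (fst (prod.swap d)) * \<omega> (prod.swap d))"
    by (rule sum_swap[symmetric])
  also have "\<dots> = - (\<Sum>d\<in>D. f (snd d) * \<omega> d)"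
    unfolding sum_negf[symmetric] by (rule sum.cong) (auto simp: anti)
  finally show ?thesis using 1 by (simp add: left_diff_distrib sum_subtractf)
qed

text \<open>If \<open>\<omega>\<close> is not the coboundary of a face function, then coboundaries of face functions,
  multiples of \<open>\<omega>\<close> and gradients of vertex functions form a space whose dimension exceeds the
  number of edges by Euler's formula, although the gradients are orthogonal to the others.\<close>
lemma dual_exact:
  assumes anti: "\<And>d. d \<in> D \<Longrightarrow> \<omega> (prod.swap d) = - \<omega> d"
    and closed: "\<And>v. v \<in> V \<Longrightarrow> (\<Sum>u\<in>N v. \<omega> (u, v) :: real) = 0"
  shows "\<exists>\<phi>. (\<forall>d\<in>D. \<phi> (fs d) = \<phi> d) \<and> (\<forall>d\<in>D. \<omega> d = \<phi> d - \<phi> (prod.swap d)) \<and> \<phi> outer = 0"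
proof -
  let ?O = "dart_face rot outer" and ?r = "fst outer"
  have OF: "?O \<in> Fs" using face_in_faces outer_D by blast
  have rV: "?r \<in> V" using outer_D by (auto simp: darts_def)
  obtain J where J: "J \<subseteq> D" "J \<inter> prod.swap ` J = {}" "D = J \<union> prod.swap ` J"
    "card J = card ((\<lambda>d. {fst d, snd d}) ` D)" by (rule orientation)
  have finJ: "finite J" using J finD finite_subset by blast
  have "card D = card J + card (prod.swap ` J)"
    using J finJ by (metis card_Un_disjoint finite_imageI)
  then have cJ: "card D = 2 * card J" by (simp add: card_image)
  \<comment> \<open>One face and one vertex are left out because constant functions have no
    differences. With \<omega> this gives (F - 1) + (V - 1) + 1 = E + 1 unknowns for E
    equations.\<close>
  define A where "A = Fs - {?O}"
  define B where "B = V - {?r}"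
  define I :: "(('a \<times> 'a) set + 'a option) set" where "I = Inl ` A \<union> Inr ` (insert None (Some ` B))"
  have finAB: "finite A" "finite B" using finFs finV by (auto simp: A_def B_def)
  have cA: "card A + 1 = card Fs"
      using OF finFs by (simp add: A_def) (metis card_gt_0_iff Suc_pred empty_iff)
  have cB: "card B + 1 = card V"
      using rV finV by (simp add: B_def) (metis card_gt_0_iff Suc_pred empty_iff)
  have "card I = card (Inl ` A :: (('a \<times> 'a) set + 'a option) set)
      + card (Inr ` (insert None (Some ` B)) :: (('a \<times> 'a) set + 'a option) set)"
    unfolding I_def by (rule card_Un_disjoint) (use finAB in auto)
  also have "\<dots> = card A + card (insert None (Some ` B))"
    by (simp only: card_image[OF inj_Inl] card_image[OF inj_Inr])
  also have "\<dots> = card A + (card B + 1)" using finAB by (simp add: card_image)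
  finally have "card J < card I" using euler cJ cA cB by simp
  define a where "a d i = (case i of Inl F \<Rightarrow> (if F = dart_face rot d then 1 else 0) - (if F
      = dart_face rot (prod.swap d) then 1 else 0)
     | Inr None \<Rightarrow> \<omega> d
     | Inr (Some v) \<Rightarrow> (if v = fst d then 1 else 0) - (if v = snd d then 1 else (0::real)))" for d i
  have finI: "finite I" using finAB by (simp add: I_def)
  from homogeneous_system_nontrivial[OF finJ finI \<open>card J < card I\<close>, of a] obtain x where
    x: "\<exists>i\<in>I. x i \<noteq> 0" "\<forall>d\<in>J. (\<Sum>i\<in>I. a d i * x i) = 0" by auto
  define p where "p d = (if dart_face rot d \<in> A then x (Inl (dart_face rot d)) else 0)" for d
  define f where "f v = (if v \<in> B then x (Inr (Some v)) else 0)" for v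
  define t where "t = x (Inr None)"
  have pf: "p (fs d) = p d" if "d \<in> D" for d using face_fs_eq[OF that] by (simp add: p_def)
  have sumI: "(\<Sum>i\<in>I. a d i * x i) = (p d - p (prod.swap d)) + t * \<omega> d + (f (fst d) - f (snd d))" for d
  proof -
    let ?M = "insert None (Some ` B)"
    have "(\<Sum>i\<in>I. a d i * x i) = (\<Sum>i\<in>Inl ` A. a d i * x i) + (\<Sum>i\<in>Inr ` ?M. a d i * x i)"
      unfolding I_def by (rule sum.union_disjoint) (use finAB in auto)
    also have "(\<Sum>i\<in>Inl ` A. a d i * x i) = (\<Sum>F\<in>A. a d (Inl F) * x (Inl F))"
      by (simp add: sum.reindex)
    also have "(\<Sum>i\<in>Inr ` ?M. a d i * x i) = (\<Sum>i\<in>?M. a d (Inr i) * x (Inr i))"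
      by (simp only: sum.reindex[OF inj_Inr] o_def)
    also have "(\<Sum>F\<in>A. a d (Inl F) * x (Inl F)) = p d - p (prod.swap d)"
      using finAB by (simp add: a_def p_def left_diff_distrib sum_subtractf if_distrib[of
          "\<lambda>y. y * _"] sum.delta cong: if_cong)
    also have "(\<Sum>i\<in>insert None (Some ` B). a d (Inr i) * x (Inr i)) = t * \<omega> d
        + (\<Sum>v\<in>B. a d (Inr (Some v)) * x (Inr (Some v)))"
      using finAB by (simp add: sum.reindex a_def t_def)
    also have "(\<Sum>v\<in>B. a d (Inr (Some v)) * x (Inr (Some v))) = f (fst d) - f (snd d)"
      using finAB by (simp add: a_def f_def left_diff_distrib sum_subtractf if_distrib[of
          "\<lambda>y. y * _"] sum.delta cong: if_cong)
    finally show ?thesis by simp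
  qed
  have eq: "(p d - p (prod.swap d)) + t * \<omega> d + (f (fst d) - f (snd d)) = 0" if "d \<in> D" for d
  proof (cases "d \<in> J")
    case True
    then show ?thesis using x(2) sumI by simp
  next
    case False
    then have "d \<in> prod.swap ` J" using J(3) that by (metis UnE)
    then obtain d' where d': "d = prod.swap d'" "d' \<in> J" by (rule imageE)
    have "(p d' - p (prod.swap d')) + t * \<omega> d' + (f (fst d') - f (snd d')) = 0"
      using x(2) sumI d' by simp
    then show ?thesis using anti[of d'] d' subsetD[OF J(1) d'(2)] by simp
  qed
  \<comment> \<open>The relation expresses the gradient of \<open>f\<close> by functions orthogonal
    to every gradient, so its squared norm is zero.\<close>
  have "(\<Sum>d\<in>D. (f (fst d) - f (snd d))\<^sup>2)
      = (\<Sum>d\<in>D. - ((f (fst d) - f (snd d)) * (p d - p (prod.swap d))) - t * ((f (fst d) - f (snd d)) *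
          \<omega> d))"
  proof (rule sum.cong)
    fix d assume "d \<in> D"
    from eq[OF this] have "f (fst d) - f (snd d) = - (p d - p (prod.swap d)) - t * \<omega> d" by simp
    then show "(f (fst d) - f (snd d))\<^sup>2
        = - ((f (fst d) - f (snd d)) * (p d - p (prod.swap d))) - t * ((f (fst d) - f (snd d)) * \<omega> d)"
      unfolding power2_eq_square by (metis (no_types) mult_minus_right right_diff_distrib
          mult.left_commute)
  qed simp
  also have "\<dots> = - (\<Sum>d\<in>D. (f (fst d) - f (snd d)) * (p d - p (prod.swap d))) - t * (\<Sum>d\<in>D. (f (fst d) -
      f (snd d)) * \<omega> d)"
    by (simp add: sum_subtractf sum_negf sum_distrib_left)
  also have "\<dots> = 0"
    using gradient_orthogonal[OF anti closed, of f] gradient_orthogonal[of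
        "\<lambda>d. p d - p (prod.swap d)" f]
      face_boundary_closed[of p, OF pf] by simp
  finally have df: "f (fst d) = f (snd d)" if "d \<in> D" for d
    using that finD by (simp add: sum_nonneg_eq_0_iff)
  have f0: "f v = 0" if "v \<in> V" for v
  proof (rule connected_V[of "\<lambda>v. f v = 0" ?r v])
    show "f v = 0" if "E u v" "f u = 0" for u v using df[of "(u, v)"] that by simp
  qed (use rV that in \<open>auto simp: f_def B_def\<close>)
  \<comment> \<open>Otherwise \<open>p\<close> would be unchanged across every edge as well as along
    every face; it would be constant, hence zero as on the outer face, and all unknowns would
    vanish.\<close>
  have "t \<noteq> 0"
  proof
    assume t0: "t = 0"
    have ps: "p (prod.swap d) = p d" if "d \<in> D" for d using eq[OF that] df[OF that] t0 by simp
    have "d \<in> {d. p d = 0}" if "d \<in> D" for d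
      by (rule dart_closed[OF outer_D _ _ _ that]) (auto simp: pf ps, simp add: p_def A_def)
    then have p0: "p d = 0" if "d \<in> D" for d using that by simp
    have "x i = 0" if iI: "i \<in> I" for i
    proof -
      consider F where "i = Inl F" "F \<in> A" | "i = Inr None" | v where "i = Inr (Some v)" "v \<in> B"
        using iI by (auto simp: I_def)
      then show ?thesis
      proof cases
        case 1
        then obtain d where "d \<in> D" "F = dart_face rot d" by (auto simp: A_def faces_def)
        then show ?thesis using p0[of d] 1 by (simp add: p_def)
      next
        case 2
        then show ?thesis using t0 by (simp add: t_def)
      next
        case 3
        then show ?thesis using f0[of v] by (simp add: f_def B_def)
      qed
    qed
    then show False using x by auto
  qed
  define q where "q d = - p d / t" for d
  have "\<omega> d = q d - q (prod.swap d)" if "d \<in> D" for d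
    using eq[OF that] df[OF that] \<open>t \<noteq> 0\<close> by (simp add: q_def field_simps)
  then show ?thesis using pf by (intro exI[of _ q]) (simp add: q_def p_def A_def)
qed

lemma face_enum:
  assumes d: "d \<in> D" and k: "card (dart_face rot d) = k"
  shows "(fs ^^ k) d = d" "dart_face rot d = (\<lambda>i. (fs ^^ i) d) ` {..<k}"
    "inj_on (\<lambda>i. (fs ^^ i) d) {..<k}" "k > 0"
proof -
  define n where "n = (LEAST n. n > 0 \<and> (fs ^^ n) d = d)"
  have n: "n > 0 \<and> (fs ^^ n) d = d"
    unfolding n_def by (rule LeastI_ex) (rule fs_period[OF d])
  have least: "\<not> (m > 0 \<and> (fs ^^ m) d = d)" if "m < n" for m
    using not_less_Least that unfolding n_def by blast
  have inj: "inj_on (\<lambda>i. (fs ^^ i) d) {..<n}"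
  proof (rule linorder_inj_onI)
    fix i j assume ij: "i < j" "i \<in> {..<n}" "j \<in> {..<n}"
    show "(fs ^^ i) d \<noteq> (fs ^^ j) d"
    proof
      assume eq: "(fs ^^ i) d = (fs ^^ j) d"
      have "(fs ^^ (n - j + i)) d = (fs ^^ (n - j)) ((fs ^^ j) d)" by (simp add: funpow_add eq)
      also have "\<dots> = (fs ^^ (n - j + j)) d" by (simp add: funpow_add)
      finally have "(fs ^^ (n - j + i)) d = d" using n ij by simp
      then show False using least[of "n - j + i"] ij by auto
    qed
  qed auto
  have "(fs ^^ m) d \<in> (\<lambda>i. (fs ^^ i) d) ` {..<n}" for m
  proof (induction m)
    case 0
    show ?case using n by (intro image_eqI[of _ _ 0]) auto
  next
    case (Suc m)
    then obtain i where i: "i < n" "(fs ^^ m) d = (fs ^^ i) d" by auto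
    show ?case
    proof (cases "Suc i = n")
      case True
      then have "(fs ^^ Suc m) d = (fs ^^ 0) d" using i n by auto
      then show ?thesis using n by (intro image_eqI[of _ _ 0]) auto
    next
      case False
      then show ?thesis using i by (intro image_eqI[of _ _ "Suc i"]) auto
    qed
  qed
  then have im: "dart_face rot d = (\<lambda>i. (fs ^^ i) d) ` {..<n}" unfolding dart_face_def by blast
  have "k = n" using k im card_image[OF inj] by simp
  then show "(fs ^^ k) d = d" "dart_face rot d = (\<lambda>i. (fs ^^ i) d) ` {..<k}"
    "inj_on (\<lambda>i. (fs ^^ i) d) {..<k}" "k > 0" using n im inj by auto
qed

text \<open>The classes \<open>cls A d\<close> are the faces of the subgraph with dart set \<open>A\<close>: faces are merged
  across all edges outside \<open>A\<close>.\<close>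
definition step :: "('a \<times> 'a) set \<Rightarrow> (('a \<times> 'a) \<times> ('a \<times> 'a)) set" where
  "step A = {(d, fs d) | d. d \<in> D} \<union> {(d, prod.swap d) | d. d \<in> D - A}"

definition cls :: "('a \<times> 'a) set \<Rightarrow> 'a \<times> 'a \<Rightarrow> ('a \<times> 'a) set" where
  "cls A d = {e. (d, e) \<in> (step A \<union> (step A)\<inverse>)\<^sup>*}"

lemma cls_self: "d \<in> cls A d" by (simp add: cls_def)

lemma sym_rtrancl_step: "sym ((step A \<union> (step A)\<inverse>)\<^sup>*)"
  by (intro sym_rtrancl sym_Un_converse)

lemma cls_eq: "e \<in> cls A d \<Longrightarrow> cls A e = cls A d"
  using sym_rtrancl_step[of A] unfolding cls_def by (auto dest: symD intro: rtrancl_trans)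

lemma cls_step: "(d, e) \<in> step A \<Longrightarrow> cls A e = cls A d"
  by (rule cls_eq) (auto simp: cls_def)

lemma cls_fs: "d \<in> D \<Longrightarrow> cls A (fs d) = cls A d"
  by (rule cls_step) (unfold step_def, blast)

lemma cls_swap: "d \<in> D - A \<Longrightarrow> cls A (prod.swap d) = cls A d"
  by (rule cls_step) (unfold step_def, blast)

lemma step_D: "(d, e) \<in> step A \<Longrightarrow> d \<in> D \<and> e \<in> D"
  unfolding step_def using fs_D swap_D by blast

lemma cls_invariant:
  assumes "e \<in> cls A d" "\<And>x y. (x, y) \<in> step A \<Longrightarrow> P x \<longleftrightarrow> P y" "P d"
  shows "P e"
proof -
  have "(d, e) \<in> (step A \<union> (step A)\<inverse>)\<^sup>*" using assms(1) by (simp add: cls_def)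
  then show ?thesis by (induction rule: rtrancl_induct) (use assms(2,3) in auto)
qed

lemma cls_const:
  assumes "\<And>d. d \<in> D \<Longrightarrow> \<phi> (fs d) = \<phi> d" "\<And>d. d \<in> D - A \<Longrightarrow> \<phi> (prod.swap d) = \<phi> d"
    "e \<in> cls A d"
  shows "\<phi> e = \<phi> d"
  by (rule cls_invariant[OF assms(3)]) (use assms(1,2) in \<open>auto simp: step_def\<close>)

lemma cls_D: "d \<in> D \<Longrightarrow> cls A d \<subseteq> D"
proof
  fix e assume "d \<in> D" "e \<in> cls A d"
  show "e \<in> D" by (rule cls_invariant[OF \<open>e \<in> cls A d\<close>,
      where P = "\<lambda>e. e \<in> D", OF _ \<open>d \<in> D\<close>]) (use step_D in blast)
qed

text \<open>Rewrites a sum over the neighbours of \<open>v\<close> as a sum over oriented edges,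
  where the unknowns of the linear systems live.\<close>

lemma half_sum:
  assumes J: "J \<subseteq> D" "J \<inter> prod.swap ` J = {}" and v: "v \<in> V"
    and h0: "\<And>d. d \<in> D \<Longrightarrow> d \<notin> J \<Longrightarrow> prod.swap d \<notin> J \<Longrightarrow> h d = 0"
  shows "(\<Sum>u\<in>N v. h (u, v) :: real) = (\<Sum>d\<in>J. of_bool (snd d = v) * h d + of_bool (fst d
      = v) * h (prod.swap d))"
proof -
  let ?g = "\<lambda>d. of_bool (snd d = v) * h d"
  have sJ: "prod.swap ` J \<subseteq> D"
  proof
    fix d assume "d \<in> prod.swap ` J"
    then obtain e where "d = prod.swap e" "e \<in> J" by (rule imageE)
    then show "d \<in> D" using swap_D subsetD[OF J(1)] by simp
  qed
  have finJ: "finite J" using J(1) finD by (rule finite_subset)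
  have "(\<Sum>u\<in>N v. h (u, v)) = (\<Sum>w\<in>V. if v = w then \<Sum>u\<in>N w. h (u, w) else 0)"
    using v finV by simp
  also have "\<dots> = (\<Sum>w\<in>V. \<Sum>u\<in>N w. ?g (u, w))" by (intro sum.cong refl) auto
  also have "\<dots> = (\<Sum>d\<in>D. ?g d)" by (rule sum_darts[symmetric])
  also have "\<dots> = (\<Sum>d\<in>J \<union> prod.swap ` J. ?g d)"
  proof (rule sum.mono_neutral_right[OF finD Un_least[OF J(1) sJ]], rule ballI)
    fix d assume d: "d \<in> D - (J \<union> prod.swap ` J)"
    have "prod.swap d \<notin> J"
    proof
      assume "prod.swap d \<in> J"
      then have "prod.swap (prod.swap d) \<in> prod.swap ` J" by (rule imageI)
      then show False using d by simp
    qed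
    then have "h d = 0" using h0[of d] d by blast
    then show "?g d = 0" by simp
  qed
  also have "\<dots> = (\<Sum>d\<in>J. ?g d) + (\<Sum>d\<in>prod.swap ` J. ?g d)"
    using finJ J(2) by (intro sum.union_disjoint) auto
  also have "(\<Sum>d\<in>prod.swap ` J. ?g d) = (\<Sum>d\<in>J. of_bool (fst d = v) * h (prod.swap d))"
    by (subst sum.reindex) auto
  finally show ?thesis by (simp add: sum.distrib)
qed

text \<open>Twice the inequality E + 2 \<le> V + F for the subgraph, which may be disconnected. If
  it failed, some nonzero \<omega> on its edges would be closed at all vertices and orthogonal to
  the boundaries of all classes. By \<open>dual_exact\<close> it is the difference of a face
  function. As \<omega> vanishes off \<open>A\<close>, that function is constant on classes, so
  \<omega> is a combination of class boundaries and orthogonal to itself.\<close>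

lemma subgraph_euler:
  assumes A: "A \<subseteq> D" "\<And>d. d \<in> A \<Longrightarrow> prod.swap d \<in> A" and ne: "A \<noteq> {}"
    and W: "\<And>d. d \<in> A \<Longrightarrow> fst d \<in> W" "finite W"
  shows "card A + 4 \<le> 2 * card W + 2 * card (cls A ` D)"
proof -
  let ?K = "cls A ` D"
  have finA: "finite A" using A finD finite_subset by auto
  have irrA: "fst d \<noteq> snd d" if "d \<in> A" for d
    using subsetD[OF A(1) that] E_irr[of "fst d" "snd d"] by (auto simp: D_iff)
  obtain J where J: "J \<subseteq> A" "J \<inter> prod.swap ` J = {}" "A = J \<union> prod.swap ` J"
  proof -
    have "\<exists>J\<subseteq>A. J \<inter> prod.swap ` J = {} \<and> A = J \<union> prod.swap ` J \<and>
      card J = card ((\<lambda>d. {fst d, snd d}) ` A)"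
      by (rule half_darts) (use finA A(2) irrA in simp_all)
    then show thesis by (elim exE conjE) (rule that)
  qed
  have finJ: "finite J" using J finA finite_subset by blast
  have JD: "J \<subseteq> D" using J A by auto
  have "card A = card J + card (prod.swap ` J)"
    using J finJ by (metis card_Un_disjoint finite_imageI)
  then have cA: "card A = 2 * card J" by (simp add: card_image)
  show ?thesis
  proof (rule ccontr)
    assume "\<not> ?thesis"
    then have small: "card W + card ?K < card J + 2" using cA by simp
    obtain d0 where d0: "d0 \<in> A" using ne by auto
    let ?w = "fst d0" and ?C = "cls A d0"
    have w: "?w \<in> W" and C: "?C \<in> ?K" using W d0 A by auto
    have cW: "card (W - {?w}) + 1 = card W"
        using w W by (simp) (metis card_gt_0_iff Suc_pred empty_iff)
    have cK: "card (?K - {?C}) + 1 = card ?K"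
        using C finD by (simp) (metis card_gt_0_iff Suc_pred empty_iff finite_imageI)
    \<comment> \<open>One vertex equation and one class equation are omitted: each of the two
      families sums to zero, so the omitted ones follow.\<close>
    define Eq :: "('a + ('a \<times> 'a) set) set" where "Eq = Inl ` (W - {?w}) \<union> Inr ` (?K - {?C})"
    have finEq: "finite Eq" using W finD by (auto simp: Eq_def)
    have "card Eq \<le> card (W - {?w}) + card (?K - {?C})"
      unfolding Eq_def by (rule order.trans[OF card_Un_le]) (simp add: card_image)
    then have "card Eq < card J" using small cW cK by simp
    define a where "a i d = (case i of Inl v \<Rightarrow> of_bool (snd d = v) - of_bool (fst d = v)
       | Inr C \<Rightarrow> of_bool (d \<in> C) - (of_bool (prod.swap d \<in> C) :: real))"
      for i and d :: "'a \<times> 'a"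
    from homogeneous_system_nontrivial[OF finEq finJ \<open>card Eq < card J\<close>, of a] obtain x where
      x: "\<exists>d\<in>J. x d \<noteq> 0" "\<forall>i\<in>Eq. (\<Sum>d\<in>J. a i d * x d) = 0" by auto
    define \<omega> where "\<omega> d = (if d \<in> J then x d else
        if prod.swap d \<in> J then - x (prod.swap d) else 0)" for d
    note notboth = not_both_halves[OF J(2)]
    have anti: "\<omega> (prod.swap d) = - \<omega> d" for d using notboth[of d] by (auto simp: \<omega>_def)
    have vs: "(\<Sum>u\<in>N v. \<omega> (u, v)) = (\<Sum>d\<in>J. a (Inl v) d * x d)" if v: "v \<in> V" for v
    proof -
      have "(\<Sum>u\<in>N v. \<omega> (u, v)) = (\<Sum>d\<in>J. of_bool (snd d = v) * \<omega> d + of_bool (fst d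
          = v) * \<omega> (prod.swap d))"
        by (rule half_sum[OF JD J(2) v]) (simp add: \<omega>_def)
      also have "\<dots> = (\<Sum>d\<in>J. a (Inl v) d * x d)"
      proof (rule sum.cong)
        fix d assume "d \<in> J"
        then have "\<omega> d = x d" by (simp add: \<omega>_def)
        then show "of_bool (snd d = v) * \<omega> d + of_bool (fst d = v) * \<omega> (prod.swap d)
            = a (Inl v) d * x d"
          using anti[of d] by (simp add: a_def left_diff_distrib)
      qed simp
      finally show ?thesis .
    qed
    have JW: "fst d \<in> W \<and> snd d \<in> W" if "d \<in> J" for d
      using W(1)[of d] W(1)[of "prod.swap d"] A(2)[of d] subsetD[OF J(1) that] by simp
    have JK: "(\<Sum>C\<in>?K. of_bool (d \<in> C) * g C) = (g (cls A d) :: real)" if "d \<in> D" for d g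
    proof -
      have "(\<Sum>C\<in>?K. of_bool (d \<in> C) * g C) = (\<Sum>C\<in>?K. if C = cls A d then g C else 0)"
      proof (rule sum.cong)
        fix C assume "C \<in> ?K"
        then have "d \<in> C \<longleftrightarrow> C = cls A d" using cls_eq cls_self by blast
        then show "of_bool (d \<in> C) * g C = (if C = cls A d then g C else 0)" by simp
      qed simp
      then show ?thesis using that finD by simp
    qed
    have allW: "(\<Sum>d\<in>J. a (Inl v) d * x d) = 0" if "v \<in> W" for v
    proof (cases "v = ?w")
      case False
      then show ?thesis using x(2) that by (auto simp: Eq_def)
    next
      case True
      have "(\<Sum>v\<in>W. \<Sum>d\<in>J. a (Inl v) d * x d) = (\<Sum>d\<in>J. (\<Sum>v\<in>W. a (Inl v) d) * x d)"
        by (subst sum.swap) (simp add: sum_distrib_right)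
      also have "\<dots> = 0"
        using JW W(2) by (intro sum.neutral) (simp add: a_def sum_subtractf of_bool_def)
      finally have "(\<Sum>d\<in>J. a (Inl ?w) d * x d) + (\<Sum>v\<in>W - {?w}. \<Sum>d\<in>J. a (Inl v) d * x d) = 0"
        using w W(2) by (simp add: sum.remove)
      moreover have "(\<Sum>v\<in>W - {?w}. \<Sum>d\<in>J. a (Inl v) d * x d) = 0"
        using x(2) by (intro sum.neutral) (auto simp: Eq_def)
      ultimately show ?thesis using True by simp
    qed
    have allK: "(\<Sum>d\<in>J. a (Inr C) d * x d) = 0" if "C \<in> ?K" for C
    proof (cases "C = ?C")
      case False
      then show ?thesis using x(2) that by (auto simp: Eq_def)
    next
      case True
      have "(\<Sum>C\<in>?K. \<Sum>d\<in>J. a (Inr C) d * x d) = (\<Sum>d\<in>J. (\<Sum>C\<in>?K. a (Inr C) d) * x d)"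
        by (subst sum.swap) (simp add: sum_distrib_right)
      also have "\<dots> = 0"
      proof (rule sum.neutral, rule ballI)
        fix d assume "d \<in> J"
        then have "d \<in> D" using JD by auto
        then show "(\<Sum>C\<in>?K. a (Inr C) d) * x d = 0"
          using JK[of d "\<lambda>_. 1"] JK[of "prod.swap d" "\<lambda>_. 1"] by (simp add: a_def sum_subtractf)
      qed
      finally have "(\<Sum>d\<in>J. a (Inr ?C) d * x d) + (\<Sum>C\<in>?K - {?C}. \<Sum>d\<in>J. a (Inr C) d * x d) = 0"
        using C finD by (simp add: sum.remove)
      moreover have "(\<Sum>C\<in>?K - {?C}. \<Sum>d\<in>J. a (Inr C) d * x d) = 0"
        using x(2) by (intro sum.neutral) (auto simp: Eq_def)
      ultimately show ?thesis using True by simp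
    qed
    have closed: "(\<Sum>u\<in>N v. \<omega> (u, v)) = 0" if "v \<in> V" for v
    proof (cases "v \<in> W")
      case True
      then show ?thesis using allW vs that by simp
    next
      case False
      then have "a (Inl v) d = 0" if "d \<in> J" for d using JW[OF that] by (auto simp: a_def)
      then show ?thesis using vs[OF that] by simp
    qed
    have "\<exists>\<phi>. (\<forall>d\<in>D. \<phi> (fs d) = \<phi> d) \<and> (\<forall>d\<in>D. \<omega> d = \<phi> d - \<phi> (prod.swap d)) \<and> \<phi> outer = 0"
      by (rule dual_exact) (simp_all only: anti closed)
    then obtain \<phi> where \<phi>: "\<forall>d\<in>D. \<phi> (fs d) = \<phi> d"
      "\<forall>d\<in>D. \<omega> d = \<phi> d - \<phi> (prod.swap d)" by (elim exE conjE) (rule that)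
    have "\<phi> (prod.swap d) = \<phi> d" if "d \<in> D - A" for d
    proof -
      have "d \<notin> J" using that J(1) by auto
      moreover have "prod.swap d \<notin> J"
      proof
        assume "prod.swap d \<in> J"
        then have "prod.swap (prod.swap d) \<in> A" using A(2) J(1) by blast
        then show False using that by simp
      qed
      ultimately have "\<omega> d = 0" by (simp add: \<omega>_def)
      then show ?thesis using bspec[OF \<phi>(2), of d] that by simp
    qed
    then have const: "\<phi> e = \<phi> d" if "e \<in> cls A d" for e d
      using cls_const[of \<phi> A e d] \<phi>(1) that by auto
    define g where "g C = \<phi> (SOME d. d \<in> C)" for C
    have g: "g (cls A d) = \<phi> d" for d
    proof -
      have "(SOME e. e \<in> cls A d) \<in> cls A d" using cls_self by (rule someI)
      then show ?thesis using const by (simp add: g_def)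
    qed
    have "(\<Sum>d\<in>J. x d * x d) = (\<Sum>d\<in>J. x d * (\<Sum>C\<in>?K. a (Inr C) d * g C))"
    proof (rule sum.cong)
      fix d assume d: "d \<in> J"
      then have dD: "d \<in> D" using JD by auto
      have "(\<Sum>C\<in>?K. a (Inr C) d * g C) = \<phi> d - \<phi> (prod.swap d)"
        using JK[of d g] JK[of "prod.swap d" g] dD g
        by (simp add: a_def left_diff_distrib sum_subtractf)
      also have "\<dots> = \<omega> d" using bspec[OF \<phi>(2) dD] by simp
      also have "\<dots> = x d" using d by (simp add: \<omega>_def)
      finally show "x d * x d = x d * (\<Sum>C\<in>?K. a (Inr C) d * g C)" by simp
    qed simp
    also have "\<dots> = (\<Sum>C\<in>?K. g C * (\<Sum>d\<in>J. a (Inr C) d * x d))"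
      unfolding sum_distrib_left by (subst sum.swap) (simp add: mult_ac)
    also have "\<dots> = 0" using allK by simp
    finally have "\<forall>d\<in>J. x d = 0" using finJ by (simp add: sum_nonneg_eq_0_iff)
    then show False using x by auto
  qed
qed

text \<open>At every vertex as many boundary darts of \<open>C\<close> enter as leave, and the graph is simple.\<close>
lemma class_boundary:
  assumes C: "d0 \<in> C" "C \<subseteq> D" "\<And>d. d \<in> D \<Longrightarrow> fs d \<in> C \<longleftrightarrow> d \<in> C" "C \<noteq> D"
  shows "card {d \<in> C. prod.swap d \<notin> C} \<ge> 3"
proof -
  let ?B = "{d \<in> C. prod.swap d \<notin> C}"
  have "\<exists>d\<in>D. d \<in> C \<and> prod.swap d \<notin> C"
  proof (rule ccontr)
    assume no: "\<not> ?thesis"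
    have "d \<in> C" if "d \<in> D" for d
    proof (rule dart_closed[OF _ C(1) _ _ that])
      show "d0 \<in> D" using C(1,2) by (rule subsetD[rotated])
      show "fs e \<in> C" if "e \<in> D" "e \<in> C" for e using C(3) that by simp
      show "prod.swap e \<in> C" if "e \<in> D" "e \<in> C" for e using no that by blast
    qed
    then have "D \<subseteq> C" by (rule subsetI)
    then show False using C(2,4) by (metis subset_antisym)
  qed
  then obtain x y where xy: "(x, y) \<in> C" "(y, x) \<notin> C" by auto
  define \<phi> where "\<phi> d = (if d \<in> C then 1 else 0 :: real)" for d
  have next_dart: "\<exists>w. (v, w) \<in> C \<and> (w, v) \<notin> C" if uv: "(u, v) \<in> C" "(v, u) \<notin> C" for u v
  proof (rule ccontr)
    assume no: "\<not> ?thesis"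
    have "E u v" using subsetD[OF C(2) uv(1)] by simp
    then have uN: "u \<in> N v" and vV: "v \<in> V" using E_V by (auto simp: N_iff E_sym)
    have "(\<Sum>w\<in>N v. \<phi> (w, v) - \<phi> (v, w)) > 0"
    proof (rule sum_pos2[OF finN uN])
      show "0 < \<phi> (u, v) - \<phi> (v, u)" using uv by (simp add: \<phi>_def)
      show "0 \<le> \<phi> (w, v) - \<phi> (v, w)" for w using no by (auto simp: \<phi>_def)
    qed
    moreover have "(\<Sum>w\<in>N v. \<phi> (w, v) - \<phi> (v, w)) = 0"
      by (rule face_boundary_closed[OF _ vV]) (use C(3) in \<open>auto simp: \<phi>_def\<close>)
    ultimately show False by simp
  qed
  obtain z where z: "(y, z) \<in> C" "(z, y) \<notin> C" using next_dart[OF xy] by auto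
  obtain w where w: "(z, w) \<in> C" "(w, z) \<notin> C" using next_dart[OF z] by auto
  \<comment> \<open>The walk cannot turn back: \<open>(y, z)\<close> lies in \<open>C\<close> and
    \<open>(y, x)\<close> does not. Closing up with \<open>w = x\<close> is allowed.\<close>
  have "x \<noteq> y" "y \<noteq> z" "z \<noteq> x" using xy z C(2) E_irr by auto
  then have c3: "card {(x, y), (y, z), (z, w)} = 3" by auto
  have sub: "{(x, y), (y, z), (z, w)} \<subseteq> ?B" using xy z w by auto
  have fin: "finite ?B" by (rule finite_subset[OF _ finD]) (use C(2) in blast)
  show ?thesis using card_mono[OF fin sub] c3 by simp
qed

end

section \<open>Combinatorial 4-PPTs\<close>

locale four_ppt = plane_map V E rot outer
  for V :: "'a set" and E :: "'a \<Rightarrow> 'a \<Rightarrow> bool" and rot :: "'a \<Rightarrow> 'a \<Rightarrow> 'a" and outer :: "'a \<times> 'a" +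
  fixes reflex :: "'a \<times> 'a \<Rightarrow> bool"
  assumes ppt: "comb_4ppt V E rot outer reflex"
    and big: "card (dart_face rot outer) \<ge> 3"
begin

abbreviation Ou where "Ou \<equiv> dart_face rot outer"
definition B where "B = snd ` Ou"
definition I where "I = V - B"
definition IF where "IF = Fs - {Ou}"

lemma Ou_face: "Ou \<in> Fs" using face_in_faces outer_D by blast

lemma Ou_D: "d \<in> Ou \<Longrightarrow> d \<in> D" using face_D outer_D by blast

lemma IF_face: "F \<in> IF \<Longrightarrow> F \<in> Fs" by (simp add: IF_def)

lemma face_cases: "d \<in> D \<Longrightarrow> d \<in> Ou \<or> (\<exists>F\<in>IF. d \<in> F)"
proof -
  assume "d \<in> D"
  then have "dart_face rot d \<in> Fs" by (rule face_in_faces)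
  then show ?thesis using face_self[of d] unfolding IF_def by (metis DiffI singletonD)
qed

lemma IF_disj: "F \<in> IF \<Longrightarrow> d \<in> F \<Longrightarrow> d \<notin> Ou"
  using faces_memD(2)[of F d] faces_memD(2)[OF Ou_face, of d] by (auto simp: IF_def)

lemma IF_unique: "F \<in> IF \<Longrightarrow> G \<in> IF \<Longrightarrow> d \<in> F \<Longrightarrow> d \<in> G \<Longrightarrow> F = G"
  using faces_memD(2)[of F d] faces_memD(2)[of G d] by (auto simp: IF_def)

lemma outer_reflex: "d \<in> Ou \<Longrightarrow> reflex d"
  using ppt by (simp add: comb_4ppt_def comb_pt_def)

lemma reflex_unique:
  assumes "d \<in> D" "e \<in> D" "reflex d" "reflex e" "snd d = snd e" shows "d = e"
proof -
  let ?S = "{d'\<in>D. snd d' = snd e \<and> reflex d'}"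
  have "snd e \<in> V" using assms(2) by (auto simp: darts_def)
  then have c: "card ?S \<le> Suc 0" using ppt by (simp add: comb_4ppt_def comb_pt_def)
  have fin: "finite ?S" using finD by simp
  have "\<forall>x\<in>?S. \<forall>y\<in>?S. x = y" using c unfolding card_le_Suc0_iff_eq[OF fin] .
  moreover have "d \<in> ?S" "e \<in> ?S" using assms by auto
  ultimately show ?thesis by blast
qed

lemma reflex_ex: "v \<in> V \<Longrightarrow> \<exists>d\<in>D. snd d = v \<and> reflex d"
  using ppt by (simp add: comb_4ppt_def pointed_vertex_def)

lemma IF_card: "F \<in> IF \<Longrightarrow> card F = 3 \<or> card F = 4"
  and IF_convex: "F \<in> IF \<Longrightarrow> card {d\<in>F. \<not> reflex d} = 3"
  using ppt by (auto simp: comb_4ppt_def comb_pt_def IF_def)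

lemma IF_fin: "F \<in> IF \<Longrightarrow> finite F" using fin_face IF_face by blast

text \<open>All outer angles are reflex and a vertex has at most one reflex angle, so the outer walk
  repeats no vertex.\<close>

lemma snd_Ou_inj: "inj_on snd Ou"
  by (rule inj_onI) (use reflex_unique outer_reflex Ou_D in blast)

lemma fin_Ou: "finite Ou" using fin_face Ou_face by blast

lemma B_V: "B \<subseteq> V" using Ou_D by (fastforce simp: B_def darts_def)

lemma finI: "finite I" "finite B" using finV B_V finite_subset by (auto simp: I_def)

lemma card_B: "card B = card Ou" unfolding B_def by (rule card_image[OF snd_Ou_inj])

lemma card_V: "card V = card Ou + card I"
proof -
  have "card V = card (B \<union> I)" using B_V by (simp add: I_def Un_absorb1)
  also have "\<dots> = card B + card I" using finI by (intro card_Un_disjoint) (auto simp: I_def)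
  finally show ?thesis by (simp add: card_B)
qed

lemma fst_Ou: "d \<in> Ou \<Longrightarrow> fst d \<in> B"
proof -
  assume d: "d \<in> Ou"
  then have dD: "d \<in> D" by (rule Ou_D)
  obtain n where n: "n > 0" "(fs ^^ n) d = d" using fs_period[OF dD] by auto
  then obtain m where m: "n = Suc m" by (cases n) auto
  have "(fs ^^ m) d \<in> Ou" using face_eq[OF outer_D d] unfolding dart_face_def by blast
  moreover have "fst d = snd ((fs ^^ m) d)"
      using n m by (metis fsucc_def fst_conv funpow.simps(2) comp_apply)
  ultimately show ?thesis by (auto simp: B_def)
qed

section \<open>Boundary walks of the interior faces\<close>

lemma triangle_face:
  assumes F: "F \<in> IF" "card F = 3" "(x, y) \<in> F"
  shows "F = {(x, y), (y, rot y x), (rot y x, x)}" "rot (rot y x) y = x" "rot x (rot y x) = y"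
    "distinct [x, y, rot y x]" "E x y" "E y (rot y x)" "E (rot y x) x"
proof -
  have D: "(x, y) \<in> D" and Feq: "dart_face rot (x, y) = F" using faces_memD[OF IF_face] F by auto
  note e = face_enum[OF D, of 3, unfolded Feq, OF F(2)]
  let ?z = "rot y x"
  have "{..<3} = {0, 1, 2 :: nat}" by auto
  then have F3: "F = {(x, y), (y, ?z), (?z, rot ?z y)}" using e(2) by (simp add: numeral_eq_Suc)
  have 3: "(rot ?z y, rot (rot ?z y) ?z) = (x, y)"
      using e(1) by (simp add: numeral_eq_Suc del: prod.inject)
  then show r1: "rot ?z y = x" by simp
  from 3[unfolded r1] show "rot x ?z = y" by (rule conjunct2[OF prod.inject[THEN iffD1]])
  show "F = {(x, y), (y, ?z), (?z, x)}" using F3 r1 by simp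
  have "(x, y) \<in> D" "(y, ?z) \<in> D" "(?z, x) \<in> D"
      using faces_memD(1)[OF IF_face[OF F(1)]] \<open>F = {(x, y), (y, ?z), (?z, x)}\<close> by auto
  then show "E x y" "E y ?z" "E ?z x" by auto
  then show "distinct [x, y, ?z]" using E_irr[of x y] E_irr[of y ?z] E_irr[of ?z x] by auto
qed

lemma deg1:
  assumes "E v u" "rot v u = u" "d \<in> D" "snd d = v" shows "d = (u, v)"
proof -
  have "fst d = u" by (rule rot_closed[of v "\<lambda>w. w = u" u "fst d"])
      (use assms in \<open>auto simp: N_iff D_iff dest: E_sym\<close>)
  then show ?thesis using assms by (cases d) auto
qed

text \<open>A vertex of degree one has a single angle, and pointedness makes it reflex. This
  excludes degenerate quadrilaterals below.\<close>

lemma deg1_reflex: "E v u \<Longrightarrow> rot v u = u \<Longrightarrow> reflex (u, v)"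
proof -
  assume a: "E v u" "rot v u = u"
  then have "v \<in> V" using E_V by blast
  from reflex_ex[OF this] obtain d where "d \<in> D" "snd d = v" "reflex d" by blast
  then show ?thesis using deg1[OF a, of d] by simp
qed

lemma quad_reflex_unique:
  assumes "F \<in> IF" "card F = 4" shows "\<exists>r. {d\<in>F. reflex d} = {r}"
proof -
  have "{d\<in>F. reflex d} = F - {d\<in>F. \<not> reflex d}" by auto
  then have "card {d\<in>F. reflex d} = 1"
    using IF_convex[OF assms(1)] assms IF_fin[of F] by (simp add: card_Diff_subset)
  then show ?thesis by (metis card_1_singletonE)
qed

text \<open>If two opposite vertices coincided, some vertex of the walk would have degree one; its
  reflex angle would have to be \<open>(a, v)\<close>, which leaves either fewer than four darts or
  a loop. An outer vertex already has a reflex angle in the outer face, so \<open>v\<close> is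
  interior.\<close>

lemma quad_face:
  assumes F: "F \<in> IF" "card F = 4" "(a, v) \<in> F" "reflex (a, v)"
  shows "F = {(a, v), (v, rot v a), (rot v a, rot (rot v a) v), (rot (rot v a) v, a)}"
    "rot (rot (rot v a) v) (rot v a) = a" "rot a (rot (rot v a) v) = v"
    "distinct [a, v, rot v a, rot (rot v a) v]" "v \<in> I"
    "E a v" "E v (rot v a)" "E (rot v a) (rot (rot v a) v)" "E (rot (rot v a) v) a"
    "\<And>d. d \<in> F \<Longrightarrow> reflex d \<longleftrightarrow> d = (a, v)"
proof -
  have D: "(a, v) \<in> D" and Feq: "dart_face rot (a, v) = F" using faces_memD[OF IF_face] F by auto
  note e = face_enum[OF D, of 4, unfolded Feq, OF F(2)]
  let ?b = "rot v a" let ?c = "rot ?b v"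
  have "{..<4} = {0, 1, 2, 3 :: nat}" by auto
  then have F4: "F = {(a, v), (v, ?b), (?b, ?c), (?c, rot ?c ?b)}"
      using e(2) by (simp add: numeral_eq_Suc)
  have 4: "(rot ?c ?b, rot (rot ?c ?b) ?c) = (a, v)"
      using e(1) by (simp add: numeral_eq_Suc del: prod.inject)
  then show r1: "rot ?c ?b = a" by simp
  from 4[unfolded r1] show r2: "rot a ?c = v" by (rule conjunct2[OF prod.inject[THEN iffD1]])
  note r = r1 r2
  then show Fset: "F = {(a, v), (v, ?b), (?b, ?c), (?c, a)}" using F4 by simp
  have "(a, v) \<in> D" "(v, ?b) \<in> D" "(?b, ?c) \<in> D" "(?c, a) \<in> D"
    using faces_memD(1)[OF IF_face[OF F(1)]] Fset by auto
  then show E: "E a v" "E v ?b" "E ?b ?c" "E ?c a" by auto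
  obtain r0 where r0: "{d\<in>F. reflex d} = {r0}" using quad_reflex_unique[OF F(1,2)] by auto
  then have r0': "r0 = (a, v)" using F by auto
  then show ru: "reflex d \<longleftrightarrow> d = (a, v)" if "d \<in> F" for d using r0 that by auto
  have n1: "a \<noteq> v" "v \<noteq> ?b" "?b \<noteq> ?c" "?c \<noteq> a" using E E_irr by blast+
  have "a \<noteq> ?b"
  proof
    assume ab: "a = ?b"
    have "rot ?c ?b = ?b" using r(1) ab by simp
    then have "reflex (?b, ?c)" using E(3) E_sym by (intro deg1_reflex) auto
    then have "(?b, ?c) = (a, v)" using ru Fset by auto
    then have "card F \<le> card {(a, v), (v, a)}" using Fset ab by (intro card_mono) auto
    then show False using F(2) card_insert_le_m1[of 2 "{(v, a)}" "(a, v)"] by simp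
  qed
  moreover have "v \<noteq> ?c"
  proof
    assume vc: "v = ?c"
    have "rot ?b v = v" using vc by simp
    then have "reflex (v, ?b)" using E(2) E_sym by (intro deg1_reflex) auto
    then have "(v, ?b) = (a, v)" using ru Fset by auto
    then show False using n1 by auto
  qed
  ultimately show "distinct [a, v, ?b, ?c]" using n1 by auto
  show "v \<in> I"
  proof (rule ccontr)
    assume "v \<notin> I"
    then have "v \<in> B" using E E_V by (auto simp: I_def)
    then obtain d where d: "d \<in> Ou" "snd d = v" by (auto simp: B_def)
    have "d = (a, v)" using reflex_unique[of d "(a, v)"] d outer_reflex Ou_D D F by auto
    then show False using IF_disj[OF F(1,3)] d by auto
  qed
qed

text \<open>For an interior vertex \<open>v\<close> the quadrilateral with its reflex angle is \<open>fa v, v, fb v, fc v\<close>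
  in face order.\<close>
definition fa where "fa v = (SOME a. E a v \<and> reflex (a, v))"
definition fb where "fb v = rot v (fa v)"
definition fc where "fc v = rot (fb v) v"
definition Q where "Q v = {(fa v, v), (v, fb v), (fb v, fc v), (fc v, fa v)}"

lemma fa: "v \<in> V \<Longrightarrow> E (fa v) v \<and> reflex (fa v, v)"
  unfolding fa_def by (rule someI_ex) (use reflex_ex[of v] in \<open>auto simp: D_iff\<close>)

lemma fa_unique: "E a v \<Longrightarrow> reflex (a, v) \<Longrightarrow> a = fa v"
  using reflex_unique[of "(a, v)" "(fa v, v)"] fa[of v] E_V[of a v] by auto

lemma quad:
  assumes v: "v \<in> I"
  shows "Q v \<in> IF" "card (Q v) = 4" "rot v (fa v) = fb v" "rot (fb v) v = fc v"
      "rot (fc v) (fb v) = fa v"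
    "rot (fa v) (fc v) = v" "distinct [fa v, v, fb v, fc v]"
    "E (fa v) v" "E v (fb v)" "E (fb v) (fc v)" "E (fc v) (fa v)"
    "\<And>d. d \<in> Q v \<Longrightarrow> reflex d \<longleftrightarrow> d = (fa v, v)" "fa v \<in> V" "fb v \<in> V" "fc v \<in> V"
proof -
  have vV: "v \<in> V" using v by (simp add: I_def)
  have f: "E (fa v) v" "reflex (fa v, v)" using fa[OF vV] by auto
  have "(fa v, v) \<notin> Ou" using v by (force simp: I_def B_def)
  then obtain F where F: "F \<in> IF" "(fa v, v) \<in> F" using face_cases[of "(fa v, v)"] f by auto
  have F4: "card F = 4"
  proof (rule ccontr)
    assume "card F \<noteq> 4"
    then have "card F = 3" using IF_card F by auto
    then have "{d\<in>F. \<not> reflex d} = F"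
      using IF_convex[OF F(1)] IF_fin[OF F(1)] by (intro card_subset_eq) auto
    then show False using F f by auto
  qed
  note q = quad_face[OF F(1) F4 F(2) f(2)]
  show r: "rot v (fa v) = fb v" "rot (fb v) v = fc v" by (auto simp: fb_def fc_def)
  have QF: "Q v = F" using q(1) r by (simp add: Q_def)
  then show "Q v \<in> IF" "card (Q v) = 4" using F F4 by auto
  show "rot (fc v) (fb v) = fa v" "rot (fa v) (fc v) = v" "distinct [fa v, v, fb v, fc v]"
    "E (fa v) v" "E v (fb v)" "E (fb v) (fc v)" "E (fc v) (fa v)"
    "\<And>d. d \<in> Q v \<Longrightarrow> reflex d \<longleftrightarrow> d = (fa v, v)" using q r unfolding QF by simp_all
  then show "fa v \<in> V" "fb v \<in> V" "fc v \<in> V" using E_V by blast+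
qed

lemma interior_face_cases:
  assumes "F \<in> IF" shows "card F = 3 \<or> (\<exists>v\<in>I. F = Q v)"
proof (cases "card F = 4")
  case True
  from quad_reflex_unique[OF assms True] obtain a v where r: "(a, v) \<in> F" "reflex (a, v)" by auto
  note q = quad_face[OF assms True r]
  have "a = fa v" using fa_unique q(6) r by auto
  then have "F = Q v" using q(1) by (simp add: Q_def fb_def fc_def)
  then show ?thesis using q(5) by auto
qed (use IF_card assms in auto)

lemma Q_inj: "inj_on Q I"
proof (rule inj_onI)
  fix v w assume vw: "v \<in> I" "w \<in> I" "Q v = Q w"
  have "(fa v, v) \<in> Q v" by (simp add: Q_def)
  then have "(fa v, v) \<in> Q w" unfolding vw(3) .
  moreover have "reflex (fa v, v)" using vw fa by (auto simp: I_def)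
  ultimately show "v = w" using quad(12)[OF vw(2)] by auto
qed

definition TF where "TF = {F\<in>IF. card F = 3}"

lemma IF_split: "IF = TF \<union> Q ` I" "TF \<inter> Q ` I = {}"
  using interior_face_cases quad(1,2) by (auto simp: TF_def)

lemma finTF: "finite TF" "finite IF" using finFs by (auto simp: TF_def IF_def)

lemma sum_IF: "(\<Sum>F\<in>IF. g F) = (\<Sum>F\<in>TF. g F) + (\<Sum>v\<in>I. g (Q v))"
proof -
  have "(\<Sum>F\<in>IF. g F) = sum g TF + sum g (Q ` I)"
    unfolding IF_split(1) using finTF finI IF_split(2) by (intro sum.union_disjoint) auto
  also have "sum g (Q ` I) = (\<Sum>v\<in>I. g (Q v))" using sum.reindex[OF Q_inj] by simp
  finally show ?thesis .
qed

lemma sum_D: "(\<Sum>d\<in>D. g d) = (\<Sum>d\<in>Ou. g d) + (\<Sum>F\<in>TF. \<Sum>d\<in>F. g d) + (\<Sum>v\<in>I. \<Sum>d\<in>Q v. g d)"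
proof -
  have "(\<Sum>d\<in>D. g d) = (\<Sum>d\<in>Ou. g d) + (\<Sum>F\<in>IF. \<Sum>d\<in>F. g d)"
    unfolding sum_faces IF_def using Ou_face finFs by (simp add: sum.remove)
  then show ?thesis by (simp add: sum_IF add.assoc)
qed

section \<open>Counting triangles and fathers\<close>

text \<open>Count darts by faces and insert this into Euler's formula: the contributions of the
  quadrilaterals cancel against those of the interior vertices, leaving the number for a
  triangulated polygon.\<close>

lemma card_TF: "card TF + 2 = card Ou"
proof -
  have "card D = card Ou + 3 * card TF + 4 * card I"
    using sum_D[of "\<lambda>_. 1::nat"] quad(2) by (simp add: TF_def)
  moreover have "card Fs = card IF + 1"
    using Ou_face finFs unfolding IF_def by (simp) (metis card_gt_0_iff Suc_pred empty_iff)
  moreover have "card IF = card TF + card I"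
    using sum_IF[of "\<lambda>_. 1::nat"] by simp
  ultimately show ?thesis using euler card_V by simp
qed

text \<open>Take the subgraph formed by the quadrilaterals of \<open>X\<close>. They remain faces of
  it, with four darts each, and each of the k other faces has at least three boundary darts. The
  subgraph inequality gives 2 |W| \<ge> 2 |X| + k + 4. The outer dart lies in one of the other
  faces, so k \<ge> 1, and integrality rounds 5/2 up to 3.\<close>

lemma father_expansion:
  assumes X: "X \<subseteq> I" "X \<noteq> {}"
  shows "card X + 3 \<le> card (X \<union> fa ` X \<union> fb ` X \<union> fc ` X)"
proof -
  let ?W = "X \<union> fa ` X \<union> fb ` X \<union> fc ` X"
  define A where "A = (\<Union>v\<in>X. Q v \<union> prod.swap ` Q v)"
  have finX: "finite X" using X finI finite_subset by auto
  have QA: "Q v \<subseteq> A" if "v \<in> X" for v using that by (auto simp: A_def)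
  have QIF: "Q v \<in> IF" if "v \<in> X" for v using that X quad(1) by auto
  have AD: "A \<subseteq> D"
  proof -
    have "Q v \<subseteq> D" if "v \<in> X" for v using faces_memD(1)[OF IF_face[OF QIF[OF that]]] by blast
    then show ?thesis unfolding A_def using swap_D by blast
  qed
  have Aswap: "prod.swap d \<in> A" if "d \<in> A" for d
    using that by (auto simp: A_def)
  have finA: "finite A" using AD finD finite_subset by auto
  have AW: "fst d \<in> ?W" if "d \<in> A" for d using that by (auto simp: A_def Q_def)
  let ?K = "cls A ` D"
  obtain v0 where v0: "v0 \<in> X" using X by auto
  have "A \<noteq> {}" using QA[OF v0] by (auto simp: Q_def)
  from subgraph_euler[OF AD Aswap this AW] finX
  have euler: "card A + 4 \<le> 2 * card ?W + 2 * card ?K" by auto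
  \<comment> \<open>All darts of \<open>Q v\<close> and their reversals lie in \<open>A\<close>, so
    nothing is merged with this face.\<close>
  have Qcls: "cls A d = Q v" if vX: "v \<in> X" and dQ: "d \<in> Q v" for v d
  proof
    have dD: "d \<in> D" using vX dQ QA AD by blast
    have "e \<in> Q v" if e: "e \<in> cls A d" for e
    proof (rule cls_invariant[OF e, where P = "\<lambda>e. e \<in> Q v"])
      fix x y assume xy: "(x, y) \<in> step A"
      then consider "x \<in> D" "y = fs x" | "x \<in> D - A" "y = prod.swap x" unfolding step_def by blast
      then show "x \<in> Q v \<longleftrightarrow> y \<in> Q v"
      proof cases
        case 1
        have Qf: "Q v \<in> Fs" using QIF \<open>v \<in> X\<close> IF_face by blast
        show ?thesis
        proof
          show "x \<in> Q v \<Longrightarrow> y \<in> Q v" using faces_memD(3)[OF Qf] 1 by auto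
          assume "y \<in> Q v"
          then have "dart_face rot y = Q v" by (rule faces_memD(2)[OF Qf])
          then have "dart_face rot x = Q v" using face_fs_eq 1 by auto
          then show "x \<in> Q v" using face_self by blast
        qed
      next
        case 2
        then have "x \<notin> A" by blast
        moreover have "y \<notin> A"
        proof
          assume "y \<in> A"
          from Aswap[OF this] have "x \<in> A" using 2(2) by simp
          then show False using 2 by blast
        qed
        ultimately show ?thesis using QA \<open>v \<in> X\<close> by blast
      qed
    qed (rule dQ)
    then show "cls A d \<subseteq> Q v" by blast
    have Qd: "Q v = dart_face rot d" using faces_memD(2)[OF IF_face[OF QIF[OF vX]] dQ] by simp
    have "dart_face rot d \<subseteq> cls A d \<inter> D"
    proof (rule face_subset)
      show "d \<in> cls A d \<inter> D" using dD cls_self by blast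
      show "fs e \<in> cls A d \<inter> D" if "e \<in> cls A d \<inter> D" for e
      proof -
        have "cls A (fs e) = cls A d" using cls_fs[of e A] cls_eq[of e A d] that by simp
        then have "fs e \<in> cls A d" using cls_self[of "fs e" A] by simp
        then show ?thesis using fs_D that by blast
      qed
    qed
    then show "Q v \<subseteq> cls A d" unfolding Qd by blast
  qed
  have QK: "Q ` X \<subseteq> ?K"
  proof -
    have "Q v \<in> ?K" if "v \<in> X" for v
    proof -
      have "(fa v, v) \<in> Q v" by (simp add: Q_def)
      moreover from this have "(fa v, v) \<in> D" using QA[OF that] AD by blast
      ultimately show ?thesis using Qcls[OF that, of "(fa v, v)", symmetric] by simp
    qed
    then show ?thesis by blast
  qed
  have finK: "finite ?K" using finD by simp
  have Kdisj: "C = C'" if "C \<in> ?K" "C' \<in> ?K" "d \<in> C" "d \<in> C'" for C C' d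
  proof -
    from that(1) obtain e where "C = cls A e" by (rule imageE)
    moreover from that(2) obtain e' where "C' = cls A e'" by (rule imageE)
    ultimately show ?thesis using cls_eq[of d A e] cls_eq[of d A e'] that(3,4) by simp
  qed
  have "D \<subseteq> \<Union> ?K"
  proof
    fix d assume "d \<in> D"
    then have "cls A d \<in> ?K" by (rule imageI)
    then show "d \<in> \<Union> ?K" by (rule UnionI) (rule cls_self)
  qed
  then have "A = A \<inter> \<Union> ?K" using AD by (simp only: Int_absorb2 order.trans)
  also have "\<dots> = (\<Union>C\<in>?K. A \<inter> C)" by (rule Int_Union)
  finally have "card A = card (\<Union>C\<in>?K. A \<inter> C)" by (rule arg_cong)
  also have "\<dots> = (\<Sum>C\<in>?K. card (A \<inter> C))"
  proof (rule card_UN_disjoint[OF finK])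
    show "\<forall>C\<in>?K. finite (A \<inter> C)" using finA by simp
    show "\<forall>C\<in>?K. \<forall>C'\<in>?K. C \<noteq> C' \<longrightarrow> A \<inter> C \<inter> (A \<inter> C') = {}"
    proof (intro ballI impI equals0I)
      fix C C' d assume "C \<in> ?K" "C' \<in> ?K" "C \<noteq> C'" "d \<in> A \<inter> C \<inter> (A \<inter> C')"
      then show False using Kdisj[of C C' d] by simp
    qed
  qed
  also have "\<dots> = (\<Sum>C\<in>?K - Q ` X. card (A \<inter> C)) + (\<Sum>C\<in>Q ` X. card (A \<inter> C))"
    by (rule sum.subset_diff[OF QK finK])
  finally have cA1: "card A = (\<Sum>C\<in>?K - Q ` X. card (A \<inter> C)) + (\<Sum>C\<in>Q ` X. card (A \<inter> C))" .
  have cA2: "(\<Sum>C\<in>Q ` X. card (A \<inter> C)) = 4 * card X"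
  proof -
    have "(\<Sum>C\<in>Q ` X. card (A \<inter> C)) = (\<Sum>v\<in>X. card (A \<inter> Q v))"
      by (rule sum.reindex_cong[OF inj_on_subset[OF Q_inj X(1)]]) auto
    also have "\<dots> = (\<Sum>v\<in>X. 4)"
    proof (rule sum.cong)
      fix v assume v: "v \<in> X"
      then have "A \<inter> Q v = Q v" using QA by blast
      then show "card (A \<inter> Q v) = 4" using quad(2)[of v] v X by auto
    qed simp
    finally show ?thesis by simp
  qed
  have cA3: "(\<Sum>C\<in>?K - Q ` X. 3) \<le> (\<Sum>C\<in>?K - Q ` X. card (A \<inter> C))"
  proof (rule sum_mono)
    fix C assume C: "C \<in> ?K - Q ` X"
    then obtain d where d: "d \<in> D" "C = cls A d" by blast
    have CD: "C \<subseteq> D" using d cls_D by auto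
    have "(fa v0, v0) \<notin> C"
    proof
      assume "(fa v0, v0) \<in> C"
      then have "C = cls A (fa v0, v0)" using d(2) cls_eq[of "(fa v0, v0)" A d] by simp
      then have "C = Q v0" using Qcls[OF v0, of "(fa v0, v0)"] by (simp add: Q_def)
      then show False using C v0 by auto
    qed
    moreover have "(fa v0, v0) \<in> D" using QA[OF v0] AD by (auto simp: Q_def)
    ultimately have CnD: "C \<noteq> D" by blast
    have "3 \<le> card {e \<in> C. prod.swap e \<notin> C}"
    proof (rule class_boundary[OF _ CD _ CnD])
      show "d \<in> C" using d cls_self by auto
      show "fs e \<in> C \<longleftrightarrow> e \<in> C" if "e \<in> D" for e
      proof -
        have mem: "x \<in> C \<longleftrightarrow> cls A x = C" for x
          unfolding d(2) using cls_eq[of x A d] cls_self[of x A] by metis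
        show ?thesis unfolding mem cls_fs[OF that, of A] ..
      qed
    qed
    also have "\<dots> \<le> card (A \<inter> C)"
    proof (rule card_mono)
      show "{e \<in> C. prod.swap e \<notin> C} \<subseteq> A \<inter> C"
      proof
        fix e assume e: "e \<in> {e \<in> C. prod.swap e \<notin> C}"
        have "e \<in> A"
        proof (rule ccontr)
          assume "e \<notin> A"
          then have "cls A (prod.swap e) = cls A e" using e CD by (intro cls_swap) blast
          moreover have "e \<in> cls A d" using e unfolding d(2) by blast
          ultimately have "cls A (prod.swap e) = C" unfolding d(2) by (simp only: cls_eq)
          then have "prod.swap e \<in> C" using cls_self[of "prod.swap e" A] by blast
          then show False using e by simp
        qed
        then show "e \<in> A \<inter> C" using e by blast
      qed
    qed (use finA in auto)
    finally show "3 \<le> card (A \<inter> C)" .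
  qed
  have cA: "4 * card X + card (?K - Q ` X) * 3 \<le> card A"
    using cA1 cA2 cA3 unfolding sum_constant of_nat_id by linarith
  have cQX: "card (Q ` X) = card X" by (rule card_image[OF inj_on_subset[OF Q_inj X(1)]])
  have cK: "card ?K = card X + card (?K - Q ` X)"
    using card_Diff_subset[OF finite_imageI[OF finX] QK] card_mono[OF finK QK] cQX by linarith
  have "cls A outer \<in> ?K - Q ` X"
  proof -
    have "outer \<notin> Q v" if "v \<in> X" for v using IF_disj[OF QIF[OF that], of outer] face_self by blast
    then have "cls A outer \<noteq> Q v" if "v \<in> X" for v using cls_self[of outer A] that by metis
    then show ?thesis using outer_D by (intro DiffI imageI) (auto simp: image_iff)
  qed
  then have "card (?K - Q ` X) > 0"
      using finK unfolding card_gt_0_iff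
          by (intro conjI finite_Diff) (rule notI, simp only: empty_iff)
  then show ?thesis using euler cA cK by linarith
qed

sublocale father_system V I fa fb fc
  by unfold_locales (use finV I_def quad(13-15) father_expansion in auto)

end

section \<open>Orientations, angles and crossing numbers\<close>

text \<open>Twice the signed area of the triangle \<open>a b c\<close>, positive for
  counterclockwise order.\<close>

definition det3 :: "complex \<Rightarrow> complex \<Rightarrow> complex \<Rightarrow> real" where
  "det3 a b c = (Re b - Re a) * (Im c - Im a) - (Im b - Im a) * (Re c - Re a)"

lemma det3_rotate: "det3 b c a = det3 a b c" by (simp add: det3_def algebra_simps)
lemma det3_swap: "det3 b a c = - det3 a b c" by (simp add: det3_def algebra_simps)
lemma det3_same [simp]: "det3 a a c = 0" "det3 a b a = 0" "det3 a b b = 0"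
  by (simp_all add: det3_def algebra_simps)

lemma ccw_angle_bounds: "0 < ccw_angle a b" "ccw_angle a b \<le> 2 * pi"
proof -
  have "- pi < Arg (b / a) \<and> Arg (b / a) \<le> pi" by (rule Arg_bounded)
  then have "- pi < Arg (b / a)" "Arg (b / a) \<le> pi" by auto
  then show "0 < ccw_angle a b" "ccw_angle a b \<le> 2 * pi"
    using pi_gt_zero unfolding ccw_angle_def by (auto split: if_splits)
qed

lemma ccw_angle_cis: "b / a = of_real (cmod (b / a)) * cis (ccw_angle a b)"
proof -
  have 1: "b / a = of_real (cmod (b / a)) * cis (Arg (b / a))"
    by (metis rcis_cmod_Arg rcis_def)
  have "cis (ccw_angle a b) = cis (Arg (b / a))"
    by (simp add: ccw_angle_def complex_eq_iff)
  then show ?thesis using 1 by simp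
qed

lemma cis_eq_1:
  assumes "cis t = 1" "\<bar>t\<bar> < 2 * pi" shows "t = 0"
proof -
  have "cos t = 1" using arg_cong[OF assms(1), of Re] by simp
  then obtain n :: int where n: "t = n * 2 * pi" by (auto simp: cos_one_2pi_int)
  have "\<bar>real_of_int n\<bar> < 1" using assms(2) pi_gt_zero unfolding n by (simp add: abs_mult)
  then have "n = 0" by linarith
  then show ?thesis using n by simp
qed

lemma cis_eq_pos:
  assumes "of_real r * cis s = of_real r' * cis t" "r > 0" "r' > 0" shows "cis s = cis t"
proof -
  have "cmod (of_real r * cis s) = cmod (of_real r' * cis t)" using assms(1) by simp
  then have "r = r'" using assms(2,3) by (simp add: norm_mult)
  then show ?thesis using assms by simp
qed

lemma ccw_angle_unique:
  assumes "0 < t" "t \<le> 2 * pi" "b / a = of_real r * cis t" "r > 0"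
  shows "ccw_angle a b = t"
proof -
  have r: "cmod (b / a) = r" using assms by (simp add: norm_mult)
  have "of_real r * cis (ccw_angle a b) = of_real r * cis t"
    using ccw_angle_cis[of b a] assms(3) r by metis
  then have "cis (ccw_angle a b) = cis t" using cis_eq_pos assms(4) by blast
  then have "cis (ccw_angle a b - t) = 1" by (simp add: cis_divide[symmetric])
  then have "ccw_angle a b - t = 0" using ccw_angle_bounds[of a b] assms by (intro cis_eq_1) auto
  then show ?thesis by simp
qed

lemma sgn_Im_div: "Im ((u - v) / (w - v)) * (cmod (w - v))\<^sup>2 = det3 u v w"
proof (cases "w = v")
  case False
  then have "(cmod (w - v))\<^sup>2 \<noteq> 0" by simp
  then show ?thesis
    by (simp add: Im_divide cmod_power2 det3_def divide_simps) (simp add: algebra_simps)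
qed simp

text \<open>The second equivalence excludes collinear points because a zero angle is counted as
  \<open>2 * pi\<close>, which exceeds \<open>pi\<close> although the determinant is zero.\<close>

lemma ccw_angle_det3:
  assumes "u \<noteq> v" "w \<noteq> v"
  shows "ccw_angle (w - v) (u - v) < pi \<longleftrightarrow> det3 u v w > 0"
    "det3 u v w \<noteq> 0 \<Longrightarrow> ccw_angle (w - v) (u - v) > pi \<longleftrightarrow> det3 u v w < 0"
proof -
  let ?t = "ccw_angle (w - v) (u - v)" and ?q = "(u - v) / (w - v)"
  have c: "cmod ?q > 0" "(cmod (w - v))\<^sup>2 > 0" using assms by auto
  have "Im ?q = cmod ?q * sin ?t"
    using arg_cong[OF ccw_angle_cis[of "u - v" "w - v"], of Im] by simp
  then have d: "det3 u v w = (cmod ?q * (cmod (w - v))\<^sup>2) * sin ?t"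
    using sgn_Im_div[of u v w] by (simp add: algebra_simps)
  have pos: "cmod ?q * (cmod (w - v))\<^sup>2 > 0" using c by (rule mult_pos_pos)
  have s: "det3 u v w > 0 \<longleftrightarrow> sin ?t > 0" "det3 u v w < 0 \<longleftrightarrow> sin ?t < 0"
    unfolding d using pos by (simp_all only: zero_less_mult_iff mult_less_0_iff) auto
  note b = ccw_angle_bounds[of "w - v" "u - v"]
  have 1: "?t < pi \<Longrightarrow> sin ?t > 0" using b by (intro sin_gt_zero) auto
  have 2: "?t \<ge> pi \<Longrightarrow> sin ?t \<le> 0"
  proof -
    assume "?t \<ge> pi"
    then have "sin (?t - pi) \<ge> 0" using b by (intro sin_ge_zero) auto
    then show ?thesis by simp
  qed
  have 3: "sin ?t < 0" if "?t > pi" "?t < 2 * pi"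
  proof -
    have "sin (?t - pi) > 0" using that by (intro sin_gt_zero) auto
    then show ?thesis by simp
  qed
  have 4: "?t = 2 * pi \<Longrightarrow> sin ?t = 0" "?t = pi \<Longrightarrow> sin ?t = 0" by simp_all
  show "?t < pi \<longleftrightarrow> det3 u v w > 0" unfolding s using 1 2 by linarith
  show "?t > pi \<longleftrightarrow> det3 u v w < 0" if "det3 u v w \<noteq> 0"
  proof
    assume "?t > pi"
    moreover have "?t \<noteq> 2 * pi" using 4(1) d that by auto
    ultimately show "det3 u v w < 0" unfolding s using 3 b by linarith
  next
    assume "det3 u v w < 0"
    then have "sin ?t < 0" by (simp only: s)
    then show "?t > pi" using 1 4(2) by linarith
  qed
qed

lemma ccw_angle_add:
  assumes "a \<noteq> 0" "b \<noteq> 0" "c \<noteq> 0" "ccw_angle a b + ccw_angle b c \<le> 2 * pi"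
  shows "ccw_angle a c = ccw_angle a b + ccw_angle b c"
proof (rule ccw_angle_unique[OF _ assms(4)])
  show "0 < ccw_angle a b + ccw_angle b c" using ccw_angle_bounds by (simp add: add_pos_pos)
  have "c / a = (b / a) * (c / b)" using assms by simp
  also have "\<dots> = of_real (cmod (b / a) * cmod (c / b)) * cis (ccw_angle a b + ccw_angle b c)"
    by (subst ccw_angle_cis[of b a], subst ccw_angle_cis[of c b]) (simp add: cis_mult[symmetric])
  finally show "c / a = of_real (cmod (b / a) * cmod (c / b)) * cis (ccw_angle a b + ccw_angle b c)" .
  show "0 < cmod (b / a) * cmod (c / b)" using assms by simp
qed

text \<open>The product of the three quotients of sides is -1, so the sum is \<open>pi\<close>
  modulo \<open>2 * pi\<close>; all angles lie between 0 and \<open>pi\<close>, which leaves only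
  \<open>pi\<close> itself.\<close>

lemma triangle_angle_sum:
  assumes "det3 x y z > 0"
  shows "ccw_angle (z - y) (x - y) + ccw_angle (x - z) (y - z) + ccw_angle (y - x) (z - x) = pi"
proof -
  have n: "x \<noteq> y" "y \<noteq> z" "z \<noteq> x" using assms by auto
  let ?a = "ccw_angle (z - y) (x - y)" and ?b = "ccw_angle (x - z) (y - z)" and ?c =
      "ccw_angle (y - x) (z - x)"
  have lt: "?a < pi" "?b < pi" "?c < pi"
    using ccw_angle_det3(1)[of x y z] ccw_angle_det3(1)[of y z x] ccw_angle_det3(1)[of z x y] n assms
    by (simp_all add: det3_rotate[of y z x] det3_rotate[of x y z])
  let ?r = "cmod ((x - y) / (z - y)) * cmod ((y - z) / (x - z)) * cmod ((z - x) / (y - x))"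
  have rpos: "?r > 0" using n by simp
  have "of_real 1 * cis pi = ((x - y) / (z - y)) * ((y - z) / (x - z)) * ((z - x) / (y - x))"
    using n by (simp add: divide_simps) (simp add: algebra_simps)
  also have "\<dots> = of_real ?r * cis (?a + ?b + ?c)"
    by (subst ccw_angle_cis[of "x - y"], subst ccw_angle_cis[of "y - z"], subst ccw_angle_cis[of
        "z - x"])
      (simp add: cis_mult[symmetric])
  finally have "cis pi = cis (?a + ?b + ?c)" by (rule cis_eq_pos) (use rpos in simp_all)
  then have "cis (?a + ?b + ?c - pi) = 1" by (simp add: cis_divide[symmetric])
  then have "?a + ?b + ?c - pi = 0"
    using lt ccw_angle_bounds[of "z - y" "x - y"] ccw_angle_bounds[of "x - z"
        "y - z"] ccw_angle_bounds[of "y - x" "z - x"]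
    by (intro cis_eq_1) auto
  then show ?thesis by simp
qed

lemma cis_sum: "finite A \<Longrightarrow> cis (sum f A) = (\<Prod>x\<in>A. cis (f x))"
  by (induction A rule: finite_induct) (simp_all add: cis_mult[symmetric])

lemma det3_cis: "det3 (cis a) (cis b) (cis c)
    = 4 * sin ((b - a) / 2) * sin ((c - b) / 2) * sin ((c - a) / 2)"
proof -
  have h: "cis x = cis (x / 2) * cis (x / 2)" for x by (simp add: cis_mult)
  have e: "det3 (cis a) (cis b) (cis c) = sin (b - a) + sin (c - b) - sin (c - a)"
    by (simp add: det3_def sin_diff algebra_simps)
  define x where "x = (b - a) / 2"
  define y where "y = (c - b) / 2"
  have xy: "b - a = 2 * x" "c - b = 2 * y" "c - a = 2 * (x + y)" "(c - a) / 2 = x + y"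
    by (simp_all add: x_def y_def field_simps)
  have s: "(cos x)\<^sup>2 = 1 - (sin x)\<^sup>2" "(cos y)\<^sup>2 = 1 - (sin y)\<^sup>2" by (simp_all add: cos_squared_eq)
  have "sin (2 * x) + sin (2 * y) - sin (2 * (x + y)) = 4 * sin x * sin y * sin (x + y)"
    unfolding sin_double sin_add cos_add using s by algebra
  then have "sin (b - a) + sin (c - b) - sin (c - a) = 4 * sin x * sin y * sin (x
      + y)" unfolding xy(1-3) .
  then show ?thesis unfolding e by (simp only: xy(4) x_def[symmetric] y_def[symmetric])
qed

text \<open>Signed crossing of the segment from \<open>x\<close> to \<open>y\<close> with the horizontal ray from \<open>q\<close> to the
  right.\<close>
definition cr :: "complex \<Rightarrow> complex \<Rightarrow> complex \<Rightarrow> int" where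
  "cr q x y = (if Im x < Im q \<and> Im q < Im y \<and> det3 x y q > 0 then 1
     else if Im y < Im q \<and> Im q < Im x \<and> det3 y x q > 0 then - 1 else 0)"

lemma cr_swap: "cr q y x = - cr q x y"
  by (auto simp: cr_def)

text \<open>The three determinants are the barycentric coordinates of \<open>q\<close> before
  normalization.\<close>

lemma barycentric_Im:
  "det3 y w q * (Im x - Im q) + det3 w x q * (Im y - Im q) + det3 x y q * (Im w - Im q) = 0"
  by (simp add: det3_def algebra_simps)

lemma barycentric_sum: "det3 y w q + det3 w x q + det3 x y q = det3 x y w"
  by (simp add: det3_def algebra_simps)

text \<open>One corner lies below the level of \<open>q\<close> and two above. In a counterclockwise
  triangle the rising edge is to the right of the falling one, so a ray that hits the falling edge
  also hits the rising one.\<close>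

lemma cr_triangle_aux:
  assumes pos: "det3 x y w > 0" and b: "Im x < Im q" "Im q < Im y" "Im q < Im w"
  shows "0 \<le> cr q x y + cr q y w + cr q w x"
    "det3 x y q > 0 \<Longrightarrow> det3 w x q > 0 \<Longrightarrow> cr q x y + cr q y w + cr q w x = 1"
proof -
  have "det3 x y q > 0" if B: "det3 w x q < 0"
  proof (rule ccontr)
    assume C: "\<not> det3 x y q > 0"
    have "det3 w x q * (Im y - Im q) < 0" using B b by (simp add: mult_neg_pos)
    moreover have "det3 x y q * (Im w - Im q) \<le> 0" using C b by (simp add: mult_nonpos_nonneg)
    ultimately have "det3 y w q * (Im x - Im q) > 0" using barycentric_Im[of y w q x] by linarith
    then have "det3 y w q < 0" using b by (simp add: zero_less_mult_iff)
    then show False using barycentric_sum[of y w q x] pos B C by linarith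
  qed
  then show "0 \<le> cr q x y + cr q y w + cr q w x"
    using b det3_swap[of x w q] by (auto simp: cr_def)
  show "det3 x y q > 0 \<Longrightarrow> det3 w x q > 0 \<Longrightarrow> cr q x y + cr q y w + cr q w x = 1"
    using b det3_swap[of x w q] by (auto simp: cr_def)
qed

lemma cr_triangle_aux2:
  assumes pos: "det3 x y w > 0" and b: "Im x > Im q" "Im q > Im y" "Im q > Im w"
  shows "0 \<le> cr q x y + cr q y w + cr q w x"
    "det3 x y q > 0 \<Longrightarrow> det3 w x q > 0 \<Longrightarrow> cr q x y + cr q y w + cr q w x = 1"
proof -
  have "det3 w x q > 0" if B: "det3 x y q < 0"
  proof (rule ccontr)
    assume C: "\<not> det3 w x q > 0"
    have "det3 x y q * (Im w - Im q) > 0" using B b by (simp add: mult_neg_neg)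
    moreover have "det3 w x q * (Im y - Im q) \<ge> 0" using C b by (simp add: mult_nonpos_nonpos)
    ultimately have "det3 y w q * (Im x - Im q) < 0" using barycentric_Im[of y w q x] by linarith
    then have "det3 y w q < 0" using b by (simp add: mult_less_0_iff)
    then show False using barycentric_sum[of y w q x] pos B C by linarith
  qed
  then show "0 \<le> cr q x y + cr q y w + cr q w x"
    using b det3_swap[of x y q] by (auto simp: cr_def)
  show "det3 x y q > 0 \<Longrightarrow> det3 w x q > 0 \<Longrightarrow> cr q x y + cr q y w + cr q w x = 1"
    using b det3_swap[of x y q] by (auto simp: cr_def)
qed

text \<open>Distinguish which corners lie above the level of \<open>q\<close>; up to rotation one or
  two of them do, as treated before. If all are on one side there is no crossing, and then the
  barycentric relation shows that \<open>q\<close> is not inside.\<close>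

lemma cr_triangle:
  assumes pos: "det3 x y w > 0" and g: "Im q \<noteq> Im x" "Im q \<noteq> Im y" "Im q \<noteq> Im w"
  shows "0 \<le> cr q x y + cr q y w + cr q w x"
    "det3 x y q > 0 \<Longrightarrow> det3 y w q > 0 \<Longrightarrow> det3 w x q > 0 \<Longrightarrow> cr q x y + cr q y w + cr q w x = 1"
proof -
  have pos': "det3 y w x > 0" "det3 w x y > 0" using pos det3_rotate by metis+
  have "Im x < Im q \<or> Im x > Im q" "Im y < Im q \<or> Im y > Im q" "Im w < Im q \<or> Im w > Im q"
    using g by linarith+
  then consider "Im x < Im q" "Im y < Im q" "Im w < Im q" | "Im x > Im q" "Im y > Im q" "Im w > Im q"
    | "Im x < Im q" "Im y > Im q" "Im w > Im q" | "Im y < Im q" "Im w > Im q" "Im x > Im q"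
    | "Im w < Im q" "Im x > Im q" "Im y > Im q"
    | "Im x > Im q" "Im y < Im q" "Im w < Im q" | "Im y > Im q" "Im w < Im q" "Im x < Im q"
    | "Im w > Im q" "Im x < Im q" "Im y < Im q" by blast
  then have "0 \<le> cr q x y + cr q y w + cr q w x \<and> (det3 x y q > 0 \<and> det3 y w q > 0 \<and> det3 w x q > 0 \<longrightarrow>
    cr q x y + cr q y w + cr q w x = 1)"
  proof cases
    case 1
    have "\<not> (det3 x y q > 0 \<and> det3 y w q > 0 \<and> det3 w x q > 0)"
    proof
      assume "det3 x y q > 0 \<and> det3 y w q > 0 \<and> det3 w x q > 0"
      then have "det3 y w q * (Im x - Im q) < 0" "det3 w x q * (Im y - Im q) < 0"
          "det3 x y q * (Im w - Im q) < 0"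
        using 1 by (simp_all add: mult_pos_neg)
      then show False using barycentric_Im[of y w q x] by linarith
    qed
    then show ?thesis using 1 by (auto simp: cr_def)
  next
    case 2
    have "\<not> (det3 x y q > 0 \<and> det3 y w q > 0 \<and> det3 w x q > 0)"
    proof
      assume "det3 x y q > 0 \<and> det3 y w q > 0 \<and> det3 w x q > 0"
      then have "det3 y w q * (Im x - Im q) > 0" "det3 w x q * (Im y - Im q) > 0"
          "det3 x y q * (Im w - Im q) > 0"
        using 2 by simp_all
      then show False using barycentric_Im[of y w q x] by linarith
    qed
    then show ?thesis using 2 by (auto simp: cr_def)
  next
    case 3 then show ?thesis using cr_triangle_aux[OF pos] by auto
  next
    case 4 then show ?thesis using cr_triangle_aux[OF pos'(1)] by (auto simp: algebra_simps)
  next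
    case 5 then show ?thesis using cr_triangle_aux[OF pos'(2)] by (auto simp: algebra_simps)
  next
    case 6 then show ?thesis using cr_triangle_aux2[OF pos] by auto
  next
    case 7 then show ?thesis using cr_triangle_aux2[OF pos'(1)] by (auto simp: algebra_simps)
  next
    case 8 then show ?thesis using cr_triangle_aux2[OF pos'(2)] by (auto simp: algebra_simps)
  qed
  then show "0 \<le> cr q x y + cr q y w + cr q w x"
    "det3 x y q > 0 \<Longrightarrow> det3 y w q > 0 \<Longrightarrow> det3 w x q > 0 \<Longrightarrow> cr q x y + cr q y w + cr q w x = 1" by auto
qed

section \<open>Positions of the vertices\<close>

lemma sin_multiple_pos:
  assumes "0 < m" "m < h" shows "sin (2 * pi / real h * real m / 2) > 0"
proof (rule sin_gt_zero)
  have h: "real h > 0" using assms by simp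
  have "pi * real m < pi * real h" using assms by simp
  then show "2 * pi / real h * real m / 2 < pi" using h by (simp add: field_simps)
  show "0 < 2 * pi / real h * real m / 2" using h assms by simp
qed

context four_ppt
begin

abbreviation h where "h \<equiv> card Ou"

text \<open>The outer vertices go to a regular polygon. The angle is negative because a face lies to
  the left of its darts, so the outer walk is clockwise. Indexing \<open>ov\<close> by all natural
  numbers makes successors and predecessors uniform.\<close>

lemma outer_cycle:
  obtains c :: "'a \<Rightarrow> complex" and ov :: "nat \<Rightarrow> 'a" where
    "B = ov ` {..<h}" "inj_on ov {..<h}" "\<And>i. c (ov i) = cis (- (2 * pi / real h) * real i)"
    "\<And>d. d \<in> Ou \<Longrightarrow> \<exists>i\<in>{1..h}. d = (ov (i - 1), ov i) \<and> rot (ov i) (ov (i - 1)) = ov (i + 1)"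
    "ov h = ov 0"
proof -
  note e = face_enum[OF outer_D refl]
  define ov where "ov i = snd ((fs ^^ i) outer)" for i
  have h0: "h > 0" using e(4) .
  have B: "B = ov ` {..<h}" unfolding B_def ov_def by (subst e(2)) (simp add: image_image)
  have inj: "inj_on ov {..<h}"
  proof (rule inj_onI)
    fix i j assume ij: "i \<in> {..<h}" "j \<in> {..<h}" "ov i = ov j"
    have "(fs ^^ i) outer \<in> Ou" "(fs ^^ j) outer \<in> Ou" by (auto simp: dart_face_def)
    then have "(fs ^^ i) outer = (fs ^^ j) outer"
      using ij(3) snd_Ou_inj unfolding ov_def by (auto dest: inj_onD)
    then show "i = j" using e(3) ij by (auto dest: inj_onD)
  qed
  have per: "ov (j + h) = ov j" for j unfolding ov_def by (simp add: funpow_add e(1))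
  have per': "ov (j + h * m) = ov j" for j m
    by (induction m) (use per in \<open>simp_all add: add.assoc[symmetric] add.commute[of h]\<close>)
  define c where "c v = cis (- (2 * pi / real h) * real (the_inv_into {..<h} ov v))" for v
  have "c (ov i) = cis (- (2 * pi / real h) * real i)" for i
  proof -
    have i: "i = i mod h + h * (i div h)" by simp
    have "ov i = ov (i mod h)" using per'[of "i mod h" "i div h"] by simp
    then have "c (ov i) = cis (- (2 * pi / real h) * real (i mod h))"
      using the_inv_into_f_f[OF inj, of "i mod h"] h0 by (simp add: c_def)
    also have "\<dots> = cis (- (2 * pi / real h) * real (i mod h)) * cis (2 * pi * real_of_int (- int (i
        div h)))"
      by (subst cis_multiple_2pi) auto
    also have "\<dots> = cis (- (2 * pi / real h) * real (i mod h)
        + 2 * pi * real_of_int (- int (i div h)))"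
      by (simp add: cis_mult)
    also have "- (2 * pi / real h) * real (i mod h) + 2 * pi * real_of_int (- int (i div h))
        = - (2 * pi / real h) * real i"
    proof -
      have ri: "real i = real (i mod h) + real h * real (i div h)"
        using arg_cong[OF i, of real] by (simp only: of_nat_add of_nat_mult)
      show ?thesis unfolding ri using h0 by (simp add: field_simps)
    qed
    finally show ?thesis .
  qed
  moreover have "\<exists>i\<in>{1..h}. d = (ov (i - 1), ov i) \<and> rot (ov i) (ov (i - 1)) = ov (i + 1)"
      if d: "d \<in> Ou" for d
  proof -
    from d e(2) obtain i0 where i0: "i0 < h" "d = (fs ^^ i0) outer" by auto
    \<comment> \<open>Index 0 is replaced by the period, so that the predecessor
      \<open>i - 1\<close> exists.\<close>
    define i where "i = (if i0 = 0 then h else i0)"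
    have i: "i \<in> {1..h}" "d = (fs ^^ i) outer" using i0 h0 e(1) by (auto simp: i_def)
    then obtain k where k: "i = Suc k" by (cases i) auto
    have "d = fs ((fs ^^ k) outer)" using i k by simp
    then have "fst d = ov k" "snd d = ov i" unfolding ov_def i(2)[symmetric] by (auto simp: fsucc_def)
    moreover have "ov (Suc i) = rot (snd d) (fst d)"
      unfolding ov_def funpow.simps o_apply i(2)[symmetric] by (simp add: fsucc_def)
    ultimately show ?thesis using i k by (intro bexI[of _ i]) (auto simp: prod_eq_iff)
  qed
  moreover have "ov h = ov 0" using per[of 0] by simp
  ultimately show thesis using B inj that[of ov c] by blast
qed

text \<open>The exact value of the outer angle, not only that it exceeds \<open>pi\<close>, enters
  the total angle sum later; this is why the polygon is regular.\<close>

lemma circle_positions: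
  obtains c :: "'a \<Rightarrow> complex" where
    "\<And>u v w. (u, v) \<in> Ou \<Longrightarrow> w \<in> B \<Longrightarrow> w \<noteq> u \<Longrightarrow> w \<noteq> v \<Longrightarrow> det3 (c v) (c u) (c w) > 0"
    "\<And>x y z. {x, y, z} \<subseteq> B \<Longrightarrow> card {x, y, z} = 3 \<Longrightarrow> det3 (c x) (c y) (c z) \<noteq> 0"
    "\<And>u v. (u, v) \<in> Ou \<Longrightarrow> ccw_angle (c (rot v u) - c v) (c u - c v) = pi + 2 * pi / real h"
proof -
  obtain c :: "'a \<Rightarrow> complex" and ov :: "nat \<Rightarrow> 'a"
      where o: "B = ov ` {..<h}" "inj_on ov {..<h}"
          "\<And>i. c (ov i) = cis (- (2 * pi / real h) * real i)"
    "\<And>d. d \<in> Ou \<Longrightarrow> \<exists>i\<in>{1..h}. d = (ov (i - 1), ov i) \<and> rot (ov i) (ov (i - 1)) = ov (i + 1)"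
    "ov h = ov 0" by (rule outer_cycle) (rule that, assumption+)
  let ?f = "2 * pi / real h"
  have f: "?f > 0" "?f < pi" using big by (auto simp: field_simps)
  have gen: "(- f * real j - - f * real i) / 2
      = (if i \<ge> j then f * real (i - j) / 2 else - (f * real (j - i) / 2))"
    for f i j by (auto simp: of_nat_diff right_diff_distrib diff_divide_distrib)
  note diff = gen[of ?f]
  have "det3 (c v) (c u) (c w) > 0" if uv: "(u, v) \<in> Ou" and w: "w \<in> B" "w \<noteq> u" "w \<noteq> v" for u v w
  proof -
    from o(4)[OF uv] obtain i where i: "i \<in> {1..h}" "u = ov (i - 1)" "v = ov i" by auto
    from w o(1) obtain j where j: "j < h" "w = ov j" by auto
    have ne: "j \<noteq> i - 1" "j \<noteq> i" "\<not> (i = h \<and> j = 0)" using w i j o(5) by (cases "j = 0"; auto)+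
    have e1: "(- ?f * real (i - 1) - - ?f * real i) / 2 = ?f * 1 / 2"
      unfolding diff using i(1) by auto
    have D: "det3 (c v) (c u) (c w)
        = 4 * sin (?f * 1 / 2) * sin ((- ?f * real j - - ?f * real (i - 1)) / 2) * sin ((- ?f * real j
            - - ?f * real i) / 2)"
      unfolding i(2,3) j(2) o(3) det3_cis e1 ..
    have s1: "sin (?f * 1 / 2) > 0" using sin_multiple_pos[of 1 h] big by simp
    show ?thesis
    proof (cases "j < i - 1")
      case True
      have "sin (?f * real (i - 1 - j) / 2) > 0" "sin (?f * real (i - j) / 2) > 0"
        using True i j ne by (intro sin_multiple_pos; auto)+
      then show ?thesis unfolding D diff using True s1 by simp
    next
      case False
      then have ji: "j > i" using ne by auto
      have "sin (?f * real (j - (i - 1)) / 2) > 0" "sin (?f * real (j - i) / 2) > 0"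
        using ji i j by (intro sin_multiple_pos; auto)+
      moreover have "\<not> i - 1 \<ge> j" "\<not> i \<ge> j" using ji by auto
      ultimately show ?thesis unfolding D diff using s1
        by (simp only: if_False sin_minus mult_minus_left mult_minus_right minus_minus)
          (intro mult_pos_pos, simp_all only: zero_less_numeral)
    qed
  qed
  moreover have "det3 (c x) (c y) (c z) \<noteq> 0" if xyz: "{x, y, z} \<subseteq> B" "card {x, y, z} = 3" for x y z
  proof -
    from xyz(1) o(1) obtain i j k where ijk: "i < h" "j < h" "k < h" "x = ov i" "y = ov j" "z = ov k"
        by auto
    have ne: "i \<noteq> j" "j \<noteq> k" "i \<noteq> k" using xyz(2) ijk by (auto simp: card_insert_if split: if_splits)
    have s: "sin ((- ?f * real b - - ?f * real a) / 2) \<noteq> 0" if "a \<noteq> b" "a < h" "b < h" for a b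
    proof (cases "a \<ge> b")
      case True
      then have "0 < a - b" "a - b < h" using that by auto
      from sin_multiple_pos[OF this] show ?thesis unfolding diff using True by simp
    next
      case False
      then have "0 < b - a" "b - a < h" using that by auto
      from sin_multiple_pos[OF this] show ?thesis unfolding diff using False by simp
    qed
    show ?thesis unfolding ijk o(3) det3_cis using s[of i j] s[of j k] s[of i k] ne ijk by simp
  qed
  moreover have "ccw_angle (c (rot v u) - c v) (c u - c v) = pi + 2 * pi / real h"
      if uv: "(u, v) \<in> Ou" for u v
  proof (rule ccw_angle_unique[of _ _ _ 1])
    from o(4)[OF uv] obtain i where i: "i \<in> {1..h}" "u = ov (i - 1)" "v = ov i" "rot v u = ov (i + 1)"
        by auto
    let ?t = "- ?f * real i"
    have g: "- x * real (i - 1) = - x * real i + x" "- x * real (i + 1) = - x * real i + - x" for x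
      using i(1) by (simp_all add: of_nat_diff algebra_simps)
    have cu: "c u = cis ?t * cis ?f" unfolding i(2) o(3) cis_mult g(1) ..
    have rv: "rot v u = ov (i + 1)" using i(2-4) by simp
    have cw: "c (rot v u) = cis ?t * cis (- ?f)" unfolding rv o(3) cis_mult g(2) ..
    have cv: "c v = cis ?t" unfolding i o(3) by simp
    have n1: "cis (- ?f) \<noteq> 1" using cis_eq_1[of "- ?f"] f pi_gt_zero by auto
    have t0: "cis ?t \<noteq> 0" by simp
    have "cis (- ?f) * cis ?f = 1" by (simp add: cis_mult)
    then have "cis ?f - 1 = - cis ?f * (cis (- ?f) - 1)" by (simp add: algebra_simps)
    moreover have "(c u - c v) / (c (rot v u) - c v) = (cis ?f - 1) / (cis (- ?f) - 1)"
      unfolding cu cw cv using t0 n1 by (simp add: divide_simps) (simp add: algebra_simps)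
    ultimately have "(c u - c v) / (c (rot v u) - c v) = - cis ?f" using n1 by simp
    then show "(c u - c v) / (c (rot v u) - c v) = of_real 1 * cis (pi + ?f)"
      by (simp add: cis_mult[symmetric])
  qed (use f in auto)
  ultimately show thesis by (rule that)
qed

lemma positions_exist:
  obtains p :: "'a \<Rightarrow> complex" and la lb lc where
    "weights la lb lc" "positive la lb lc"
    "\<And>v. v \<in> I \<Longrightarrow> p v = la v *\<^sub>R p (fa v) + lb v *\<^sub>R p (fb v) + lc v *\<^sub>R p (fc v)"
    "\<And>u v w. (u, v) \<in> Ou \<Longrightarrow> w \<in> B \<Longrightarrow> w \<noteq> u \<Longrightarrow> w \<noteq> v \<Longrightarrow> det3 (p v) (p u) (p w) > 0"
    "\<And>x y z. {x, y, z} \<subseteq> V \<Longrightarrow> card {x, y, z} = 3 \<Longrightarrow> det3 (p x) (p y) (p z) \<noteq> 0"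
    "\<And>u v. (u, v) \<in> Ou \<Longrightarrow> ccw_angle (p (rot v u) - p v) (p u - p v) = pi + 2 * pi / real h"
proof -
  obtain c :: "'a \<Rightarrow> complex" where c:
    "\<And>u v w. (u, v) \<in> Ou \<Longrightarrow> w \<in> B \<Longrightarrow> w \<noteq> u \<Longrightarrow> w \<noteq> v \<Longrightarrow> det3 (c v) (c u) (c w) > 0"
    "\<And>x y z. {x, y, z} \<subseteq> B \<Longrightarrow> card {x, y, z} = 3 \<Longrightarrow> det3 (c x) (c y) (c z) \<noteq> 0"
    "\<And>u v. (u, v) \<in> Ou \<Longrightarrow> ccw_angle (c (rot v u) - c v) (c u - c v) = pi + 2 * pi / real h"
    by (rule circle_positions) blast
  have VI: "V - I = B" using B_V by (auto simp: I_def)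
  have "\<exists>la lb lc X Y. weights la lb lc \<and> positive la lb lc \<and> harmonic la lb lc X \<and>
      harmonic la lb lc Y \<and>
    (\<forall>v\<in>V - I. X v = Re (c v) \<and> Y v = Im (c v)) \<and>
    (\<forall>a b c. {a, b, c} \<subseteq> V \<and> card {a, b, c} = 3 \<longrightarrow> area X Y a b c \<noteq> 0)"
    by (rule general_position) (use c(2) in \<open>simp add: VI area_def det3_def\<close>)
  then obtain la lb lc X Y where g: "weights la lb lc" "positive la lb lc" "harmonic la lb lc X"
      "harmonic la lb lc Y"
    "\<forall>v\<in>V - I. X v = Re (c v) \<and> Y v = Im (c v)"
    "\<forall>a b c. {a, b, c} \<subseteq> V \<and> card {a, b, c} = 3 \<longrightarrow> area X Y a b c \<noteq> 0" by (elim exE conjE)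
  define p where "p v = Complex (X v) (Y v)" for v
  have pc: "p v = c v" if "v \<in> B" for v using g(5) that VI by (simp add: p_def complex_eq_iff)
  have OB: "u \<in> B \<and> v \<in> B \<and> rot v u \<in> B" if "(u, v) \<in> Ou" for u v
    using fst_Ou[OF that] face_fs[OF that] that by (force simp: B_def)
  show thesis
  proof (rule that[OF g(1,2), of p])
    show "p v = la v *\<^sub>R p (fa v) + lb v *\<^sub>R p (fb v) + lc v *\<^sub>R p (fc v)" if "v \<in> I" for v
      using g(3,4) that by (simp add: harmonic_def p_def complex_eq_iff)
    show "det3 (p v) (p u) (p w) > 0" if "(u, v) \<in> Ou" "w \<in> B" "w \<noteq> u" "w \<noteq> v" for u v w
      using c(1)[OF that] OB[OF that(1)] that(2) by (simp add: pc)
    show "det3 (p x) (p y) (p z) \<noteq> 0" if "{x, y, z} \<subseteq> V" "card {x, y, z} = 3" for x y z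
      using g(6) that by (simp add: det3_def area_def p_def)
    show "ccw_angle (p (rot v u) - p v) (p u - p v) = pi + 2 * pi / real h" if "(u, v) \<in> Ou" for u v
      using c(3)[OF that] OB[OF that] by (simp add: pc)
  qed
qed

end

section \<open>Sign changes of a linear functional\<close>

definition ch :: "('a \<Rightarrow> real) \<Rightarrow> 'a \<Rightarrow> 'a \<Rightarrow> 'a \<Rightarrow> nat" where
  "ch z v a b = (if (z a - z v) * (z b - z v) < 0 then 1 else 0)"

lemma ch_same [simp]: "ch z v a a = 0" by (simp add: ch_def not_less)

lemma ch_commute: "ch z v a b = ch z v b a" by (simp add: ch_def mult.commute)

lemma ch_opposite: "z a < z v \<Longrightarrow> z v < z b \<Longrightarrow> ch z v a b = 1" "z a > z v \<Longrightarrow> z v > z b \<Longrightarrow> ch z v a b = 1"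
  by (simp_all add: ch_def mult_less_0_iff)

lemma ch_agree: "z a < z v \<Longrightarrow> z b < z v \<Longrightarrow> ch z v a b = 0" "z a > z v \<Longrightarrow> z b > z v \<Longrightarrow> ch z v a b = 0"
  by (simp_all add: ch_def mult_less_0_iff)

text \<open>Exactly one of three distinct values is the middle one, so each triangle contributes one
  turn.\<close>

lemma ch_median:
  assumes "z x \<noteq> z y" "z y \<noteq> z w" "z x \<noteq> z w"
  shows "ch z x y w + ch z y w x + ch z w x y = 1"
  using assms by (auto simp: ch_def mult_less_0_iff)

context four_ppt
begin

lemma Q_unique: "x \<in> I \<Longrightarrow> y \<in> I \<Longrightarrow> d \<in> Q x \<Longrightarrow> d \<in> Q y \<Longrightarrow> x = y"
  by (rule inj_onD[OF Q_inj IF_unique[OF quad(1) quad(1)]])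

text \<open>Split the quadrilateral of every interior vertex \<open>x\<close> by its diagonal from \<open>x\<close> to \<open>fc x\<close>;
  \<open>third d\<close> is the remaining vertex of the triangle at the dart \<open>d\<close>.\<close>
definition third :: "'a \<times> 'a \<Rightarrow> 'a" where
  "third d = (if \<exists>x\<in>I. d \<in> Q x then
     (let x = SOME x. x \<in> I \<and> d \<in> Q x in if d = (fa x, x) \<or> d = (x, fb x) then fc x else x)
   else rot (snd d) (fst d))"

lemma third_in_Q:
  assumes x: "x \<in> I" "d \<in> Q x"
  shows "third d = (if d = (fa x, x) \<or> d = (x, fb x) then fc x else x)"
proof -
  have "(SOME y. y \<in> I \<and> d \<in> Q y) = x"
    by (rule some_equality) (use x Q_unique in blast)+
  moreover have "\<exists>x\<in>I. d \<in> Q x" using x by blast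
  ultimately show ?thesis by (simp only: third_def Let_def if_True)
qed

lemma third_Q:
  assumes x: "x \<in> I"
  shows "third (fa x, x) = fc x" "third (x, fb x) = fc x" "third (fb x, fc x) = x"
      "third (fc x, fa x) = x"
  using quad(7)[OF x] third_in_Q[OF x] by (auto simp: Q_def)

lemma third_TF: "F \<in> TF \<Longrightarrow> d \<in> F \<Longrightarrow> third d = rot (snd d) (fst d)"
proof -
  assume F: "F \<in> TF" "d \<in> F"
  have "\<not> (\<exists>x\<in>I. d \<in> Q x)"
  proof
    assume "\<exists>x\<in>I. d \<in> Q x"
    then obtain x where x: "x \<in> I" "d \<in> Q x" by blast
    have "F = Q x" using IF_unique[OF _ quad(1)[OF x(1)] F(2) x(2)] F(1) by (simp add: TF_def)
    then show False using quad(2)[OF x(1)] F(1) by (simp add: TF_def)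
  qed
  then show ?thesis by (simp add: third_def)
qed

lemma interior_dart:
  assumes "(u, v) \<in> D" "(u, v) \<notin> Ou"
  obtains (tri) F where "F \<in> TF" "(u, v) \<in> F"
  | (quad1) "v \<in> I" "u = fa v"
  | (quad2) "u \<in> I" "v = fb u"
  | (quad3) x where "x \<in> I" "u = fb x" "v = fc x"
  | (quad4) x where "x \<in> I" "u = fc x" "v = fa x"
proof -
  from face_cases[OF assms(1)] assms(2) obtain F where F: "F \<in> IF" "(u, v) \<in> F" by blast
  show thesis
  proof (cases "card F = 3")
    case True
    then show ?thesis using F by (intro tri[of F]) (auto simp: TF_def)
  next
    case False
    then obtain x where "x \<in> I" "F = Q x" using interior_face_cases[OF F(1)] by blast
    then have "(u, v) = (fa x, x) \<or> (u, v) = (x, fb x) \<or> (u, v) = (fb x, fc x) \<or>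
        (u, v) = (fc x, fa x)"
      using F(2) by (simp add: Q_def)
    then show ?thesis using \<open>x \<in> I\<close> quad1 quad2 quad3[of x] quad4[of x] unfolding prod.inject by metis
  qed
qed

lemma Q_rot:
  assumes "x \<in> I"
  shows "rot x (fa x) = fb x" "rot (fb x) x = fc x" "rot (fc x) (fb x) = fa x" "rot (fa x) (fc x) = x"
  using quad(3-6)[OF assms] by auto

text \<open>A diagonal divides only the corners at its two ends, \<open>x\<close> and
  \<open>fc x\<close>. In any other corner the two bounding darts belong to the same
  triangle.\<close>

lemma corner_cases:
  assumes "(u, v) \<in> D" "(u, v) \<notin> Ou"
  obtains (flat) "third (u, v) = rot v u" "third (v, rot v u) = u"
  | (reflex) "v \<in> I" "u = fa v" "rot v u = fb v" "third (u, v) = fc v" "third (v, rot v u) = fc v"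
  | (opp) x where "x \<in> I" "u = fb x" "v = fc x" "rot v u = fa x" "third (u, v) = x"
      "third (v, rot v u) = x"
  using assms
proof (cases rule: interior_dart)
  case (tri F)
  then have F: "F \<in> IF" "card F = 3" by (auto simp: TF_def)
  note t = triangle_face[OF F tri(2)]
  have "(v, rot v u) \<in> F" using t(1) by auto
  then show ?thesis using third_TF[OF tri(1)] tri(2) t(2) by (intro flat) auto
next
  case quad1
  then show ?thesis using third_Q Q_rot by (intro reflex) auto
next
  case quad2
  then show ?thesis using third_Q Q_rot by (intro flat) auto
next
  case (quad3 x)
  then show ?thesis using third_Q[of x] Q_rot[of x] by (intro opp) auto
next
  case (quad4 x)
  then show ?thesis using third_Q[of x] Q_rot[of x] by (intro flat) auto
qed

lemma corner_distinct:
  assumes "(u, v) \<in> D" "(u, v) \<notin> Ou"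
  shows "u \<noteq> v" "v \<noteq> rot v u" "rot v u \<noteq> u" "third (u, v) \<noteq> u" "third (u, v) \<noteq> v" "third (u, v) \<in> V"
    "u \<in> V" "v \<in> V" "rot v u \<in> V"
proof -
  have E: "E u v" "E v u" "E v (rot v u)" using assms(1) E_sym rot_E by auto
  then show "u \<noteq> v" "v \<noteq> rot v u" "u \<in> V" "v \<in> V" "rot v u \<in> V" using E_irr E_V by blast+
  have "rot v u \<noteq> u \<and> third (u, v) \<noteq> u \<and> third (u, v) \<noteq> v \<and> third (u, v) \<in> V"
    using assms
  proof (cases rule: interior_dart)
    case (tri F)
    then have F: "F \<in> IF" "card F = 3" by (auto simp: TF_def)
    show ?thesis using triangle_face(4)[OF F tri(2)] third_TF[OF tri] E E_V by auto
  next
    case quad1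
    then show ?thesis using quad(7,15)[of v] third_Q Q_rot by auto
  next
    case quad2
    then show ?thesis using quad(7,15)[of u] third_Q Q_rot by auto
  next
    case (quad3 x)
    then show ?thesis using quad(7)[of x] third_Q[of x] Q_rot[of x] by (auto simp: I_def)
  next
    case (quad4 x)
    then show ?thesis using quad(7)[of x] third_Q[of x] Q_rot[of x] by (auto simp: I_def)
  qed
  then show "rot v u \<noteq> u" "third (u, v) \<noteq> u" "third (u, v) \<noteq> v" "third (u, v) \<in> V" by auto
qed

text \<open>In an undivided corner \<open>third d\<close> is the other end of the corner and the
  second summand vanishes, so the formula counts triangles in divided and undivided corners
  alike.\<close>

definition cnt :: "('a \<Rightarrow> real) \<Rightarrow> 'a \<times> 'a \<Rightarrow> nat" where
  "cnt z d = ch z (snd d) (fst d) (third d) + ch z (snd d) (third d) (rot (snd d) (fst d))"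

text \<open>The number of triangles at \<open>v\<close> in which \<open>v\<close> has the middle value of \<open>z\<close>.\<close>
definition turns :: "('a \<Rightarrow> real) \<Rightarrow> 'a \<Rightarrow> nat" where
  "turns z v = (\<Sum>u\<in>N v. if (u, v) \<in> Ou then 0 else cnt z (u, v))"

lemma sum_turns:
  assumes z: "inj_on z V"
  shows "(\<Sum>v\<in>V. turns z v) = card TF + 2 * card I"
proof -
  have zne: "z x \<noteq> z y" if "x \<in> V" "y \<in> V" "x \<noteq> y" for x y using z that by (auto dest: inj_onD)
  have "(\<Sum>v\<in>V. turns z v) = (\<Sum>d\<in>D. if d \<in> Ou then 0 else cnt z d)"
    unfolding turns_def sum_darts ..
  also have "\<dots> = (\<Sum>F\<in>TF. \<Sum>d\<in>F. cnt z d) + (\<Sum>v\<in>I. \<Sum>d\<in>Q v. cnt z d)"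
  proof -
    have "(\<Sum>F\<in>TF. \<Sum>d\<in>F. if d \<in> Ou then 0 else cnt z d) = (\<Sum>F\<in>TF. \<Sum>d\<in>F. cnt z d)"
      using IF_disj by (intro sum.cong refl) (auto simp: TF_def)
    moreover have "(\<Sum>v\<in>I. \<Sum>d\<in>Q v. if d \<in> Ou then 0 else cnt z d) = (\<Sum>v\<in>I. \<Sum>d\<in>Q v. cnt z d)"
      using IF_disj[OF quad(1)] by (intro sum.cong refl) auto
    ultimately show ?thesis unfolding sum_D by simp
  qed
  also have "(\<Sum>F\<in>TF. \<Sum>d\<in>F. cnt z d) = (\<Sum>F\<in>TF. 1)"
  proof (rule sum.cong)
    fix F assume F: "F \<in> TF"
    then have F': "F \<in> IF" "card F = 3" by (auto simp: TF_def)
    then have "F \<noteq> {}" by auto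
    then obtain d where "d \<in> F" by blast
    then obtain x y where xy: "(x, y) \<in> F" by (cases d) auto
    note t = triangle_face[OF F' xy]
    let ?w = "rot y x"
    have V: "x \<in> V" "y \<in> V" "?w \<in> V" using t(5-7) E_V by blast+
    have th: "third (x, y) = ?w" "third (y, ?w) = x" "third (?w, x) = y"
      using third_TF[OF F] t(1-3) by auto
    have "(\<Sum>d\<in>F. cnt z d) = cnt z (x, y) + cnt z (y, ?w) + cnt z (?w, x)"
      by (subst t(1)) (use t(4) in simp)
    also have "\<dots> = ch z x y ?w + ch z y ?w x + ch z ?w x y"
      using t(2,3) th by (simp add: cnt_def ch_commute)
    also have "\<dots> = 1" by (rule ch_median) (use zne V t(4) in auto)
    finally show "(\<Sum>d\<in>F. cnt z d) = 1" .
  qed simp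
  also have "(\<Sum>v\<in>I. \<Sum>d\<in>Q v. cnt z d) = (\<Sum>v\<in>I. 2)"
  proof (rule sum.cong)
    fix x assume x: "x \<in> I"
    have xV: "x \<in> V" using x by (simp add: I_def)
    have "(\<Sum>d\<in>Q x. cnt z d) = cnt z (fa x, x) + cnt z (x, fb x) + cnt z (fb x, fc x)
        + cnt z (fc x, fa x)"
      unfolding Q_def using quad(7)[OF x] by simp
    also have "\<dots> = (ch z x (fb x) (fc x) + ch z (fb x) (fc x) x + ch z (fc x) x (fb x))
        + (ch z x (fc x) (fa x) + ch z (fc x) (fa x) x + ch z (fa x) x (fc x))"
      using third_Q[OF x] Q_rot[OF x] by (simp add: cnt_def ch_commute)
    also have "\<dots> = 1 + 1"
      using quad(7,13-15)[OF x] xV by (intro arg_cong2[of _ _ _ _ "(+)"] ch_median zne) auto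
    finally show "(\<Sum>d\<in>Q x. cnt z d) = 2" by simp
  qed simp
  finally show ?thesis by simp
qed

text \<open>The same count read from the other side of the corner, as is needed for an edge that
  ends the corner instead of starting it.\<close>

lemma cnt_alt:
  assumes "(u, v) \<in> D" "(u, v) \<notin> Ou"
  shows "cnt z (u, v) = ch z v u (third (v, rot v u)) + ch z v (third (v, rot v u)) (rot v u)"
  using assms by (cases rule: corner_cases) (auto simp: cnt_def)

text \<open>If a possible diagonal splits the corner, its far end lies on one side of the level of
  \<open>v\<close> and is separated from one of the two ends.\<close>

lemma cnt_opposite:
  assumes z: "inj_on z V" and d: "(u, v) \<in> D" "(u, v) \<notin> Ou"
    and opp: "z u < z v \<and> z v < z (rot v u) \<or> z u > z v \<and> z v > z (rot v u)"
  shows "cnt z (u, v) \<ge> 1"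
proof -
  have "z (third (u, v)) \<noteq> z v" using z corner_distinct[OF d] by (auto dest: inj_onD)
  then have "z (third (u, v)) < z v \<or> z (third (u, v)) > z v" by linarith
  then show ?thesis using opp ch_opposite[of z] unfolding cnt_def by fastforce
qed

text \<open>A discrete intermediate value principle for the cyclic order at
  \<open>v\<close>.\<close>

lemma rot_crossing:
  assumes "a \<in> N v" "b \<in> N v" "P a" "\<not> P b"
  shows "\<exists>u\<in>N v. P u \<and> \<not> P (rot v u)"
proof (rule ccontr)
  assume "\<not> ?thesis"
  then have "P b" using assms by (intro rot_closed[of v P a b]) auto
  then show False using assms by simp
qed

end

locale placed = four_ppt V E rot outer reflex
  for V :: "'a set" and E :: "'a \<Rightarrow> 'a \<Rightarrow> bool" and rot :: "'a \<Rightarrow> 'a \<Rightarrow> 'a" and outer :: "'a \<times> 'a"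
    and reflex :: "'a \<times> 'a \<Rightarrow> bool" +
  fixes p :: "'a \<Rightarrow> complex" and la lb lc :: "'a \<Rightarrow> real"
  assumes wts: "weights la lb lc" and lpos: "positive la lb lc"
    and comb: "v \<in> I \<Longrightarrow> p v = la v *\<^sub>R p (fa v) + lb v *\<^sub>R p (fb v) + lc v *\<^sub>R p (fc v)"
    and conv: "(u, v) \<in> Ou \<Longrightarrow> w \<in> B \<Longrightarrow> w \<noteq> u \<Longrightarrow> w \<noteq> v \<Longrightarrow> det3 (p v) (p u) (p w) > 0"
    and gp3: "{x, y, z} \<subseteq> V \<Longrightarrow> card {x, y, z} = 3 \<Longrightarrow> det3 (p x) (p y) (p z) \<noteq> 0"
    and outer_angle: "(u, v) \<in> Ou \<Longrightarrow>
        ccw_angle (p (rot v u) - p v) (p u - p v) = pi + 2 * pi / real (card (dart_face rot outer))"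
begin

section \<open>Lower bounds for the numbers of medians\<close>

lemma gp: "x \<in> V \<Longrightarrow> y \<in> V \<Longrightarrow> z \<in> V \<Longrightarrow> x \<noteq> y \<Longrightarrow> y \<noteq> z \<Longrightarrow> x \<noteq> z \<Longrightarrow> det3 (p x) (p y) (p z) \<noteq> 0"
  by (rule gp3) auto

lemma card_V3: "card V \<ge> 3" using card_V big by simp

lemma inj_p: "inj_on p V"
proof (rule inj_onI, rule ccontr)
  fix x y assume xy: "x \<in> V" "y \<in> V" "p x = p y" "x \<noteq> y"
  have "\<not> V \<subseteq> {x, y}"
  proof
    assume "V \<subseteq> {x, y}"
    then have "card V \<le> card {x, y}" by (rule card_mono[rotated]) simp
    then show False using card_V3 xy by simp
  qed
  then obtain w where "w \<in> V" "w \<noteq> x" "w \<noteq> y" by auto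
  then show False using gp[of x y w] xy by auto
qed

definition lin :: "('a \<Rightarrow> real) \<Rightarrow> bool" where
  "lin z \<longleftrightarrow> (\<exists>a b c. \<forall>v. z v = a * Re (p v) + b * Im (p v) + c)"

lemma coeffs: "v \<in> I \<Longrightarrow> la v > 0" "v \<in> I \<Longrightarrow> lb v > 0" "v \<in> I \<Longrightarrow> lc v > 0" "v \<in> I \<Longrightarrow>
    la v + lb v + lc v = 1"
  using wts lpos by (auto simp: weights_def positive_def)

lemma lin_comb:
  assumes "lin z" "v \<in> I" shows "z v = la v * z (fa v) + lb v * z (fb v) + lc v * z (fc v)"
proof -
  from assms(1) obtain a b c where z: "\<And>v. z v = a * Re (p v) + b * Im (p v) + c"
      by (auto simp: lin_def)
  have l: "z v = a * Re (p v) + b * Im (p v) + c * (la v + lb v + lc v)"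
    using z[of v] coeffs(4)[OF assms(2)] by simp
  have R: "Re (p v) = la v * Re (p (fa v)) + lb v * Re (p (fb v)) + lc v * Re (p (fc v))"
    "Im (p v) = la v * Im (p (fa v)) + lb v * Im (p (fb v)) + lc v * Im (p (fc v))"
    using arg_cong[OF comb[OF assms(2)], of Re] arg_cong[OF comb[OF assms(2)], of Im] by simp_all
  show ?thesis unfolding l R unfolding z by (simp add: algebra_simps)
qed

lemma lin_harmonic: "lin z \<Longrightarrow> harmonic la lb lc z" using lin_comb by (auto simp: harmonic_def)

lemma lin_det3: "lin (\<lambda>q. det3 a b (p q))"
  unfolding lin_def det3_def
  by (intro exI[of _ "- (Im b - Im a)"] exI[of _ "Re b - Re a"]
      exI[of _ "- (Re b - Re a) * Im a + (Im b - Im a) * Re a"]) (simp add: algebra_simps)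

lemma lin_add:
  assumes "lin z" "lin y" shows "lin (\<lambda>v. z v + e * y v)"
proof -
  from assms obtain a b c a' b' c' where "\<And>v. z v = a * Re (p v) + b * Im (p v) + c"
    "\<And>v. y v = a' * Re (p v) + b' * Im (p v) + c'" unfolding lin_def by metis
  then show ?thesis unfolding lin_def
    by (intro exI[of _ "a + e * a'"] exI[of _ "b + e * b'"] exI[of _
        "c + e * c'"]) (simp add: algebra_simps)
qed

lemma V_I: "V - I = B" using B_V by (auto simp: I_def)

text \<open>Affine functions of the position are harmonic, so the maximum principle carries the
  convexity of the outer polygon to all vertices; general position makes the inequality
  strict.\<close>

lemma outer_pos:
  assumes "(u, v) \<in> Ou" "q \<in> V" "q \<noteq> u" "q \<noteq> v" shows "det3 (p v) (p u) (p q) > 0"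
proof -
  let ?z = "\<lambda>q. - det3 (p v) (p u) (p q)"
  have uvV: "u \<in> V" "v \<in> V" "u \<noteq> v" using Ou_D[OF assms(1)] E_V E_irr by auto
  have "?z q \<le> 0"
  proof (rule max_principle[OF wts positive_escaping[OF lpos] harmonic_uminus[OF lin_harmonic[OF
      lin_det3]] _ assms(2)])
    fix w assume "w \<in> V - I"
    then show "?z w \<le> 0" using conv[OF assms(1), of w] V_I by (cases "w = u \<or> w = v") auto
  qed
  moreover have "?z q \<noteq> 0" using gp[of v u q] uvV assms by auto
  ultimately show ?thesis by linarith
qed

text \<open>If \<open>v\<close> has neighbours above and below its level, the cyclic order at
  \<open>v\<close> crosses the level at least twice. Otherwise \<open>fa v\<close> and
  \<open>fb v\<close> are on the same side, and since \<open>v\<close> is a positive combination of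
  its fathers, \<open>fc v\<close> is on the other; then \<open>v\<close> is the median of both
  triangles at its reflex corner.\<close>

lemma interior_turns:
  assumes z: "lin z" "inj_on z V" and v: "v \<in> I"
  shows "turns z v \<ge> 2"
proof -
  have vV: "v \<in> V" and vB: "v \<notin> B" using v by (auto simp: I_def)
  have notO: "(u, v) \<notin> Ou" for u using vB by (force simp: B_def)
  have t: "turns z v = (\<Sum>u\<in>N v. cnt z (u, v))" using notO by (simp add: turns_def)
  have D: "(u, v) \<in> D" if "u \<in> N v" for u using that E_sym by (auto simp: N_iff)
  have ne: "z u \<noteq> z v" if "u \<in> V" "u \<noteq> v" for u using z(2) that vV by (auto dest: inj_onD)
  have neN: "z u \<noteq> z v" if "u \<in> N v" for u
    using ne[of u] that E_V[of v u] E_irr[of v u] by (auto simp: N_iff)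
  show ?thesis
  proof (cases "(\<exists>a\<in>N v. z a < z v) \<and> (\<exists>b\<in>N v. z b > z v)")
    case True
    then obtain a b where ab: "a \<in> N v" "z a < z v" "b \<in> N v" "z b > z v" by auto
    from rot_crossing[of a v b "\<lambda>u. z u < z v"] ab obtain u1
        where u1: "u1 \<in> N v" "z u1 < z v" "\<not> z (rot v u1) < z v" by auto
    from rot_crossing[of b v a "\<lambda>u. z u > z v"] ab obtain u2
        where u2: "u2 \<in> N v" "z u2 > z v" "\<not> z (rot v u2) > z v" by auto
    have r: "z (rot v u) \<noteq> z v" if "u \<in> N v" for u
        using neN[of "rot v u"] rot_E that by (auto simp: N_iff)
    have c1: "cnt z (u1, v) \<ge> 1" using u1 r[OF u1(1)] by (intro cnt_opposite z D notO) auto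
    have c2: "cnt z (u2, v) \<ge> 1" using u2 r[OF u2(1)] by (intro cnt_opposite z D notO) auto
    have "(\<Sum>u\<in>{u1, u2}. cnt z (u, v)) \<le> (\<Sum>u\<in>N v. cnt z (u, v))"
      using u1 u2 finN by (intro sum_mono2) auto
    moreover have "u1 \<noteq> u2" using u1 u2 by auto
    ultimately show ?thesis using c1 c2 t by simp
  next
    case False
    note q = quad[OF v]
    have aN: "fa v \<in> N v" "fb v \<in> N v" using q(8,9) E_sym by (auto simp: N_iff)
    have lc: "z v = la v * z (fa v) + lb v * z (fb v) + lc v * z (fc v)" by (rule lin_comb[OF z(1) v])
    have sum0: "la v * (z (fa v) - z v) + lb v * (z (fb v) - z v) + lc v * (z (fc v) - z v) = 0"
    proof -
      have "la v * (z (fa v) - z v) + lb v * (z (fb v) - z v) + lc v * (z (fc v) - z v)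
        = (la v * z (fa v) + lb v * z (fb v) + lc v * z (fc v)) - (la v + lb v + lc v) * z v"
        by (simp add: algebra_simps)
      then show ?thesis using lc coeffs(4)[OF v] by simp
    qed
    have "z (fa v) < z v \<and> z (fb v) < z v \<and> z (fc v) > z v \<or> z (fa v) > z v \<and> z (fb v) > z v \<and>
        z (fc v) < z v"
    proof (cases "z (fa v) < z v")
      case True
      then have bl: "z (fb v) < z v" using False aN neN[OF aN(2)] by force
      then have "la v * (z (fa v) - z v) < 0" "lb v * (z (fb v) - z v) < 0"
        using True coeffs[OF v] by (simp_all add: mult_pos_neg)
      then have "lc v * (z (fc v) - z v) > 0" using sum0 by linarith
      then have "z (fc v) > z v" using coeffs(3)[OF v] by (simp add: zero_less_mult_iff)
      then show ?thesis using True bl by simp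
    next
      case False2: False
      then have al: "z (fa v) > z v" using neN[OF aN(1)] by linarith
      then have bl: "z (fb v) > z v" using False aN neN[OF aN(2)] by force
      then have "la v * (z (fa v) - z v) > 0" "lb v * (z (fb v) - z v) > 0"
        using al coeffs[OF v] by simp_all
      then have "lc v * (z (fc v) - z v) < 0" using sum0 by linarith
      then have "z (fc v) < z v" using coeffs(3)[OF v] by (simp add: mult_less_0_iff)
      then show ?thesis using al bl by simp
    qed
    then have "ch z v (fa v) (fc v) = 1" "ch z v (fc v) (fb v) = 1"
      using ch_opposite[of z] by auto
    then have "cnt z (fa v, v) = 2" using third_Q(1)[OF v] q(3) by (simp add: cnt_def)
    moreover have "cnt z (fa v, v) \<le> (\<Sum>u\<in>N v. cnt z (u, v))"
      by (rule member_le_sum) (use aN finN in auto)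
    ultimately show ?thesis using t by simp
  qed
qed

definition mid :: "('a \<Rightarrow> real) \<Rightarrow> 'a \<Rightarrow> bool" where
  "mid z v \<longleftrightarrow> (\<exists>w\<in>B. z w < z v) \<and> (\<exists>w\<in>B. z w > z v)"

text \<open>Cramer's rule in the basis of the two outer edges at \<open>v\<close>; convexity makes
  the coefficients nonnegative.\<close>

lemma cone:
  assumes uv: "(u, v) \<in> Ou" and q: "q \<in> B"
  obtains s t where "s \<ge> 0" "t \<ge> 0" "p q - p v = s *\<^sub>R (p u - p v) + t *\<^sub>R (p (rot v u) - p v)"
proof -
  let ?w = "rot v u"
  have vw: "(v, ?w) \<in> Ou" using face_fs[OF uv] by simp
  have n: "u \<in> B" "v \<in> B" "?w \<in> B" "u \<noteq> v" "v \<noteq> ?w"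
    using fst_Ou[OF uv] fst_Ou[OF vw] vw Ou_D[OF uv] Ou_D[OF vw] E_irr by (force simp: B_def)+
  have uw: "u \<noteq> ?w"
  proof
    assume eq: "u = ?w"
    then have "(v, u) \<in> Ou" using vw by simp
    have "\<not> B \<subseteq> {u, v}"
    proof
      assume "B \<subseteq> {u, v}"
      then have "card B \<le> card {u, v}" by (rule card_mono[rotated]) simp
      then show False using card_B big n by simp
    qed
    then obtain r where r: "r \<in> B" "r \<noteq> u" "r \<noteq> v" by blast
    have "det3 (p v) (p u) (p r) > 0" by (rule conv[OF uv r])
    moreover have "det3 (p u) (p v) (p r) > 0" by (rule conv[OF \<open>(v, u) \<in> Ou\<close> r(1,3,2)])
    ultimately show False using det3_swap[of "p u" "p v" "p r"] by simp
  qed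
  have d: "det3 (p v) (p u) (p ?w) > 0" using conv[OF uv n(3)] uw n by auto
  have A: "det3 (p v) (p u) (p q) \<ge> 0" using conv[OF uv q] by (cases "q = u \<or> q = v") auto
  have C: "det3 (p ?w) (p v) (p q) \<ge> 0" using conv[OF vw q] by (cases "q = v \<or> q = ?w") auto
  have "p q - p v = (det3 (p ?w) (p v) (p q) / det3 (p v) (p u) (p ?w)) *\<^sub>R (p u - p v)
      + (det3 (p v) (p u) (p q) / det3 (p v) (p u) (p ?w)) *\<^sub>R (p ?w - p v)"
  proof -
    have "det3 (p v) (p u) (p ?w) * (Re (p q) - Re (p v))
        = det3 (p ?w) (p v) (p q) * (Re (p u) - Re (p v))
            + det3 (p v) (p u) (p q) * (Re (p ?w) - Re (p v))"
      "det3 (p v) (p u) (p ?w) * (Im (p q) - Im (p v))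
          = det3 (p ?w) (p v) (p q) * (Im (p u) - Im (p v))
              + det3 (p v) (p u) (p q) * (Im (p ?w) - Im (p v))"
      unfolding det3_def by algebra+
    note * = this
    have div: "x = A / D * y + C / D * w" if "D * x = A * y + C * w" "D > 0" for A C D x y w :: real
      using that by (simp add: field_simps)
    show ?thesis using div[OF *(1) d] div[OF *(2) d] by (intro complex_eqI) simp_all
  qed
  then show thesis using that A C d by (meson divide_nonneg_pos)
qed

text \<open>The two outer neighbours lie on different sides of the level of \<open>v\<close>, since
  otherwise the cone they span would put all outer vertices on one side. The outer corner accounts
  for one crossing of the level, and the way back around \<open>v\<close> needs another, inside the
  polygon.\<close>

lemma boundary_turns:
  assumes z: "lin z" "inj_on z V" and v: "v \<in> B" "mid z v"
  shows "turns z v \<ge> 1"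
proof -
  from v(1) obtain u where uv: "(u, v) \<in> Ou" by (auto simp: B_def)
  let ?w = "rot v u"
  have vV: "v \<in> V" using v B_V by auto
  have D: "(u, v) \<in> D" using Ou_D uv by blast
  have uN: "u \<in> N v" "?w \<in> N v" using D rot_E E_sym by (auto simp: N_iff)
  have ne: "z x \<noteq> z v" if "x \<in> N v" for x
    using inj_onD[OF z(2), of x v] that vV E_V[of v x] E_irr[of v x] by (auto simp: N_iff)
  from z(1) obtain a b c where zz: "\<And>v. z v = a * Re (p v) + b * Im (p v) + c" by (auto simp: lin_def)
  have zd: "z q - z v = s * (z u - z v) + t * (z ?w - z v)"
    if "p q - p v = s *\<^sub>R (p u - p v) + t *\<^sub>R (p ?w - p v)" for q s t
  proof -
    have R: "Re (p q) = Re (p v) + s * (Re (p u) - Re (p v)) + t * (Re (p ?w) - Re (p v))"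
      "Im (p q) = Im (p v) + s * (Im (p u) - Im (p v)) + t * (Im (p ?w) - Im (p v))"
      using arg_cong[OF that, of Re] arg_cong[OF that, of Im] by simp_all
    show ?thesis unfolding zz R by (simp add: algebra_simps)
  qed
  have opp: "z u < z v \<and> z ?w > z v \<or> z u > z v \<and> z ?w < z v"
  proof (rule ccontr)
    assume "\<not> ?thesis"
    then consider "z u > z v" "z ?w > z v" | "z u < z v" "z ?w < z v"
      using ne[OF uN(1)] ne[OF uN(2)] by linarith
    then show False
    proof cases
      case 1
      from v(2) obtain q where q: "q \<in> B" "z q < z v" by (auto simp: mid_def)
      from cone[OF uv q(1)] obtain s t
          where st: "s \<ge> 0" "t \<ge> 0" "p q - p v = s *\<^sub>R (p u - p v) + t *\<^sub>R (p ?w - p v)" .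
      have "s * (z u - z v) \<ge> 0" "t * (z ?w - z v) \<ge> 0" using st 1 by simp_all
      then show False using zd[OF st(3)] q by linarith
    next
      case 2
      from v(2) obtain q where q: "q \<in> B" "z q > z v" by (auto simp: mid_def)
      from cone[OF uv q(1)] obtain s t
          where st: "s \<ge> 0" "t \<ge> 0" "p q - p v = s *\<^sub>R (p u - p v) + t *\<^sub>R (p ?w - p v)" .
      have "s * (z u - z v) \<le> 0" "t * (z ?w - z v) \<le> 0"
          using st 2 by (simp_all add: mult_nonneg_nonpos)
      then show False using zd[OF st(3)] q by linarith
    qed
  qed
  have "\<exists>x\<in>N v. x \<noteq> u \<and> (z x < z v \<and> z v < z (rot v x) \<or> z x > z v \<and> z v > z (rot v x))"
    using opp
  proof
    assume o: "z u < z v \<and> z ?w > z v"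
    from rot_crossing[of ?w v u "\<lambda>x. z x > z v"] o uN obtain x where
      x: "x \<in> N v" "z x > z v" "\<not> z (rot v x) > z v" by auto
    moreover have "z (rot v x) \<noteq> z v" using x rot_E by (intro ne) (auto simp: N_iff)
    ultimately show ?thesis using o by (intro bexI[of _ x]) auto
  next
    assume o: "z u > z v \<and> z ?w < z v"
    from rot_crossing[of ?w v u "\<lambda>x. z x < z v"] o uN obtain x where
      x: "x \<in> N v" "z x < z v" "\<not> z (rot v x) < z v" by auto
    moreover have "z (rot v x) \<noteq> z v" using x rot_E by (intro ne) (auto simp: N_iff)
    ultimately show ?thesis using o by (intro bexI[of _ x]) auto
  qed
  then obtain x where x: "x \<in> N v" "x \<noteq> u" "z x < z v \<and> z v < z (rot v x) \<or> z x > z v \<and>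
      z v > z (rot v x)" by blast
  have xO: "(x, v) \<notin> Ou"
  proof
    assume "(x, v) \<in> Ou"
    then have "(x, v) = (u, v)" using inj_onD[OF snd_Ou_inj, of "(x, v)" "(u, v)"] uv by simp
    then show False using x by simp
  qed
  have "(x, v) \<in> D" using x E_sym by (auto simp: N_iff)
  from cnt_opposite[OF z(2) this xO x(3)] have "cnt z (x, v) \<ge> 1" .
  moreover have "(if (x, v) \<in> Ou then 0 else cnt z (x, v)) \<le> turns z v"
    unfolding turns_def by (rule member_le_sum) (use x finN in auto)
  ultimately show ?thesis using xO by simp
qed

lemma turns_exact:
  assumes z: "lin z" "inj_on z V"
  shows "v \<in> I \<Longrightarrow> turns z v = 2" "v \<in> B \<Longrightarrow> mid z v \<Longrightarrow> turns z v = 1"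
proof -
  let ?M = "{v\<in>B. mid z v}"
  define low where "low v = (if v \<in> I then 2 else if mid z v then 1 else 0 :: nat)" for v
  have IB: "V = I \<union> B" "I \<inter> B = {}" using B_V by (auto simp: I_def)
  have Bne: "B \<noteq> {}" using card_B big by auto
  have zfin: "finite (z ` B)" "z ` B \<noteq> {}" using finI Bne by auto
  obtain mx where mx: "mx \<in> B" "z mx = Max (z ` B)" using Max_in[OF zfin] by auto
  obtain mn where mn: "mn \<in> B" "z mn = Min (z ` B)" using Min_in[OF zfin] by auto
  have "B - {mx, mn} \<subseteq> ?M"
  proof
    fix v assume v: "v \<in> B - {mx, mn}"
    have "z v \<le> z mx" "z mn \<le> z v" using v zfin mx mn by auto
    moreover have "z v \<noteq> z mx" "z v \<noteq> z mn"
      using inj_onD[OF z(2), of v mx] inj_onD[OF z(2), of v mn] v mx mn B_V by auto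
    ultimately have "z mn < z v" "z v < z mx" by auto
    then show "v \<in> ?M" using v mx(1) mn(1) unfolding mid_def by blast
  qed
  then have "card (B - {mx, mn}) \<le> card ?M" using finI by (intro card_mono) auto
  moreover have "card B - card {mx, mn} \<le> card (B - {mx, mn})" by (rule diff_card_le_card_Diff) simp
  moreover have "card {mx, mn} \<le> 2" by (simp add: card_insert_if)
  ultimately have cM: "card TF \<le> card ?M" using card_B card_TF by simp
  have "(\<Sum>v\<in>V. low v) = (\<Sum>v\<in>I \<union> B. low v)" by (rule arg_cong[OF IB(1)])
  also have "\<dots> = (\<Sum>v\<in>I. low v) + (\<Sum>v\<in>B. low v)"
    using finI IB(2) by (rule sum.union_disjoint)
  also have "(\<Sum>v\<in>I. low v) = 2 * card I" by (simp add: low_def)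
  also have "(\<Sum>v\<in>B. low v) = (\<Sum>v\<in>B. if mid z v then 1 else 0)"
    using IB(2) by (intro sum.cong refl) (auto simp: low_def)
  also have "\<dots> = card ?M" using finI by (simp add: sum.If_cases Int_def)
  finally have suml: "(\<Sum>v\<in>V. turns z v) \<le> (\<Sum>v\<in>V. low v)" using sum_turns[OF z(2)] cM by simp
  have le: "low v \<le> turns z v" if "v \<in> V" for v
    using interior_turns[OF z, of v] boundary_turns[OF z, of v] that by (auto simp: low_def I_def)
  have eq: "turns z v = low v" if "v \<in> V" for v
  proof (rule ccontr)
    assume "turns z v \<noteq> low v"
    then have "low v < turns z v" using le[OF that] by simp
    then have "(\<Sum>v\<in>V. low v) < (\<Sum>v\<in>V. turns z v)"
        using le that finV by (intro sum_strict_mono_ex1) auto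
    then show False using suml by simp
  qed
  show "v \<in> I \<Longrightarrow> turns z v = 2" using eq[of v] by (simp add: low_def I_def)
  show "v \<in> B \<Longrightarrow> mid z v \<Longrightarrow> turns z v = 1" using eq[of v] B_V by (auto simp: low_def I_def)
qed

end

section \<open>Orientations and angle sums\<close>

lemma small_scale:
  assumes "finite S" "\<And>s. s \<in> S \<Longrightarrow> a s > 0" "\<And>s. s \<in> S \<Longrightarrow> b s \<ge> 0"
  shows "\<exists>e>0. \<forall>s\<in>S. e * b s < (a s :: real)"
  using assms
proof (induction S rule: finite_induct)
  case empty
  then show ?case by (intro exI[of _ 1]) simp
next
  case (insert s S)
  then obtain e where e: "e > 0" "\<forall>s\<in>S. e * b s < a s" by auto
  have ab: "a s > 0" "b s \<ge> 0" using insert by auto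
  \<comment> \<open>The summand 1 keeps the quotient meaningful when \<open>b s\<close> is
    zero.\<close>
  define e' where "e' = min e (a s / (b s + 1))"
  have "e' > 0" using e ab by (simp add: e'_def)
  moreover have "e' * b t < a t" if "t \<in> S" for t
  proof -
    have "e' * b t \<le> e * b t" using insert.prems that by (intro mult_right_mono) (auto simp: e'_def)
    then show ?thesis using e that by force
  qed
  moreover have "e' * b s < a s"
  proof -
    have "e' * b s \<le> a s / (b s + 1) * b s" using ab by (intro mult_right_mono) (auto simp: e'_def)
    also have "\<dots> < a s" using ab by (simp add: field_simps)
    finally show ?thesis .
  qed
  ultimately show ?case by (intro exI[of _ e']) auto
qed

lemma ccw_angle_lt_pi: "det3 u v w > 0 \<Longrightarrow> ccw_angle (w - v) (u - v) < pi"
  using ccw_angle_det3(1)[of u v w] by (cases "u = v"; cases "w = v") auto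

text \<open>Written with \<open>sgn\<close> so that products of consecutive angles at a vertex
  telescope.\<close>

lemma cis_ccw_angle: "a \<noteq> 0 \<Longrightarrow> b \<noteq> 0 \<Longrightarrow> cis (ccw_angle a b) = sgn b / sgn a"
proof -
  assume ab: "a \<noteq> 0" "b \<noteq> 0"
  have "b / a = of_real (cmod (b / a)) * cis (ccw_angle a b)" by (rule ccw_angle_cis)
  moreover have "b / a = of_real (cmod (b / a)) * (sgn b / sgn a)"
    using ab by (simp add: sgn_eq norm_divide)
  moreover have "complex_of_real (cmod (b / a)) \<noteq> 0" using ab by simp
  ultimately show ?thesis by (metis mult_cancel_left)
qed

context placed
begin

text \<open>The functionals \<open>z1\<close> and \<open>z2\<close> are the distance from the line through \<open>p u\<close> and \<open>p v\<close>,
  perturbed slightly in both directions along it.\<close>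
lemma tilt:
  assumes uv: "u \<in> V" "v \<in> V" "u \<noteq> v"
  obtains z1 z2 where "lin z1" "lin z2" "inj_on z1 V" "inj_on z2 V" "z1 u < z1 v" "z2 u > z2 v"
    "\<And>x. x \<in> V \<Longrightarrow> x \<noteq> u \<Longrightarrow> x \<noteq> v \<Longrightarrow> det3 (p u) (p v) (p x) > 0 \<and> z1 x > z1 v \<and> z2 x > z2 v \<or>
       det3 (p u) (p v) (p x) < 0 \<and> z1 x < z1 v \<and> z2 x < z2 v"
proof -
  define g where "g q = det3 (p u) (p v) (p q)" for q
  define k where "k q = (Re (p u) - Re (p v)) * Re (p q) + (Im (p u) - Im (p v)) * Im (p q)" for q
  have lg: "lin g" unfolding g_def by (rule lin_det3)
  have lk: "lin k" unfolding lin_def k_def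
    by (intro exI[of _ "Re (p u) - Re (p v)"] exI[of _ "Im (p u) - Im (p v)"] exI[of _ 0]) simp
  define S where "S = {s \<in> V \<times> V. g (fst s) \<noteq> g (snd s)}"
  \<comment> \<open>So small an \<open>e\<close> never reverses an inequality between different
    values of \<open>g\<close>; \<open>k\<close>, the coordinate along the line, only breaks
    ties.\<close>
  have "\<exists>e>0. \<forall>s\<in>S. e * \<bar>k (fst s) - k (snd s)\<bar> < \<bar>g (fst s) - g (snd s)\<bar>"
    by (rule small_scale) (use finV in \<open>auto simp: S_def\<close>)
  then obtain e where e: "e > 0" "\<And>x y. x \<in> V \<Longrightarrow> y \<in> V \<Longrightarrow> g x \<noteq> g y \<Longrightarrow> e * \<bar>k x - k y\<bar> < \<bar>g x - g y\<bar>"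
    by (force simp: S_def)
  \<comment> \<open>Up to a common scale, \<open>g\<close> and \<open>k\<close> measure orthogonal
    displacements, so points that agree in both coincide.\<close>
  have pyth: "(g x - g y)\<^sup>2 + (k x - k y)\<^sup>2 = ((Re (p u) - Re (p v))\<^sup>2
      + (Im (p u) - Im (p v))\<^sup>2) * ((Re (p x) - Re (p y))\<^sup>2 + (Im (p x) - Im (p y))\<^sup>2)" for x y
    unfolding g_def k_def det3_def by algebra
  have duv: "(Re (p u) - Re (p v))\<^sup>2 + (Im (p u) - Im (p v))\<^sup>2 > 0"
  proof -
    have "p u \<noteq> p v" using inj_p uv by (auto dest: inj_onD)
    then have "Re (p u) - Re (p v) \<noteq> 0 \<or> Im (p u) - Im (p v) \<noteq> 0" by (auto simp: complex_eq_iff)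
    then show ?thesis by (auto simp: sum_power2_gt_zero_iff)
  qed
  have inj: "inj_on (\<lambda>q. g q + f * k q) V" if f: "\<bar>f\<bar> = e" for f
  proof (rule inj_onI)
    fix x y assume xy: "x \<in> V" "y \<in> V" "g x + f * k x = g y + f * k y"
    then have eq: "g x - g y = - (f * (k x - k y))" by (simp add: algebra_simps)
    have gxy: "g x = g y"
    proof (rule ccontr)
      assume "g x \<noteq> g y"
      from e(2)[OF xy(1,2) this] show False unfolding eq using f by (simp add: abs_mult)
    qed
    then have kxy: "k x = k y" using eq f e(1) by auto
    have "((Re (p u) - Re (p v))\<^sup>2 + (Im (p u) - Im (p v))\<^sup>2) * ((Re (p x) - Re (p y))\<^sup>2
        + (Im (p x) - Im (p y))\<^sup>2) = 0"
      unfolding pyth[symmetric] by (simp add: gxy kxy)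
    then have "(Re (p x) - Re (p y))\<^sup>2 + (Im (p x) - Im (p y))\<^sup>2 = 0"
      using duv by (metis mult_eq_0_iff order_less_irrefl)
    then have "p x = p y" by (simp add: complex_eq_iff sum_power2_eq_zero_iff)
    then show "x = y" using inj_p xy by (auto dest: inj_onD)
  qed
  have g0: "g u = 0" "g v = 0" by (auto simp: g_def)
  have kuv: "k u - k v > 0" using duv by (simp add: k_def power2_eq_square algebra_simps)
  show thesis
  proof (rule that[of "\<lambda>q. g q + (- e) * k q" "\<lambda>q. g q + e * k q"])
    show "lin (\<lambda>q. g q + (- e) * k q)" "lin (\<lambda>q. g q + e * k q)" by (rule lin_add[OF lg lk])+
    show "inj_on (\<lambda>q. g q + (- e) * k q) V" "inj_on (\<lambda>q. g q + e * k q) V"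
        using e by (intro inj; simp)+
    have "e * k u > e * k v" using kuv e(1) by simp
    then show "g u + - e * k u < g v + - e * k v" "g v + e * k v < g u + e * k u" using g0 by simp_all
    fix x assume x: "x \<in> V" "x \<noteq> u" "x \<noteq> v"
    have gx: "g x \<noteq> 0" using gp[of u v x] x uv by (simp add: g_def)
    have "e * \<bar>k x - k v\<bar> < \<bar>g x\<bar>" using e(2)[OF x(1) uv(2)] gx g0 by simp
    then have "\<bar>e * k x - e * k v\<bar> < \<bar>g x\<bar>"
        using e(1) by (simp add: right_diff_distrib[symmetric] abs_mult)
    then show "det3 (p u) (p v) (p x) > 0 \<and> g x + - e * k x > g v + - e * k v \<and>
        g x + e * k x > g v + e * k v \<or>
       det3 (p u) (p v) (p x) < 0 \<and> g x + - e * k x < g v + - e * k v \<and> g x + e * k x < g v + e * k v"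
      using gx unfolding g_def[symmetric] g0 by (cases "g x > 0") auto
  qed
qed

text \<open>The weights are the barycentric coordinates of \<open>x\<close> in the triangle of its
  fathers; hence all subtriangles have the orientation of that triangle.\<close>

lemma Q_dets:
  assumes x: "x \<in> I"
  defines "G \<equiv> det3 (p (fa x)) (p (fb x)) (p (fc x))"
  shows "det3 (p (fb x)) (p (fc x)) (p x) = la x * G" "det3 (p (fc x)) (p (fa x)) (p x) = lb x * G"
    "det3 (p (fa x)) (p (fb x)) (p x) = lc x * G"
  using lin_comb[OF lin_det3 x, of "p (fb x)" "p (fc x)"] lin_comb[OF lin_det3 x, of "p (fc x)"
      "p (fa x)"]
    lin_comb[OF lin_det3 x, of "p (fa x)" "p (fb x)"]
    det3_rotate[of "p (fb x)" "p (fc x)" "p (fa x)"] det3_rotate[of "p (fc x)" "p (fa x)" "p (fb x)"]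
  by (simp_all add: G_def)

text \<open>With \<open>g\<close> zero at both ends of the diagonal, the combination at
  \<open>x\<close> leaves a positive combination of the values at \<open>fa x\<close> and
  \<open>fb x\<close> that is zero.\<close>

lemma diagonal_separates:
  assumes x: "x \<in> I" and g: "lin g" "g x = 0" "g (fc x) = 0" "g (fa x) \<noteq> 0" "g (fb x) \<noteq> 0"
  shows "g (fa x) > 0 \<and> g (fb x) < 0 \<or> g (fa x) < 0 \<and> g (fb x) > 0"
proof -
  have 0: "la x * g (fa x) + lb x * g (fb x) = 0" using lin_comb[OF g(1) x] g by simp
  note c = coeffs[OF x]
  show ?thesis
  proof (cases "g (fa x) > 0")
    case True
    then have "la x * g (fa x) > 0" using c by simp
    then have "lb x * g (fb x) < 0" using 0 by linarith
    then show ?thesis using True c by (simp add: mult_less_0_iff)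
  next
    case False
    then have a: "g (fa x) < 0" using g by simp
    then have "la x * g (fa x) < 0" using c by (simp add: mult_pos_neg)
    then have "lb x * g (fb x) > 0" using 0 by linarith
    then show ?thesis using a c by (simp add: zero_less_mult_iff)
  qed
qed

text \<open>The outer neighbours of \<open>v\<close> lie on different sides of the chord. Hence
  \<open>v\<close> is extreme among the outer vertices in neither tilt, and its number of turns is
  known in both.\<close>

lemma chord_mid:
  assumes uv: "u \<in> B" "v \<in> B" "u \<noteq> v" "(u, v) \<notin> Ou" "(v, u) \<notin> Ou"
  shows "\<exists>x\<in>B - {u, v}. \<exists>y\<in>B - {u, v}. det3 (p u) (p v) (p x) > 0 \<and> det3 (p u) (p v) (p y) < 0"
proof -
  from uv(2) obtain x where xv: "(x, v) \<in> Ou" by (auto simp: B_def)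
  have vy: "(v, rot v x) \<in> Ou" using face_fs[OF xv] by simp
  let ?y = "rot v x"
  have xB: "x \<in> B" using fst_Ou[OF xv] by simp
  have yB: "?y \<in> B" unfolding B_def by (rule image_eqI[OF _ vy]) simp
  note xB = xB yB
  have ne: "x \<noteq> u" "?y \<noteq> u" using uv(4,5) xv vy by metis+
  have "E x v" "E v ?y" using Ou_D[OF xv] Ou_D[OF vy] by simp_all
  then have nv: "x \<noteq> v" "?y \<noteq> v" using E_irr[of x v] E_irr[of v ?y] by auto
  have "det3 (p v) (p x) (p u) > 0" using conv[OF xv uv(1)] ne uv by auto
  moreover have "det3 (p ?y) (p v) (p u) > 0" using conv[OF vy uv(1)] ne uv by auto
  ultimately have "det3 (p u) (p v) (p x) > 0" "det3 (p u) (p v) (p ?y) < 0"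
    using det3_rotate[of "p v" "p x" "p u"] det3_rotate[of "p v" "p u" "p ?y"] det3_swap[of "p v"
        "p u" "p ?y"] by auto
  then show ?thesis using xB ne nv by blast
qed

text \<open>Between the two tilts the vertex \<open>v\<close> becomes or stops being a median only in the two
  triangles at the edge \<open>u v\<close>; as its number of turns is the same, the two changes cancel.\<close>
lemma fold_free_aux:
  assumes d: "(u, v) \<in> D" "(u, v) \<notin> Ou" "(v, u) \<notin> Ou" and c: "v \<in> I \<or> u \<in> B \<and> v \<in> B"
  shows "det3 (p u) (p v) (p (third (u, v))) > 0 \<longleftrightarrow> det3 (p u) (p v) (p (third (v, u))) < 0"
proof -
  let ?g = "\<lambda>x. det3 (p u) (p v) (p x)"
  have E: "E u v" "E v u" using d(1) E_sym by auto
  have uv: "u \<in> V" "v \<in> V" "u \<noteq> v" using E E_V E_irr by blast+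
  from tilt[OF uv] obtain z1 z2 where z: "lin z1" "lin z2" "inj_on z1 V" "inj_on z2 V" "z1 u < z1 v"
      "z2 u > z2 v"
    and sg: "\<And>x. x \<in> V \<Longrightarrow> x \<noteq> u \<Longrightarrow> x \<noteq> v \<Longrightarrow> ?g x > 0 \<and> z1 x > z1 v \<and> z2 x > z2 v \<or>
       ?g x < 0 \<and> z1 x < z1 v \<and> z2 x < z2 v" by metis
  have turns: "turns z1 v = turns z2 v"
  proof (cases "v \<in> I")
    case True
    then show ?thesis using turns_exact(1) z by simp
  next
    case False
    then have uvB: "u \<in> B" "v \<in> B" using c by auto
    from chord_mid[OF uvB uv(3) d(2,3)] obtain x y
        where xy: "x \<in> B - {u, v}" "y \<in> B - {u, v}" "?g x > 0" "?g y < 0" by blast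
    have xyV: "x \<in> V" "y \<in> V" using xy(1,2) B_V by auto
    have "z1 x > z1 v \<and> z2 x > z2 v" using sg[OF xyV(1)] xy(1,3) by auto
    moreover have "z1 y < z1 v \<and> z2 y < z2 v" using sg[OF xyV(2)] xy(2,4) by auto
    ultimately have "mid z1 v" "mid z2 v" using xy(1,2) unfolding mid_def by blast+
    then show ?thesis using turns_exact(2) z uvB by simp
  qed
  have ch_eq: "ch z1 v x y = ch z2 v x y" if "x \<in> V" "x \<noteq> u" "x \<noteq> v" "y \<in> V" "y \<noteq> u" "y \<noteq> v" for x y
    using sg[OF that(1-3)] sg[OF that(4-6)] by (auto simp: ch_opposite ch_agree)
  have uN: "u \<in> N v" using E by (simp add: N_iff)
  \<comment> \<open>The edge from \<open>v\<close> to \<open>u\<close> bounds two corners at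
    \<open>v\<close>: that of \<open>(u, v)\<close> and the preceding one, that of
    \<open>(u', v)\<close>.\<close>
  then obtain u' where u': "u' \<in> N v" "rot v u' = u"
      using rot_bij[of v] by (metis bij_betw_imp_surj_on imageE)
  have d2: "(u', v) \<in> D" using u' E_sym by (auto simp: N_iff)
  have d2O: "(u', v) \<notin> Ou"
  proof
    assume "(u', v) \<in> Ou"
    from face_fs[OF this] show False using u'(2) d(3) by simp
  qed
  have dvu: "(v, u) \<in> D" using E by simp
  note cd = corner_distinct[OF d(1,2)] and cd2 = corner_distinct[OF d2 d2O] and cd3
      = corner_distinct[OF dvu d(3)]
  have neu: "u' \<noteq> u" using cd(3) u' by auto
  define f where "f z x = (if (x, v) \<in> Ou then 0 else cnt z (x, v))" for z x
  define R where "R = N v - {u, u'}"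
  have split: "turns z v = f z u + f z u' + (\<Sum>x\<in>R. f z x)" for z
  proof -
    have "turns z v = (\<Sum>x\<in>N v. f z x)" by (simp add: turns_def f_def)
    also have "\<dots> = (\<Sum>x\<in>{u, u'}. f z x) + (\<Sum>x\<in>R. f z x)"
      unfolding R_def by (subst add.commute, rule sum.subset_diff) (use uN u' finN in auto)
    finally show ?thesis using neu by simp
  qed
  have "f z1 x = f z2 x" if x: "x \<in> R" for x
  proof (cases "(x, v) \<in> Ou")
    case False
    have xN: "x \<in> N v" "x \<noteq> u" "x \<noteq> u'" using x by (auto simp: R_def)
    have xD: "(x, v) \<in> D" using xN E_sym by (auto simp: N_iff)
    note c1 = corner_distinct[OF xD False]
    have ru: "rot v x \<noteq> u"
    proof
      assume "rot v x = u"
      then have "x = u'" using u' rot_eqD[of v x u'] xN by (auto simp: N_iff)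
      then show False using xN by simp
    qed
    have "cnt z1 (x, v) = cnt z2 (x, v)"
    proof (cases "third (x, v) = u")
      case False
      then show ?thesis using c1 ru xN ch_eq by (simp add: cnt_def)
    next
      case True
      \<comment> \<open>A diagonal from \<open>v\<close> may end at \<open>u\<close> as well,
        parallel to the edge. It separates the two ends of its corner, so the corner counts one in
        both tilts, wherever \<open>u\<close> falls.\<close>
      have opp: "?g x > 0 \<and> ?g (rot v x) < 0 \<or> ?g x < 0 \<and> ?g (rot v x) > 0"
        using xD False
      proof (cases rule: corner_cases)
        case flat
        then show ?thesis using True ru by simp
      next
        case reflex
        have "?g x \<noteq> 0" "?g (rot v x) \<noteq> 0" using gp[of u v x] gp[of u v "rot v x"] c1 uv ru xN by auto
        then show ?thesis using diagonal_separates[OF reflex(1), of ?g] lin_det3 reflex True by auto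
      next
        case (opp y)
        have "?g x \<noteq> 0" "?g (rot v x) \<noteq> 0" using gp[of u v x] gp[of u v "rot v x"] c1 uv ru xN by auto
        then show ?thesis using diagonal_separates[OF opp(1), of ?g] lin_det3 opp True by auto
      qed
      have s: "z x < z v \<and> z v < z (rot v x) \<or> z x > z v \<and> z v > z (rot v x) \<Longrightarrow> z u < z v \<or> z u > z v \<Longrightarrow>
          cnt z (x, v) = 1" for z
        unfolding cnt_def using True by (auto simp: ch_opposite ch_agree)
      have "cnt z1 (x, v) = 1" "cnt z2 (x, v) = 1"
        using opp sg[of x] sg[of "rot v x"] c1 xN ru z(5,6) by (intro s; auto)+
      then show ?thesis by simp
    qed
    then show ?thesis by (simp add: f_def)
  qed (simp add: f_def)
  then have "(\<Sum>x\<in>R. f z1 x) = (\<Sum>x\<in>R. f z2 x)" by (rule sum.cong[OF refl])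
  then have main: "f z1 u + f z1 u' = f z2 u + f z2 u'" using split[of z1] split[of z2] turns by simp
  let ?t = "third (u, v)" and ?t' = "third (v, u)" and ?w = "rot v u"
  have fu: "f z u = ch z v u ?t + ch z v ?t ?w" for z using d by (simp add: f_def cnt_def)
  have fu': "f z u' = ch z v u' ?t' + ch z v ?t' u" for z
      using cnt_alt[OF d2 d2O] d2O u' by (simp add: f_def)
  have e1: "ch z1 v ?t ?w = ch z2 v ?t ?w" using cd by (intro ch_eq) auto
  have e2: "ch z1 v u' ?t' = ch z2 v u' ?t'" using cd2 cd3 neu by (intro ch_eq) auto
  have m2: "ch z1 v u ?t + ch z1 v ?t' u = ch z2 v u ?t + ch z2 v ?t' u"
    using main unfolding fu fu' e1 e2 by simp
  have st: "?g ?t > 0 \<and> z1 ?t > z1 v \<and> z2 ?t > z2 v \<or> ?g ?t < 0 \<and> z1 ?t < z1 v \<and> z2 ?t < z2 v"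
    using cd by (intro sg) auto
  have st': "?g ?t' > 0 \<and> z1 ?t' > z1 v \<and> z2 ?t' > z2 v \<or> ?g ?t' < 0 \<and> z1 ?t' < z1 v \<and> z2 ?t' < z2 v"
    using cd3 by (intro sg) auto
  show ?thesis using m2 st st' z(5,6) by (auto simp: ch_opposite ch_agree)
qed

text \<open>An outer \<open>v\<close> with interior \<open>u\<close> may be extreme in one of the
  tilts; the argument is then made at \<open>u\<close>.\<close>

lemma fold_free:
  assumes d: "(u, v) \<in> D" "(u, v) \<notin> Ou" "(v, u) \<notin> Ou"
  shows "det3 (p u) (p v) (p (third (u, v))) > 0 \<longleftrightarrow> det3 (p v) (p u) (p (third (v, u))) > 0"
proof (cases "v \<in> I \<or> u \<in> B \<and> v \<in> B")
  case True
  then show ?thesis using fold_free_aux[OF d] det3_swap[of "p u" "p v" "p (third (v, u))"] by simp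
next
  case False
  have "u \<in> V" "v \<in> V" using d(1) E_V by auto
  then have "u \<in> I" using False by (auto simp: I_def)
  moreover have "(v, u) \<in> D" using d(1) E_sym by auto
  ultimately show ?thesis
    using fold_free_aux[of v u] d(2,3) det3_swap[of "p u" "p v" "p (third (u, v))"] by simp
qed

definition posd :: "'a \<times> 'a \<Rightarrow> bool" where
  "posd d \<longleftrightarrow> det3 (p (fst d)) (p (snd d)) (p (third d)) > 0"

text \<open>Both halves of a quadrilateral are positive multiples of the triangle of fathers, so all
  darts of a face share one orientation.\<close>

lemma posd_fs:
  assumes d: "(u, v) \<in> D" "(u, v) \<notin> Ou" shows "posd (u, v) \<longleftrightarrow> posd (v, rot v u)"
  using d
proof (cases rule: corner_cases)
  case flat
  then show ?thesis using det3_rotate[of "p v" "p (rot v u)" "p u"] by (simp add: posd_def)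
next
  case reflex
  note q = Q_dets[OF reflex(1)] and c = coeffs[OF reflex(1)]
  have "det3 (p u) (p v) (p (third (u, v))) = lb v * det3 (p (fa v)) (p (fb v)) (p (fc v))"
    using q(2) reflex det3_rotate[of "p (fa v)" "p v" "p (fc v)"] by simp
  moreover have "det3 (p v) (p (rot v u)) (p (third (v, rot v u)))
      = la v * det3 (p (fa v)) (p (fb v)) (p (fc v))"
    using q(1) reflex det3_rotate[of "p (fb v)" "p (fc v)" "p v"] by simp
  ultimately show ?thesis using c by (simp add: posd_def zero_less_mult_iff)
next
  case (opp x)
  note q = Q_dets[OF opp(1)] and c = coeffs[OF opp(1)]
  show ?thesis using q opp c by (simp add: posd_def zero_less_mult_iff)
qed

text \<open>The inner sides of outer edges are positive because all vertices lie on one side of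
  them. From there positivity spreads along faces and across edges, which reaches every
  dart.\<close>

lemma all_posd:
  assumes "d \<in> D" "d \<notin> Ou" shows "posd d"
proof -
  have "d \<in> {d. d \<in> Ou \<or> posd d}"
  proof (rule dart_closed[OF outer_D _ _ _ assms(1)])
    show "outer \<in> {d. d \<in> Ou \<or> posd d}" by simp
    fix e assume e: "e \<in> D" "e \<in> {d. d \<in> Ou \<or> posd d}"
    obtain u v where uv: "e = (u, v)" by (cases e)
    show "fs e \<in> {d. d \<in> Ou \<or> posd d}"
    proof (cases "e \<in> Ou")
      case True
      from face_fs[OF this] show ?thesis by simp
    next
      case False
      then show ?thesis using e posd_fs[of u v] uv by simp
    qed
    have vu: "(v, u) \<in> D" using e uv E_sym by auto
    show "prod.swap e \<in> {d. d \<in> Ou \<or> posd d}"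
    proof (cases "(v, u) \<in> Ou")
      case True
      then show ?thesis by (simp add: uv)
    next
      case vuO: False
      have "posd (v, u)"
      proof (cases "e \<in> Ou")
        case True
        then show ?thesis using outer_pos[of u v "third (v, u)"] corner_distinct[OF vu vuO] uv
            by (simp add: posd_def)
      next
        case False
        then show ?thesis using fold_free[of u v] e uv vuO by (simp add: posd_def)
      qed
      then show ?thesis by (simp add: uv)
    qed
  qed
  then show ?thesis using assms(2) by simp
qed

lemma Q_positive: "x \<in> I \<Longrightarrow> det3 (p (fa x)) (p (fb x)) (p (fc x)) > 0"
proof -
  assume x: "x \<in> I"
  have m: "(fb x, fc x) \<in> Q x" by (simp add: Q_def)
  have "posd (fb x, fc x)"
  proof (rule all_posd)
    show "(fb x, fc x) \<in> D" using quad(10)[OF x] by simp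
    show "(fb x, fc x) \<notin> Ou" by (rule IF_disj[OF quad(1)[OF x] m])
  qed
  then have "la x * det3 (p (fa x)) (p (fb x)) (p (fc x)) > 0"
    using third_Q(3)[OF x] Q_dets(1)[OF x] by (simp add: posd_def)
  then show ?thesis using coeffs(1)[OF x] by (simp add: zero_less_mult_iff)
qed

lemma reflex_interior:
  assumes "(u, v) \<in> D" "(u, v) \<notin> Ou" "reflex (u, v)" shows "v \<in> I" "u = fa v"
proof -
  show "u = fa v" using fa_unique assms by simp
  show "v \<in> I"
  proof (rule ccontr)
    assume "v \<notin> I"
    then have "v \<in> B" using assms(1) E_V by (auto simp: I_def)
    then obtain x where xO: "(x, v) \<in> Ou" by (auto simp: B_def)
    have "(x, v) = (u, v)"
      using reflex_unique[OF Ou_D[OF xO] assms(1) outer_reflex[OF xO] assms(3)] by simp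
    then show False using assms(2) xO by simp
  qed
qed

lemma corner_det:
  assumes "(u, v) \<in> D" "(u, v) \<notin> Ou"
  shows "if reflex (u, v) then det3 (p u) (p v) (p (rot v u)) < 0 else det3 (p u) (p v) (p (rot v u))
      > 0"
proof (cases "reflex (u, v)")
  case True
  note r = reflex_interior[OF assms True]
  have "det3 (p (fa v)) (p (fb v)) (p v) > 0"
      using Q_dets(3)[OF r(1)] Q_positive[OF r(1)] coeffs[OF r(1)] by simp
  then have "det3 (p (fa v)) (p v) (p (fb v)) < 0"
    using det3_swap[of "p (fa v)" "p v" "p (fb v)"] det3_rotate[of "p (fa v)" "p (fb v)" "p v"]
        by simp
  then show ?thesis using True r Q_rot(1)[OF r(1)] by simp
next
  case nr: False
  have "det3 (p u) (p v) (p (rot v u)) > 0"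
    using assms
  proof (cases rule: corner_cases)
    case flat
    then show ?thesis using all_posd[OF assms] by (simp add: posd_def)
  next
    case reflex
    then show ?thesis using nr fa[of v] by (simp add: I_def)
  next
    case (opp x)
    then show ?thesis using Q_positive[OF opp(1)] det3_rotate[of "p (fb x)" "p (fc x)" "p (fa x)"]
        by simp
  qed
  then show ?thesis using nr by simp
qed

section \<open>Angle sums and the rotation system\<close>

abbreviation ang where "ang \<equiv> corner_angle p rot"

lemma ang_pair: "ang (u, v) = ccw_angle (p (rot v u) - p v) (p u - p v)"
  by (simp add: corner_angle_def)

lemma p_ne: "x \<in> V \<Longrightarrow> y \<in> V \<Longrightarrow> x \<noteq> y \<Longrightarrow> p x \<noteq> p y"
  using inj_p by (auto dest: inj_onD)

lemma interior_ang:
  assumes d: "(u, v) \<in> D" "(u, v) \<notin> Ou"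
  shows "reflex (u, v) \<longleftrightarrow> ang (u, v) > pi" "\<not> reflex (u, v) \<longleftrightarrow> ang (u, v) < pi"
proof -
  note c = corner_distinct[OF d]
  have ne: "p u \<noteq> p v" "p (rot v u) \<noteq> p v" using p_ne c by metis+
  have nz: "det3 (p u) (p v) (p (rot v u)) \<noteq> 0" using gp c by metis
  note k = ccw_angle_det3(1)[OF ne] ccw_angle_det3(2)[OF ne nz]
  show "reflex (u, v) \<longleftrightarrow> ang (u, v) > pi" "\<not> reflex (u, v) \<longleftrightarrow> ang (u, v) < pi"
    using corner_det[OF d] unfolding ang_pair k by (auto split: if_splits)
qed

lemma outer_ang: "d \<in> Ou \<Longrightarrow> ang d = pi + 2 * pi / real h"
  using outer_angle by (cases d) (simp add: ang_pair)

lemma h_pos: "real h > 0" using big by simp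

lemma reflex_iff_ang: "d \<in> D \<Longrightarrow> reflex d \<longleftrightarrow> ang d > pi"
proof (cases "d \<in> Ou")
  case True
  have "2 * pi / real h > 0" using h_pos by simp
  then show ?thesis using outer_ang[OF True] outer_reflex[OF True] by simp
next
  case False
  assume "d \<in> D"
  then show ?thesis using interior_ang(1)[of "fst d" "snd d"] False by simp
qed

lemma triangle_sum: assumes F: "F \<in> TF" shows "(\<Sum>d\<in>F. ang d) = pi"
proof -
  have F': "F \<in> IF" "card F = 3" using F by (auto simp: TF_def)
  then have "F \<noteq> {}" by auto
  then obtain x y where xy: "(x, y) \<in> F" by (metis ex_in_conv surj_pair)
  note t = triangle_face[OF F' xy]
  let ?w = "rot y x"
  have "(\<Sum>d\<in>F. ang d) = ang (x, y) + ang (y, ?w) + ang (?w, x)"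
    by (subst t(1)) (use t(4) in simp)
  also have "\<dots> = pi"
    unfolding ang_pair t(2,3)
  proof (rule triangle_angle_sum)
    show "det3 (p x) (p y) (p ?w) > 0"
      using all_posd[of "(x, y)"] IF_disj[OF F'(1) xy] t(5) third_TF[OF F xy] by (simp add: posd_def)
  qed
  finally show ?thesis .
qed

text \<open>The diagonal splits the corners at \<open>x\<close> and \<open>fc x\<close> into angles
  below \<open>pi\<close>, so they add without reduction and two triangle sums remain.\<close>

lemma quad_sum: assumes x: "x \<in> I" shows "(\<Sum>d\<in>Q x. ang d) = 2 * pi"
proof -
  let ?a = "p (fa x)" and ?b = "p (fb x)" and ?c = "p (fc x)" and ?x = "p x"
  have xV: "x \<in> V" using x by (simp add: I_def)
  note q = quad[OF x]
  have ne: "?a \<noteq> ?x" "?x \<noteq> ?b" "?b \<noteq> ?c" "?c \<noteq> ?a" "?a \<noteq> ?b" "?x \<noteq> ?c"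
    using q(7,13-15) xV by (auto simp: inj_on_eq_iff[OF inj_p])
  have d1: "det3 ?x ?b ?c > 0" using Q_dets(1)[OF x] Q_positive[OF x] coeffs[OF x] det3_rotate[of ?b
      ?c ?x] by simp
  have d2: "det3 ?c ?a ?x > 0" using Q_dets(2)[OF x] Q_positive[OF x] coeffs[OF x] by simp
  have lt: "ccw_angle (?b - ?x) (?c - ?x) < pi" "ccw_angle (?c - ?x) (?a - ?x) < pi"
    "ccw_angle (?a - ?c) (?x - ?c) < pi" "ccw_angle (?x - ?c) (?b - ?c) < pi"
  proof -
    have "det3 ?b ?c ?x > 0" using d1 unfolding det3_rotate[of ?b ?c ?x] .
    moreover from this have "det3 ?c ?x ?b > 0" unfolding det3_rotate[of ?c ?x ?b] .
    moreover have "det3 ?a ?x ?c > 0" using d2 unfolding det3_rotate[of ?a ?x ?c] .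
    moreover from this have "det3 ?x ?c ?a > 0" unfolding det3_rotate[of ?x ?c ?a] .
    ultimately show "ccw_angle (?b - ?x) (?c - ?x) < pi" "ccw_angle (?c - ?x) (?a - ?x) < pi"
      "ccw_angle (?a - ?c) (?x - ?c) < pi" "ccw_angle (?x - ?c) (?b - ?c) < pi"
      by (simp_all only: ccw_angle_lt_pi)
  qed
  have s1: "ccw_angle (?b - ?x) (?a - ?x) = ccw_angle (?b - ?x) (?c - ?x)
      + ccw_angle (?c - ?x) (?a - ?x)"
    using ne lt by (intro ccw_angle_add) auto
  have s2: "ccw_angle (?a - ?c) (?b - ?c) = ccw_angle (?a - ?c) (?x - ?c)
      + ccw_angle (?x - ?c) (?b - ?c)"
    using ne lt by (intro ccw_angle_add) auto
  have "(\<Sum>d\<in>Q x. ang d) = ang (fa x, x) + ang (x, fb x) + ang (fb x, fc x) + ang (fc x, fa x)"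
    unfolding Q_def using q(7) by simp
  also have "\<dots> = ccw_angle (?b - ?x) (?a - ?x) + ccw_angle (?c - ?b) (?x - ?b)
      + ccw_angle (?a - ?c) (?b - ?c) + ccw_angle (?x - ?a) (?c - ?a)"
    unfolding ang_pair Q_rot[OF x] ..
  also have "\<dots> = pi + pi"
    using triangle_angle_sum[OF d1] triangle_angle_sum[OF d2] s1 s2 by simp
  finally show ?thesis by simp
qed

text \<open>The outer face contributes \<open>h * pi + 2 * pi\<close>, the h - 2 triangles
  \<open>pi\<close> each and the quadrilaterals \<open>2 * pi\<close> each.\<close>

lemma total_angle: "(\<Sum>d\<in>D. ang d) = 2 * pi * real (card V)"
proof -
  have "(\<Sum>d\<in>Ou. ang d) = real h * (pi + 2 * pi / real h)" using outer_ang by simp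
  also have "\<dots> = real h * pi + 2 * pi" using h_pos by (simp add: field_simps)
  finally have tot: "(\<Sum>d\<in>D. ang d) = real h * pi + 2 * pi + real (card TF) * pi
      + real (card I) * (2 * pi)"
    unfolding sum_D using triangle_sum quad_sum by simp
  have cv: "real (card V) = real h + real (card I)" using card_V by simp
  have hh: "real h = real (card TF) + 2" using card_TF by simp
  show ?thesis unfolding tot cv hh by (simp add: algebra_simps)
qed

text \<open>Around a vertex the directions telescope to 1, so the angle sum is a multiple of
  \<open>2 * pi\<close>, and it is positive.\<close>

lemma vertex_angle_ge: assumes v: "v \<in> V" shows "(\<Sum>u\<in>N v. ang (u, v)) \<ge> 2 * pi"
proof (rule ccontr)
  let ?S = "\<Sum>u\<in>N v. ang (u, v)"
  assume "\<not> ?S \<ge> 2 * pi"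
  have ne: "p u - p v \<noteq> 0" if "u \<in> N v" for u
    using p_ne[of u v] E_V[of v u] E_irr[of v u] that by (auto simp: N_iff)
  have "cis ?S = (\<Prod>u\<in>N v. cis (ang (u, v)))" by (rule cis_sum[OF finN])
  also have "\<dots> = (\<Prod>u\<in>N v. sgn (p u - p v) / sgn (p (rot v u) - p v))"
  proof (rule prod.cong)
    fix u assume "u \<in> N v"
    moreover from this have "rot v u \<in> N v" using rot_E by (auto simp: N_iff)
    ultimately show "cis (ang (u, v)) = sgn (p u - p v) / sgn (p (rot v u) - p v)"
      unfolding ang_pair using ne by (intro cis_ccw_angle)
  qed simp
  also have "\<dots> = (\<Prod>u\<in>N v. sgn (p u - p v)) / (\<Prod>u\<in>N v. sgn (p (rot v u) - p v))"
    by (rule prod_dividef)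
  also have "(\<Prod>u\<in>N v. sgn (p (rot v u) - p v)) = (\<Prod>u\<in>N v. sgn (p u - p v))"
    by (rule prod.reindex_bij_betw[OF rot_bij])
  also have "(\<Prod>u\<in>N v. sgn (p u - p v)) / (\<Prod>u\<in>N v. sgn (p u - p v)) = 1"
    using ne finN by (intro divide_self) (auto simp: sgn_zero_iff)
  finally have "cis ?S = 1" .
  moreover have "?S > 0"
  proof (rule sum_pos)
    obtain d where "d \<in> D" "snd d = v" using reflex_ex[OF v] by blast
    then have "E v (fst d)" using E_sym by (auto simp: D_iff)
    then show "N v \<noteq> {}" unfolding N_def by blast
  qed (use finN in \<open>auto simp: ang_pair ccw_angle_bounds\<close>)
  ultimately have "?S = 0" using \<open>\<not> ?S \<ge> 2 * pi\<close> by (intro cis_eq_1) auto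
  then show False using \<open>?S > 0\<close> by simp
qed

lemma vertex_angle: assumes v: "v \<in> V" shows "(\<Sum>u\<in>N v. ang (u, v)) = 2 * pi"
proof (rule ccontr)
  assume "(\<Sum>u\<in>N v. ang (u, v)) \<noteq> 2 * pi"
  then have "2 * pi < (\<Sum>u\<in>N v. ang (u, v))" using vertex_angle_ge[OF v] by simp
  then have "(\<Sum>v\<in>V. 2 * pi) < (\<Sum>v\<in>V. \<Sum>u\<in>N v. ang (u, v))"
    using vertex_angle_ge finV v by (intro sum_strict_mono_ex1) auto
  then show False using total_angle unfolding sum_darts by simp
qed

text \<open>Rotate from \<open>u\<close> until \<open>x\<close> is first reached. The corners passed
  are distinct, so their sum is at most the full angle at \<open>v\<close> and therefore equals the
  angle from \<open>x\<close> to \<open>u\<close>; the angle from \<open>rot v u\<close> to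
  \<open>u\<close> is its first summand.\<close>

lemma rotation_realized: "realizes_rotation V E rot p"
  unfolding realizes_rotation_def
proof (intro ballI allI impI)
  fix v u x assume v: "v \<in> V" and ux: "E v u" "E v x"
  let ?r = "\<lambda>i. (rot v ^^ i) u"
  have rN: "?r i \<in> N v" for i by (induction i) (use ux rot_E in \<open>auto simp: N_iff\<close>)
  have ne: "p w - p v \<noteq> 0" if "w \<in> N v" for w
    using p_ne[of w v] E_V[of v w] E_irr[of v w] that by (auto simp: N_iff)
  obtain n where "(rot v ^^ n) (rot v u) = x" using rot_trans[of v "rot v u" x] rot_E ux by blast
  then have ex: "\<exists>j. j \<ge> 1 \<and> ?r j = x" by (intro exI[of _ "Suc n"]) (simp add: funpow_swap1)
  \<comment> \<open>At least one step is required: for \<open>x = u\<close> the walk goes once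
    around and yields \<open>2 * pi\<close>.\<close>
  define j where "j = (LEAST j. j \<ge> 1 \<and> ?r j = x)"
  have j: "j \<ge> 1" "?r j = x" using LeastI_ex[OF ex] unfolding j_def by auto
  have least: "\<not> (k \<ge> 1 \<and> ?r k = x)" if "k < j" for k
      using not_less_Least that unfolding j_def by blast
  have inj: "inj_on ?r {..<j}"
  proof (rule linorder_inj_onI)
    fix i k assume ik: "i < k" "i \<in> {..<j}" "k \<in> {..<j}"
    show "?r i \<noteq> ?r k"
    proof
      assume eq: "?r i = ?r k"
      have "?r (j - k + i) = (rot v ^^ (j - k)) (?r k)" by (simp add: funpow_add eq)
      also have "\<dots> = ?r (j - k + k)" by (simp add: funpow_add)
      finally have "?r (j - k + i) = x" using j ik by simp
      moreover have "j - k + i < j" "j - k + i \<ge> 1" using ik by auto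
      ultimately show False using least by blast
    qed
  qed auto
  define S where "S k = (\<Sum>i<k. ang (?r i, v))" for k
  have pos: "ang d > 0" for d by (simp add: corner_angle_def ccw_angle_bounds)
  have "S j = (\<Sum>w\<in>?r ` {..<j}. ang (w, v))" unfolding S_def by (simp add: sum.reindex[OF inj])
  also have "\<dots> \<le> (\<Sum>w\<in>N v. ang (w, v))"
    using rN finN pos by (intro sum_mono2) (auto intro: less_imp_le)
  finally have Sle: "S j \<le> 2 * pi" using vertex_angle[OF v] by simp
  have cisS: "cis (S k) = sgn (p u - p v) / sgn (p (?r k) - p v)" for k
  proof (induction k)
    case 0
    then show ?case using ne[OF rN[of 0]] by (simp add: S_def sgn_zero_iff)
  next
    case (Suc k)
    have "cis (S (Suc k)) = cis (S k) * cis (ang (?r k, v))" by (simp add: S_def cis_mult)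
    also have "cis (ang (?r k, v)) = sgn (p (?r k) - p v) / sgn (p (?r (Suc k)) - p v)"
      unfolding ang_pair using cis_ccw_angle[OF ne[OF rN[of "Suc k"]] ne[OF rN[of k]]] by simp
    finally show ?case using Suc ne[OF rN[of k]] by (simp add: sgn_zero_iff)
  qed
  have Spos: "S j \<ge> ang (u, v)"
  proof -
    have "(\<Sum>i\<in>{0}. ang (?r i, v)) \<le> S j" unfolding S_def
      using j pos by (intro sum_mono2) (auto intro: less_imp_le)
    then show ?thesis by simp
  qed
  have un: "p u - p v \<noteq> 0" "p x - p v \<noteq> 0" using ne[OF rN[of 0]] ne[of x] ux by (auto simp: N_iff)
  have "ccw_angle (p x - p v) (p u - p v) = S j"
  proof (rule ccw_angle_unique[of _ _ _ "cmod ((p u - p v) / (p x - p v))"])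
    show "0 < S j" using Spos pos[of "(u, v)"] by linarith
    show "(p u - p v) / (p x - p v) = of_real (cmod ((p u - p v) / (p x - p v))) * cis (S j)"
      using ccw_angle_cis[of "p u - p v" "p x - p v"] cis_ccw_angle[OF un(2,1)] cisS[of j] j(2)
          by simp
  qed (use Sle un in auto)
  then show "ccw_angle (p (rot v u) - p v) (p u - p v) \<le> ccw_angle (p x - p v) (p u - p v)"
    using Spos by (simp add: ang_pair)
qed

end

section \<open>Absence of crossings\<close>

text \<open>The derivative of \<open>det3 a b\<close> in the direction \<open>w\<close>.\<close>

definition crs :: "complex \<Rightarrow> complex \<Rightarrow> complex \<Rightarrow> real" where
  "crs a b w = (Re b - Re a) * Im w - (Im b - Im a) * Re w"

lemma det3_move: "det3 a b (q + e *\<^sub>R w) = det3 a b q + e * crs a b w"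
  by (simp add: det3_def crs_def algebra_simps)

lemma det3_segment: "det3 a b ((1 - s) *\<^sub>R x + s *\<^sub>R y) = (1 - s) * det3 a b x + s * det3 a b y"
  by (simp add: det3_def algebra_simps)

lemma move_into_open:
  fixes q w :: complex
  assumes "finite S" "\<And>a b. (a, b) \<in> S \<Longrightarrow> det3 a b q > 0"
  shows "\<exists>e>0. \<forall>(a, b)\<in>S. det3 a b (q + e *\<^sub>R w) > 0"
proof -
  have "\<exists>e>0. \<forall>s\<in>S. e * \<bar>crs (fst s) (snd s) w\<bar> < det3 (fst s) (snd s) q"
    by (rule small_scale[OF assms(1)]) (use assms(2) in auto)
  then obtain e where e: "e > 0" "\<forall>s\<in>S. e * \<bar>crs (fst s) (snd s) w\<bar> < det3 (fst s) (snd s) q" by blast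
  have "det3 a b (q + e *\<^sub>R w) > 0" if "(a, b) \<in> S" for a b
  proof -
    have "\<bar>e * crs a b w\<bar> < det3 a b q" using bspec[OF e(2) that] e(1) by (simp add: abs_mult)
    then show ?thesis unfolding det3_move by linarith
  qed
  then show ?thesis using e(1) by blast
qed

text \<open>A slight upward shift avoids the heights of the vertices, at which crossing numbers are
  not controlled.\<close>

lemma move_generic:
  fixes q :: complex
  assumes "finite S" "\<And>a b. (a, b) \<in> S \<Longrightarrow> det3 a b q > 0" and T: "finite T"
  shows "\<exists>q'. (\<forall>(a, b)\<in>S. det3 a b q' > 0) \<and> (\<forall>t\<in>T. Im q' \<noteq> t)"
proof -
  have "\<exists>e>0. \<forall>s\<in>S. e * \<bar>crs (fst s) (snd s) \<i>\<bar> < det3 (fst s) (snd s) q"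
    by (rule small_scale[OF assms(1)]) (use assms(2) in auto)
  then obtain e where e: "e > 0" "\<forall>s\<in>S. e * \<bar>crs (fst s) (snd s) \<i>\<bar> < det3 (fst s) (snd s) q" by blast
  have "infinite {Im q<..<Im q + e}" using e by simp
  then have "\<not> {Im q<..<Im q + e} \<subseteq> T" using T finite_subset by blast
  then obtain y where y: "y \<in> {Im q<..<Im q + e}" "y \<notin> T" by blast
  define f where "f = y - Im q"
  have f: "0 < f" "f < e" using y by (auto simp: f_def)
  have "det3 a b (q + f *\<^sub>R \<i>) > 0" if "(a, b) \<in> S" for a b
  proof -
    have "f * \<bar>crs a b \<i>\<bar> \<le> e * \<bar>crs a b \<i>\<bar>" using f by (intro mult_right_mono) auto
    also have "\<dots> < det3 a b q" using bspec[OF e(2) that] by simp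
    finally have "\<bar>f * crs a b \<i>\<bar> < det3 a b q" using f by (simp add: abs_mult)
    then show ?thesis unfolding det3_move by linarith
  qed
  moreover have "Im (q + f *\<^sub>R \<i>) = y" by (simp add: f_def)
  ultimately show ?thesis using y(2) by (intro exI[of _ "q + f *\<^sub>R \<i>"]) auto
qed

context placed
begin

section \<open>Winding numbers of the face boundaries\<close>

definition tri_in :: "complex \<Rightarrow> 'a \<times> 'a \<Rightarrow> bool" where
  "tri_in q d \<longleftrightarrow> det3 (p (fst d)) (p (snd d)) q > 0 \<and> det3 (p (snd d)) (p (third d)) q > 0 \<and>
     det3 (p (third d)) (p (fst d)) q > 0"

text \<open>The winding number of the boundary of \<open>F\<close> about \<open>q\<close>, for
  \<open>q\<close> off the boundary and level with no vertex.\<close>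

definition cov :: "complex \<Rightarrow> ('a \<times> 'a) set \<Rightarrow> int" where
  "cov q F = (\<Sum>d\<in>F. cr q (p (fst d)) (p (snd d)))"

lemma cov_TF:
  assumes F: "F \<in> TF" and g: "\<forall>v\<in>V. Im q \<noteq> Im (p v)" and d: "d \<in> F"
  shows "cov q F \<ge> 0" "tri_in q d \<Longrightarrow> cov q F \<ge> 1"
proof -
  obtain x y where xy: "d = (x, y)" by (cases d)
  have F': "F \<in> IF" "card F = 3" using F by (auto simp: TF_def)
  have dF: "(x, y) \<in> F" using d xy by simp
  note t = triangle_face[OF F' dF]
  let ?w = "rot y x"
  have V: "x \<in> V" "y \<in> V" "?w \<in> V" using t(5-7) E_V by blast+
  have th: "third (x, y) = ?w" using third_TF[OF F dF] by simp
  have pos: "det3 (p x) (p y) (p ?w) > 0"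
    using all_posd[of "(x, y)"] IF_disj[OF F'(1) dF] t(5) th by (simp add: posd_def)
  have c: "cov q F = cr q (p x) (p y) + cr q (p y) (p ?w) + cr q (p ?w) (p x)"
    unfolding cov_def by (subst t(1)) (use t(4) in simp)
  have g': "Im q \<noteq> Im (p x)" "Im q \<noteq> Im (p y)" "Im q \<noteq> Im (p ?w)" using g V by auto
  note k = cr_triangle[OF pos g']
  show "cov q F \<ge> 0" using k(1) c by simp
  show "cov q F \<ge> 1" if "tri_in q d" using k(2) that th unfolding c tri_in_def xy by simp
qed

text \<open>The two halves run through the diagonal in opposite directions, so its crossings cancel
  and the count is the sum over the two triangles.\<close>

lemma cov_Q:
  assumes x: "x \<in> I" and g: "\<forall>v\<in>V. Im q \<noteq> Im (p v)"
  shows "cov q (Q x) \<ge> 0" "d \<in> Q x \<Longrightarrow> tri_in q d \<Longrightarrow> cov q (Q x) \<ge> 1"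
proof -
  let ?a = "p (fa x)" and ?b = "p (fb x)" and ?c = "p (fc x)" and ?x = "p x"
  have xV: "x \<in> V" using x by (simp add: I_def)
  note q = quad[OF x]
  have d1: "det3 ?x ?b ?c > 0" using Q_dets(1)[OF x] Q_positive[OF x] coeffs[OF x] det3_rotate[of ?b
      ?c ?x] by simp
  have d2: "det3 ?c ?a ?x > 0" using Q_dets(2)[OF x] Q_positive[OF x] coeffs[OF x] by simp
  have g': "Im q \<noteq> Im ?a" "Im q \<noteq> Im ?b" "Im q \<noteq> Im ?c" "Im q \<noteq> Im ?x" using g q(13-15) xV by auto
  note k1 = cr_triangle[OF d1 g'(4,2,3)] and k2 = cr_triangle[OF d2 g'(3,1,4)]
  have "cov q (Q x) = cr q ?a ?x + cr q ?x ?b + cr q ?b ?c + cr q ?c ?a"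
    unfolding cov_def Q_def using q(7) by simp
  also have "\<dots> = (cr q ?x ?b + cr q ?b ?c + cr q ?c ?x) + (cr q ?c ?a + cr q ?a ?x + cr q ?x ?c)"
    using cr_swap[of q ?x ?c] by simp
  finally have c: "cov q (Q x) = (cr q ?x ?b + cr q ?b ?c + cr q ?c ?x) + (cr q ?c ?a + cr q ?a ?x
      + cr q ?x ?c)" .
  show "cov q (Q x) \<ge> 0" using k1(1) k2(1) c by simp
  assume d: "d \<in> Q x" "tri_in q d"
  consider "d = (fa x, x)" | "d = (x, fb x)" | "d = (fb x, fc x)" | "d = (fc x, fa x)"
    using d(1) unfolding Q_def by blast
  then show "cov q (Q x) \<ge> 1"
  proof cases
    case 1
    then show ?thesis using k2(2) k1(1) d(2) third_Q(1)[OF x] unfolding c tri_in_def by simp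
  next
    case 2
    then show ?thesis using k1(2) k2(1) d(2) third_Q(2)[OF x] unfolding c tri_in_def by simp
  next
    case 3
    then show ?thesis using k1(2) k2(1) d(2) third_Q(3)[OF x] unfolding c tri_in_def by simp
  next
    case 4
    then show ?thesis using k2(2) k1(1) d(2) third_Q(4)[OF x] unfolding c tri_in_def by simp
  qed
qed

lemma cov_IF:
  assumes F: "F \<in> IF" and g: "\<forall>v\<in>V. Im q \<noteq> Im (p v)"
  shows "cov q F \<ge> 0" "d \<in> F \<Longrightarrow> tri_in q d \<Longrightarrow> cov q F \<ge> 1"
proof -
  have "cov q F \<ge> 0 \<and> (\<forall>d\<in>F. tri_in q d \<longrightarrow> cov q F \<ge> 1)"
  proof (cases "card F = 3")
    case True
    then have T: "F \<in> TF" "F \<noteq> {}" using F by (auto simp: TF_def)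
    then obtain d0 where d0: "d0 \<in> F" by blast
    show ?thesis
      by (intro conjI ballI impI) (rule cov_TF(1)[OF T(1) g d0], rule cov_TF(2)[OF T(1) g])
  next
    case False
    then obtain x where x: "x \<in> I" "F = Q x" using interior_face_cases[OF F] by blast
    show ?thesis unfolding x(2)
      by (intro conjI ballI impI) (rule cov_Q(1)[OF x(1) g], rule cov_Q(2)[OF x(1) g])
  qed
  then show "cov q F \<ge> 0" "d \<in> F \<Longrightarrow> tri_in q d \<Longrightarrow> cov q F \<ge> 1" by auto
qed

text \<open>All other vertices lie to the left of each descending outer edge read upwards. Of two
  such edges, each would have to meet the level \<open>y\<close> strictly to the left of the
  other.\<close>

lemma outer_crossing_unique:
  assumes d: "(u, v) \<in> Ou" "(u', v') \<in> Ou"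
    and b: "Im (p v) < y" "y < Im (p u)" "Im (p v') < y" "y < Im (p u')"
  shows "(u, v) = (u', v')"
proof (rule ccontr)
  assume ne: "(u, v) \<noteq> (u', v')"
  define s where "s = (y - Im (p v)) / (Im (p u) - Im (p v))"
  define s' where "s' = (y - Im (p v')) / (Im (p u') - Im (p v'))"
  define X where "X = (1 - s) *\<^sub>R p v + s *\<^sub>R p u"
  define X' where "X' = (1 - s') *\<^sub>R p v' + s' *\<^sub>R p u'"
  have s: "0 < s" "s < 1" "0 < s'" "s' < 1" using b by (simp_all add: s_def s'_def)
  have "Im X = Im (p v) + s * (Im (p u) - Im (p v))"
      "Im X' = Im (p v') + s' * (Im (p u') - Im (p v'))"
    by (simp_all add: X_def X'_def algebra_simps)
  then have IX: "Im X = y" "Im X' = y" using b by (simp_all add: s_def s'_def)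
  have key: "Re (X2 :: complex) < Re X1" if D: "(u1, v1) \<in> Ou" "(u2, v2) \<in> Ou" "(u1, v1) \<noteq> (u2, v2)"
    and bb: "Im (p v1) < y" "y < Im (p u1)" "Im (p v2) < y" "y < Im (p u2)"
    and X1: "X1 = (1 - t1) *\<^sub>R p v1 + t1 *\<^sub>R p u1" and X2: "X2 = (1 - t2) *\<^sub>R p v2 + t2 *\<^sub>R p u2"
    and t: "0 < t2" "t2 < 1" and I12: "Im X1 = y" "Im X2 = y" for u1 v1 u2 v2 X1 X2 t1 t2
  proof -
    have V2: "u2 \<in> V" "v2 \<in> V" using Ou_D[OF D(2)] E_V by auto
    have ge: "det3 (p v1) (p u1) (p w) \<ge> 0" if "w \<in> V" for w
      using outer_pos[OF D(1) that] by (cases "w = u1 \<or> w = v1") auto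
    have "\<not> (u2 \<in> {u1, v1} \<and> v2 \<in> {u1, v1})" using D(3) bb by auto
    then have "det3 (p v1) (p u1) (p v2) > 0 \<or> det3 (p v1) (p u1) (p u2) > 0"
      using outer_pos[OF D(1), of u2] outer_pos[OF D(1), of v2] V2 by auto
    then have "det3 (p v1) (p u1) X2 > 0"
    proof
      assume "det3 (p v1) (p u1) (p v2) > 0"
      then show ?thesis unfolding X2 det3_segment using t ge[OF V2(1)]
        by (intro add_pos_nonneg mult_pos_pos mult_nonneg_nonneg) auto
    next
      assume "det3 (p v1) (p u1) (p u2) > 0"
      then show ?thesis unfolding X2 det3_segment using t ge[OF V2(2)]
        by (intro add_nonneg_pos mult_pos_pos mult_nonneg_nonneg) auto
    qed
    moreover have "det3 (p v1) (p u1) X1 = 0" unfolding X1 det3_segment by simp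
    moreover have "det3 (p v1) (p u1) X2 - det3 (p v1) (p u1) X1
        = (Im (p u1) - Im (p v1)) * (Re X1 - Re X2)"
      unfolding det3_def I12 by (simp add: algebra_simps)
    ultimately have "(Im (p u1) - Im (p v1)) * (Re X1 - Re X2) > 0" by simp
    then show ?thesis using bb by (simp add: zero_less_mult_iff)
  qed
  have "Re X' < Re X" by (rule key[OF d ne b X_def X'_def s(3,4) IX])
  moreover have "Re X < Re X'" by (rule key[OF d(2,1) ne[symmetric] b(3,4,1,2) X'_def X_def s(1,2)
      IX(2,1)])
  ultimately show False by simp
qed

text \<open>Crossings cancel between the two darts of an edge, so the interior faces together count
  minus the crossings of the outer walk, and at most one outer dart descends across the level of
  \<open>q\<close>.\<close>

lemma cov_total:
  assumes g: "\<forall>v\<in>V. Im q \<noteq> Im (p v)"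
  shows "(\<Sum>F\<in>IF. cov q F) \<le> 1"
proof -
  let ?c = "\<lambda>d. cr q (p (fst d)) (p (snd d))"
  have "(\<Sum>d\<in>D. ?c d) = (\<Sum>d\<in>D. ?c (prod.swap d))" by (rule sum_swap[symmetric])
  also have "\<dots> = (\<Sum>d\<in>D. - ?c d)" by (rule sum.cong) (auto simp: cr_swap[of q "p (fst _)"])
  also have "\<dots> = - (\<Sum>d\<in>D. ?c d)" by (rule sum_negf)
  finally have z: "(\<Sum>d\<in>D. ?c d) = 0" by simp
  have "(\<Sum>d\<in>D. ?c d) = (\<Sum>d\<in>Ou. ?c d) + (\<Sum>F\<in>IF. cov q F)"
    unfolding sum_faces IF_def cov_def using Ou_face finFs by (simp add: sum.remove)
  then have eq: "(\<Sum>F\<in>IF. cov q F) = (\<Sum>d\<in>Ou. - ?c d)" using z by (simp add: sum_negf)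
  define P where "P = {d\<in>Ou. - ?c d > 0}"
  have finP: "finite P" using fin_Ou by (simp add: P_def)
  have up: "Im (p (snd d)) < Im q \<and> Im q < Im (p (fst d))" if "d \<in> P" for d
    using that by (auto simp: P_def cr_def split: if_splits)
  have "d = d'" if "d \<in> P" "d' \<in> P" for d d'
    using outer_crossing_unique[of "fst d" "snd d" "fst d'" "snd d'"
        "Im q"] up[OF that(1)] up[OF that(2)] that
    by (simp add: P_def)
  then have "card P \<le> Suc 0" unfolding card_le_Suc0_iff_eq[OF finP] by blast
  have "(\<Sum>d\<in>Ou. - ?c d) \<le> (\<Sum>d\<in>Ou. if d \<in> P then 1 else 0)"
    by (rule sum_mono) (auto simp: P_def cr_def)
  also have "\<dots> = int (card P)" using fin_Ou finP by (simp add: sum.If_cases P_def Int_def)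
  finally show ?thesis using eq \<open>card P \<le> Suc 0\<close> by simp
qed

lemma cover_unique:
  assumes F: "F \<in> IF" "F' \<in> IF" "d \<in> F" "d' \<in> F'" "tri_in q d" "tri_in q d'"
    and g: "\<forall>v\<in>V. Im q \<noteq> Im (p v)"
  shows "F = F'"
proof (rule ccontr)
  assume "F \<noteq> F'"
  have "(\<Sum>G\<in>{F, F'}. cov q G) \<le> (\<Sum>G\<in>IF. cov q G)"
    using F(1,2) finTF cov_IF(1)[OF _ g] by (intro sum_mono2) auto
  then have "cov q F + cov q F' \<le> 1" using cov_total[OF g] \<open>F \<noteq> F'\<close> by simp
  moreover have "cov q F \<ge> 1" "cov q F' \<ge> 1"
      using cov_IF(2)[OF F(1) g F(3,5)] cov_IF(2)[OF F(2) g F(4,6)] .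
  ultimately show False by simp
qed

text \<open>Near the crossing point some generic point lies to the left of both darts, hence in the
  triangles of both, and no point is covered by two faces.\<close>
lemma crossing_same_face:
  assumes d: "(u, v) \<in> D" "(u, v) \<notin> Ou" and d': "(x, y) \<in> D" "(x, y) \<notin> Ou"
    and dist: "distinct [u, v, x, y]"
    and P: "P = (1 - s) *\<^sub>R p u + s *\<^sub>R p v" "0 < s" "s < 1" "P = (1 - r) *\<^sub>R p x + r *\<^sub>R p y" "0 < r"
        "r < 1"
  shows "dart_face rot (u, v) = dart_face rot (x, y)"
proof -
  have V: "u \<in> V" "v \<in> V" "x \<in> V" "y \<in> V" using d(1) d'(1) E_V by auto
  let ?t = "third (u, v)" and ?t' = "third (x, y)"
  \<comment> \<open>As \<open>P\<close> lies on the line through \<open>a\<close> and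
    \<open>b\<close> and strictly between \<open>c\<close> and \<open>e\<close>, one of
    \<open>c\<close> and \<open>e\<close> lies to the left of that line.\<close>
  have choose: "\<exists>X. det3 (p a) (p b) X > 0 \<and> det3 (p c) (p e) X = 0"
    if dd: "distinct [a, b, c, e]" "{a, b, c, e} \<subseteq> V" and PP: "P = (1 - t) *\<^sub>R p a + t *\<^sub>R p b"
        "P = (1 - t') *\<^sub>R p c + t' *\<^sub>R p e" "0 < t'" "t' < 1"
    for a b c e t t'
  proof -
    have "det3 (p a) (p b) P = 0" unfolding PP(1) det3_segment by simp
    then have 0: "(1 - t') * det3 (p a) (p b) (p c) + t' * det3 (p a) (p b) (p e) = 0"
      unfolding PP(2) det3_segment .
    have nz: "det3 (p a) (p b) (p c) \<noteq> 0" using gp[of a b c] dd by auto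
    show ?thesis
    proof (cases "det3 (p a) (p b) (p c) > 0")
      case True
      then show ?thesis by (intro exI[of _ "p c"]) simp
    next
      case False
      then have "(1 - t') * det3 (p a) (p b) (p c) < 0" using nz PP by (simp add: mult_pos_neg)
      then have "t' * det3 (p a) (p b) (p e) > 0" using 0 by linarith
      then have "det3 (p a) (p b) (p e) > 0" using PP by (simp add: zero_less_mult_iff)
      then show ?thesis by (intro exI[of _ "p e"]) simp
    qed
  qed
  obtain X where X: "det3 (p u) (p v) X > 0" "det3 (p x) (p y) X = 0"
    using choose[of u v x y s r] dist V P by auto
  obtain U where U: "det3 (p x) (p y) U > 0" "det3 (p u) (p v) U = 0"
    using choose[of x y u v r s] dist V P by auto
  have P01: "det3 (p u) (p v) P = 0" unfolding P(1) det3_segment by simp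
  have P02: "det3 (p x) (p y) P = 0" unfolding P(4) det3_segment by simp
  note P0 = P01 P02
  \<comment> \<open>Moving towards \<open>X\<close> increases the determinant of \<open>u v\<close>
    and keeps that of \<open>x y\<close>; towards \<open>U\<close> it is the other way round. The
    sum of the two directions increases both.\<close>
  define W where "W = (X - P) + (U - P)"
  have crsW: "crs (p a) (p b) W = (det3 (p a) (p b) X - det3 (p a) (p b) P)
      + (det3 (p a) (p b) U - det3 (p a) (p b) P)" for a b
    by (simp add: crs_def det3_def W_def algebra_simps)
  have cW: "crs (p u) (p v) W > 0" "crs (p x) (p y) W > 0" unfolding crsW using X U P0 by auto
  have side: "det3 (p b) (p (third (a, b))) P > 0" "det3 (p (third (a, b))) (p a) P > 0"
    if ab: "(a, b) \<in> D" "(a, b) \<notin> Ou" "P = (1 - t) *\<^sub>R p a + t *\<^sub>R p b" "0 < t" "t < 1" for a b t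
  proof -
    have pos: "det3 (p a) (p b) (p (third (a, b))) > 0"
        using all_posd[OF ab(1,2)] by (simp add: posd_def)
    have "det3 (p b) (p (third (a, b))) P = (1 - t) * det3 (p a) (p b) (p (third (a, b)))"
      "det3 (p (third (a, b))) (p a) P = t * det3 (p a) (p b) (p (third (a, b)))"
      unfolding ab(3) det3_segment using det3_rotate[of "p b" "p (third (a, b))" "p a"] det3_rotate[of
          "p (third (a, b))" "p a" "p b"]
      by simp_all
    then show "det3 (p b) (p (third (a, b))) P > 0" "det3 (p (third (a, b))) (p a) P > 0"
        using pos ab by simp_all
  qed
  note sd = side[OF d P(1-3)] and sd' = side[OF d' P(4-6)]
  define S where "S = {(p v, p ?t), (p ?t, p u), (p y, p ?t'), (p ?t', p x)}"
  have "\<exists>e>0. \<forall>(a, b)\<in>S. det3 a b (P + e *\<^sub>R W) > 0"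
    by (rule move_into_open) (use sd sd' in \<open>auto simp: S_def\<close>)
  then obtain e where e: "e > 0" "\<forall>(a, b)\<in>S. det3 a b (P + e *\<^sub>R W) > 0" by blast
  have "\<exists>q'. (\<forall>(a, b)\<in>S \<union> {(p u, p v), (p x, p y)}. det3 a b q' > 0) \<and> (\<forall>t\<in>(Im \<circ> p) ` V. Im q' \<noteq> t)"
  proof (rule move_generic)
    show "det3 a b (P + e *\<^sub>R W) > 0" if "(a, b) \<in> S \<union> {(p u, p v), (p x, p y)}" for a b
      using that e cW P0 by (auto simp: det3_move)
  qed (use finV in \<open>auto simp: S_def\<close>)
  then obtain q where q: "\<forall>(a, b)\<in>S \<union> {(p u, p v), (p x, p y)}. det3 a b q > 0"
      "\<forall>v\<in>V. Im q \<noteq> Im (p v)"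
    by auto
  have "tri_in q (u, v)" "tri_in q (x, y)" using q(1) by (auto simp: tri_in_def S_def)
  moreover have "dart_face rot (u, v) \<in> IF" "dart_face rot (x, y) \<in> IF"
    using face_in_faces[OF d(1)] face_in_faces[OF d'(1)] d(2) d'(2) face_self[of
        "(u, v)"] face_self[of "(x, y)"]
    unfolding IF_def by (metis DiffI singletonD)+
  ultimately show ?thesis using cover_unique[OF _ _ face_self face_self _ _ q(2)] by blast
qed

lemma opposite_not_same_face:
  assumes d: "(u, v) \<in> D" "(u, v) \<notin> Ou" shows "dart_face rot (u, v) \<noteq> dart_face rot (v, u)"
proof
  assume eq: "dart_face rot (u, v) = dart_face rot (v, u)"
  obtain F where F: "F \<in> IF" "(u, v) \<in> F" using face_cases d by blast
  have "F = dart_face rot (u, v)" using faces_memD(2)[OF IF_face[OF F(1)] F(2)] by simp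
  then have vu: "(v, u) \<in> F" using eq face_self[of "(v, u)"] by simp
  show False
  proof (cases "card F = 3")
    case True
    note t = triangle_face[OF F(1) True F(2)]
    then show ?thesis using vu by auto
  next
    case False
    then obtain x where x: "x \<in> I" "F = Q x" using interior_face_cases[OF F(1)] by blast
    show ?thesis using F(2) vu quad(7)[OF x(1)] unfolding x(2) Q_def by auto
  qed
qed

lemma outer_edge_not_crossed:
  assumes uv: "(u, v) \<in> Ou" and V: "x \<in> V" "y \<in> V" and dist: "distinct [u, v, x, y]"
    and P: "P = (1 - s) *\<^sub>R p u + s *\<^sub>R p v" "P = (1 - r) *\<^sub>R p x + r *\<^sub>R p y" "0 \<le> r" "r \<le> 1"
  shows False
proof -
  have "det3 (p v) (p u) P = 0" unfolding P(1) det3_segment by simp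
  moreover have "det3 (p v) (p u) (p x) > 0" "det3 (p v) (p u) (p y) > 0"
      using outer_pos[OF uv] V dist by auto
  then have "det3 (p v) (p u) P > 0" unfolding P(2) det3_segment using P(3,4)
    by (cases "r = 1") (auto intro!: add_pos_nonneg)
  ultimately show False by simp
qed

lemma swap_segment: "(1 - s) *\<^sub>R a + s *\<^sub>R b = (1 - (1 - s)) *\<^sub>R b + (1 - s) *\<^sub>R (a :: complex)"
  by (simp add: add.commute)

text \<open>By general position a common point is interior to both edges, and outer edges cannot be
  crossed. A crossing would put both darts of \<open>u v\<close> into the face of
  \<open>(x, y)\<close>, but no interior face contains a dart and its reversal.\<close>

lemma disjoint_edges:
  assumes E: "E u v" "E x y" and dist: "distinct [u, v, x, y]"
    and P: "P \<in> closed_segment (p u) (p v)" "P \<in> closed_segment (p x) (p y)"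
  shows False
proof -
  have V: "u \<in> V" "v \<in> V" "x \<in> V" "y \<in> V" using E E_V by auto
  from P(1) obtain s where s: "P = (1 - s) *\<^sub>R p u + s *\<^sub>R p v" "0 \<le> s" "s \<le> 1"
      by (auto simp: in_segment)
  from P(2) obtain r where r: "P = (1 - r) *\<^sub>R p x + r *\<^sub>R p y" "0 \<le> r" "r \<le> 1"
      by (auto simp: in_segment)
  have d0: "det3 (p u) (p v) P = 0" unfolding s(1) det3_segment by simp
  have d0': "det3 (p x) (p y) P = 0" unfolding r(1) det3_segment by simp
  have "s \<noteq> 0" "s \<noteq> 1" using d0' s(1) gp[of x y u] gp[of x y v] V dist by auto
  then have s': "0 < s" "s < 1" using s by auto
  have "r \<noteq> 0" "r \<noteq> 1" using d0 r(1) gp[of u v x] gp[of u v y] V dist by auto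
  then have r': "0 < r" "r < 1" using r by auto
  note ss = s(1)[unfolded swap_segment[of s]] and rr = r(1)[unfolded swap_segment[of r]]
  have o: "(u, v) \<notin> Ou" "(v, u) \<notin> Ou" "(x, y) \<notin> Ou"
    using outer_edge_not_crossed[OF _ V(3,4) _ s(1) r] outer_edge_not_crossed[OF _ V(3,4) _ ss r]
      outer_edge_not_crossed[OF _ V(1,2) _ r(1) s] dist by auto
  have D: "(u, v) \<in> D" "(v, u) \<in> D" "(x, y) \<in> D" using E E_sym by auto
  have "dart_face rot (u, v) = dart_face rot (x, y)"
    by (rule crossing_same_face[OF D(1) o(1) D(3) o(3) dist s(1) s' r(1) r'])
  moreover have "dart_face rot (v, u) = dart_face rot (x, y)"
    by (rule crossing_same_face[OF D(2) o(2) D(3) o(3) _ ss _ _ r(1) r']) (use dist s' in auto)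
  ultimately show False using opposite_not_same_face[OF D(1) o(1)] by simp
qed

lemma adjacent_edges:
  assumes V: "c \<in> V" "a \<in> V" "b \<in> V" "c \<noteq> a" "c \<noteq> b" "a \<noteq> b"
    and P: "P \<in> closed_segment (p c) (p a)" "P \<in> closed_segment (p c) (p b)"
  shows "P = p c"
proof -
  from P(1) obtain s where s: "P = (1 - s) *\<^sub>R p c + s *\<^sub>R p a" by (auto simp: in_segment)
  from P(2) obtain r where r: "P = (1 - r) *\<^sub>R p c + r *\<^sub>R p b" by (auto simp: in_segment)
  have "det3 (p c) (p a) P = 0" unfolding s det3_segment by simp
  then have "r * det3 (p c) (p a) (p b) = 0" unfolding r det3_segment by simp
  then have "r = 0" using gp[of c a b] V by auto
  then show ?thesis using r by simp
qed

lemma plane_embedding: "straight_line_plane_embedding V E p"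
  unfolding straight_line_plane_embedding_def
proof (intro conjI allI impI subsetI)
  show "inj_on p V" by (rule inj_p)
  fix u v x y P assume E: "E u v" "E x y" "{u, v} \<noteq> {x, y}"
    and P: "P \<in> closed_segment (p u) (p v) \<inter> closed_segment (p x) (p y)"
  have V: "u \<in> V" "v \<in> V" "x \<in> V" "y \<in> V" using E E_V by auto
  have n: "u \<noteq> v" "x \<noteq> y" using E E_irr by auto
  have P': "P \<in> closed_segment (p u) (p v)" "P \<in> closed_segment (p v) (p u)"
    "P \<in> closed_segment (p x) (p y)" "P \<in> closed_segment (p y) (p x)"
    using P by (auto simp: closed_segment_commute)
  show "P \<in> p ` ({u, v} \<inter> {x, y})"
  proof -
    consider "distinct [u, v, x, y]" | "u = x" "v \<noteq> y" | "u = y" "v \<noteq> x" | "v = x" "u \<noteq> y" | "v = y"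
        "u \<noteq> x"
      using n E(3) by auto
    then show ?thesis
    proof cases
      case 1
      then show ?thesis using disjoint_edges[OF E(1,2) 1 P'(1,3)] by simp
    next
      case 2
      then have "P = p u" using adjacent_edges[of u v y P] V n P' by auto
      then show ?thesis using 2 by simp
    next
      case 3
      then have "P = p u" using adjacent_edges[of u v x P] V n P' by auto
      then show ?thesis using 3 by simp
    next
      case 4
      then have "P = p v" using adjacent_edges[of v u y P] V n P' by auto
      then show ?thesis using 4 by simp
    next
      case 5
      then have "P = p v" using adjacent_edges[of v u x P] V n P' by auto
      then show ?thesis using 5 by simp
    qed
  qed
qed

text \<open>A line separating a vertex from the outer polygon would give an affine, hence harmonic,
  function that violates the maximum principle.\<close>

lemma in_hull: "p ` V \<subseteq> convex hull (p ` snd ` Ou)"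
proof
  fix P assume "P \<in> p ` V"
  then obtain v where v: "v \<in> V" "P = p v" by auto
  let ?C = "convex hull (p ` B)"
  have "P \<in> ?C"
  proof (rule ccontr)
    assume "P \<notin> ?C"
    have "finite (p ` B)" using finI by simp
    then have "closed ?C" by (simp add: compact_imp_closed compact_convex_hull finite_imp_compact)
    from separating_hyperplane_closed_point[OF convex_convex_hull this \<open>P \<notin> ?C\<close>] obtain a b where
      ab: "a \<bullet> P < b" "\<forall>x\<in>?C. b < a \<bullet> x" by auto
    let ?z = "\<lambda>w. (- Re a) * Re (p w) + (- Im a) * Im (p w) + 0"
    have "lin ?z" unfolding lin_def by blast
    have "?z v \<le> - b"
    proof (rule max_principle[OF wts positive_escaping[OF lpos] lin_harmonic[OF \<open>lin ?z\<close>] _ v(1)])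
      fix w assume "w \<in> V - I"
      then have "p w \<in> ?C" using V_I by (auto intro: hull_inc)
      then show "?z w \<le> - b" using ab(2) by (fastforce simp: inner_complex_def)
    qed
    then show False using ab(1) v(2) by (simp add: inner_complex_def)
  qed
  then show "P \<in> convex hull (p ` snd ` Ou)" by (simp add: B_def)
qed

theorem stretches: "stretches_to_4ppt V E rot outer reflex p"
proof -
  have inter: "inj_on snd F \<and> card {d\<in>F. ang d < pi} = 3" if F: "F \<in> IF" for F
  proof
    show "inj_on snd F"
    proof (cases "card F = 3")
      case True
      then have "F \<noteq> {}" by auto
      then obtain x y where xy: "(x, y) \<in> F" by (metis ex_in_conv surj_pair)
      show ?thesis by (subst triangle_face(1)[OF F True xy]) (use triangle_face(4)[OF F True xy] in
          auto)
    next
      case False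
      then obtain x where x: "x \<in> I" "F = Q x" using interior_face_cases[OF F] by blast
      show ?thesis unfolding x(2) Q_def using quad(7)[OF x(1)] by auto
    qed
    have "{d\<in>F. ang d < pi} = {d\<in>F. \<not> reflex d}"
    proof -
      have "ang d < pi \<longleftrightarrow> \<not> reflex d" if d: "d \<in> F" for d
        using interior_ang(2)[of "fst d" "snd d"] faces_memD(1)[OF IF_face[OF F] d] IF_disj[OF F d]
            by simp
      then show ?thesis by blast
    qed
    then show "card {d\<in>F. ang d < pi} = 3" using IF_convex[OF F] by simp
  qed
  have "2 * pi / real h > 0" using h_pos by simp
  then have out: "\<forall>d\<in>Ou. ang d > pi" using outer_ang by simp
  have pointed: "\<exists>d\<in>D. snd d = v \<and> ang d > pi" if "v \<in> V" for v
    using reflex_ex[OF that] reflex_iff_ang by blast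
  have "geometric_ppt V E rot outer p"
    unfolding geometric_ppt_def using in_hull out pointed inter by (auto simp: IF_def)
  then show ?thesis
    unfolding stretches_to_4ppt_def using plane_embedding rotation_realized reflex_iff_ang IF_card
    by (auto simp: IF_def)
qed

end

section \<open>The generalized Laman property\<close>

lemma affine_zero:
  fixes a b c :: real
  assumes "\<And>q. q \<in> {x, y, z} \<Longrightarrow> a + b * Re q + c * Im q = 0" "det3 x y z \<noteq> 0"
  shows "a = 0 \<and> b = 0 \<and> c = 0"
proof -
  have e: "a + b * Re x + c * Im x = 0" "a + b * Re y + c * Im y = 0" "a + b * Re z + c * Im z = 0"
    using assms(1) by auto
  have "b * det3 x y z = 0" "c * det3 x y z = 0" unfolding det3_def using e by algebra+
  then have "b = 0" "c = 0" using assms(2) by auto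
  then show ?thesis using e by simp
qed

context placed
begin

text \<open>For every point \<open>q\<close> the weighted areas \<open>\<alpha> q\<close> are closed, so they are differences of a
  function \<open>\<Phi> q\<close> on the faces that is affine in \<open>q\<close>: the Maxwell lifting. Its heights \<open>z\<close> are
  harmonic and vanish on the boundary.\<close>
lemma no_stress:
  assumes sym: "\<And>d. d \<in> D \<Longrightarrow> \<omega> (prod.swap d) = \<omega> d"
    and re: "\<And>v. v \<in> V \<Longrightarrow> (\<Sum>u\<in>N v. \<omega> (u, v) * (Re (p u) - Re (p v))) = 0"
    and im: "\<And>v. v \<in> V \<Longrightarrow> (\<Sum>u\<in>N v. \<omega> (u, v) * (Im (p u) - Im (p v))) = 0"
    and d: "d \<in> D"
  shows "\<omega> d = 0"
proof -
  define \<alpha> where "\<alpha> q d = \<omega> d * det3 (p (fst d)) (p (snd d)) q" for q d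
  have "\<exists>\<phi>. (\<forall>d\<in>D. \<phi> (fs d) = \<phi> d) \<and> (\<forall>d\<in>D. \<alpha> q d = \<phi> d - \<phi> (prod.swap d)) \<and> \<phi> outer = 0" for q
  proof (rule dual_exact)
    show "\<alpha> q (prod.swap d) = - \<alpha> q d" if "d \<in> D" for d
      using sym[OF that] det3_swap[of "p (snd d)" "p (fst d)" q] by (simp add: \<alpha>_def)
    show "(\<Sum>u\<in>N v. \<alpha> q (u, v)) = 0" if v: "v \<in> V" for v
    proof -
      have "(\<Sum>u\<in>N v. \<alpha> q (u, v)) = (\<Sum>u\<in>N v. (Re q - Re (p v)) * (\<omega> (u, v) * (Im (p u) - Im (p v)))
          - (Im q - Im (p v)) * (\<omega> (u, v) * (Re (p u) - Re (p v))))"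
        by (rule sum.cong) (auto simp: \<alpha>_def det3_def algebra_simps)
      also have "\<dots> = 0" using re[OF v] im[OF v]
          by (simp add: sum_subtractf sum_distrib_left[symmetric])
      finally show ?thesis .
    qed
  qed
  then obtain \<phi> where \<phi>: "\<And>q. (\<forall>d\<in>D. \<phi> q (fs d) = \<phi> q d) \<and> (\<forall>d\<in>D. \<alpha> q d = \<phi> q d - \<phi> q (prod.swap d)) \<and>
      \<phi> q outer = 0"
    by metis
  \<comment> \<open>The functions chosen for different \<open>q\<close> are unrelated; interpolating
    from 0, 1 and \<open>\<i>\<close> makes the dependence on \<open>q\<close> affine, as that of
    the weighted areas is.\<close>
  define \<Phi> where "\<Phi> q d = \<phi> 0 d + Re q * (\<phi> 1 d - \<phi> 0 d) + Im q * (\<phi> \<i> d - \<phi> 0 d)" for q d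
  have Pfs: "\<Phi> q (fs d) = \<Phi> q d" if "d \<in> D" for q d using \<phi> that by (simp add: \<Phi>_def)
  have Pa: "\<alpha> q d = \<Phi> q d - \<Phi> q (prod.swap d)" if "d \<in> D" for q d
  proof -
    have A: "\<alpha> q d = \<alpha> 0 d + Re q * (\<alpha> 1 d - \<alpha> 0 d) + Im q * (\<alpha> \<i> d - \<alpha> 0 d)"
      by (simp add: \<alpha>_def det3_def algebra_simps)
    have B: "\<alpha> r d = \<phi> r d - \<phi> r (prod.swap d)" for r using \<phi>[of r] that by blast
    show ?thesis unfolding A B[of 0] B[of 1] B[of \<i>] \<Phi>_def by (simp add: algebra_simps)
  qed
  have POu: "\<Phi> q d = 0" if "d \<in> Ou" for q d
  proof -
    have "Ou \<subseteq> {d \<in> D. \<Phi> q d = 0}"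
      by (rule face_subset) (use \<phi> outer_D fs_D Pfs in \<open>auto simp: \<Phi>_def\<close>)
    then show ?thesis using that by auto
  qed
  \<comment> \<open>The weighted area vanishes at the ends of the edge, so the affine functions of
    the two adjacent faces agree there: the lifting is continuous.\<close>
  have Psw1: "\<Phi> (p (fst d)) (prod.swap d) = \<Phi> (p (fst d)) d" if "d \<in> D" for d
    using Pa[OF that, of "p (fst d)"] by (simp add: \<alpha>_def)
  have Psw2: "\<Phi> (p (snd d)) (prod.swap d) = \<Phi> (p (snd d)) d" if "d \<in> D" for d
    using Pa[OF that, of "p (snd d)"] by (simp add: \<alpha>_def)
  define z where "z v = \<Phi> (p v) (SOME d. d \<in> D \<and> snd d = v)" for v
  have z2: "\<Phi> (p v) (u, v) = z v" if uv: "E u v" for u v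
  proof -
    let ?d = "SOME d. d \<in> D \<and> snd d = v"
    have dd: "?d \<in> D \<and> snd ?d = v" by (rule someI[of _ "(u, v)"]) (use uv in simp)
    define w where "w = fst ?d"
    have w1: "?d = (w, v)" using dd by (simp add: w_def prod_eq_iff)
    have w2: "E w v" using dd unfolding w1 by simp
    note w = w1 w2
    show ?thesis unfolding z_def w1
    proof (rule rot_closed[of v "\<lambda>u. \<Phi> (p v) (u, v) = \<Phi> (p v) (w, v)" w u])
      fix x assume x: "x \<in> N v" "\<Phi> (p v) (x, v) = \<Phi> (p v) (w, v)"
      then have xD: "(x, v) \<in> D" "(rot v x, v) \<in> D" using E_sym rot_E by (auto simp: N_iff)
      have "\<Phi> (p v) (rot v x, v) = \<Phi> (p v) (v, rot v x)" using Psw2[OF xD(2)] by simp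
      also have "\<dots> = \<Phi> (p v) (x, v)" using Pfs[OF xD(1), of "p v"] by simp
      finally show "\<Phi> (p v) (rot v x, v) = \<Phi> (p v) (w, v)" using x by simp
    qed (use w uv E_sym in \<open>auto simp: N_iff\<close>)
  qed
  have z1: "\<Phi> (p u) (u, v) = z u" if uv: "E u v" for u v
    using z2[OF E_sym[OF uv]] Psw1[of "(u, v)"] uv by simp
  have z3: "\<Phi> (p (rot v u)) (u, v) = z (rot v u)" if uv: "E u v" for u v
    using z2[of v "rot v u"] Pfs[of "(u, v)" "p (rot v u)"] uv rot_E E_sym by simp
  have zB: "z v = 0" if "v \<in> V - I" for v
  proof -
    from that V_I obtain u where u: "(u, v) \<in> Ou" by (auto simp: B_def)
    then show ?thesis using z2[of u v] POu[OF u] Ou_D[OF u] by simp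
  qed
  have hz: "harmonic la lb lc z"
    unfolding harmonic_def
  proof
    fix x assume x: "x \<in> I"
    note q = quad[OF x]
    \<comment> \<open>All four vertices of \<open>Q x\<close> are lifted by this one affine
      function, which preserves the convex combination.\<close>
    let ?f = "\<lambda>r. \<Phi> r (fa x, x)"
    have "?f (p x) = z x" "?f (p (fa x)) = z (fa x)" "?f (p (fb x)) = z (fb x)"
      using z2[OF q(8)] z1[OF q(8)] z3[OF q(8)] q(3) by simp_all
    moreover have "?f (p (fc x)) = z (fc x)"
      using z3[OF q(9)] Pfs[of "(fa x, x)" "p (fc x)"] q(3,4,8) by simp
    moreover have "?f (p x) = la x * ?f (p (fa x)) + lb x * ?f (p (fb x)) + lc x * ?f (p (fc x))"
    proof -
      have "lin (\<lambda>v. ?f (p v))" unfolding lin_def \<Phi>_def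
        by (intro exI[of _ "\<phi> 1 (fa x, x) - \<phi> 0 (fa x, x)"] exI[of _
            "\<phi> \<i> (fa x, x) - \<phi> 0 (fa x, x)"] exI[of _ "\<phi> 0 (fa x, x)"])
          (simp add: algebra_simps)
      from lin_comb[OF this x] show ?thesis .
    qed
    ultimately show "z x = la x * z (fa x) + lb x * z (fb x) + lc x * z (fc x)" by simp
  qed
  have z0: "z v = 0" if "v \<in> V" for v
    by (rule harmonic_zero[OF wts positive_escaping[OF lpos] hz _ that]) (rule zB)
  have P0: "\<Phi> q d = 0" if dD: "d \<in> D" for q d
  proof (cases "d \<in> Ou")
    case False
    obtain u v where uv: "d = (u, v)" by (cases d)
    have D': "(u, v) \<in> D" "(u, v) \<notin> Ou" using dD False uv by auto
    note c = corner_distinct[OF D']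
    have nz: "det3 (p u) (p v) (p (rot v u)) \<noteq> 0" using gp c by metis
    have "\<phi> 0 d + (\<phi> 1 d - \<phi> 0 d) * Re r + (\<phi> \<i> d - \<phi> 0 d) * Im r = 0"
        if r: "r \<in> {p u, p v, p (rot v u)}" for r
    proof -
      have "\<Phi> r d = 0" using r z1[of u v] z2[of u v] z3[of u v] z0 c D' uv by auto
      then show ?thesis by (simp add: \<Phi>_def algebra_simps)
    qed
    from affine_zero[OF this nz] show ?thesis by (simp add: \<Phi>_def)
  qed (rule POu)
  obtain u v where uv: "d = (u, v)" by (cases d)
  have V: "u \<in> V" "v \<in> V" "u \<noteq> v" using d uv E_V E_irr by auto
  have "\<not> V \<subseteq> {u, v}"
  proof
    assume "V \<subseteq> {u, v}"
    then have "card V \<le> card {u, v}" by (rule card_mono[rotated]) simp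
    then show False using card_V3 V by simp
  qed
  then obtain w where w: "w \<in> V" "w \<noteq> u" "w \<noteq> v" by auto
  have "\<alpha> (p w) d = 0" using Pa[OF d] P0[OF d] P0[OF swap_D[OF d]] by simp
  then show "\<omega> d = 0" using gp[of u v w] V w uv by (auto simp: \<alpha>_def)
qed

text \<open>If the bound failed, the edges within \<open>X\<close> would outnumber the 2 |X| - 3
  equations of equilibrium: two at each vertex but \<open>u0\<close> and \<open>v0\<close>, and one
  at \<open>v0\<close>. A nonzero stress would result.\<close>

lemma laman_count:
  assumes X: "X \<subseteq> V" "card X \<ge> 2"
  shows "card (induced_edges E X) + 3 \<le> 2 * card X"
proof (rule ccontr)
  assume neg: "\<not> ?thesis"
  define DX where "DX = {d \<in> D. fst d \<in> X \<and> snd d \<in> X}"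
  have finX: "finite X" using X finV finite_subset by blast
  have "\<exists>J\<subseteq>DX. J \<inter> prod.swap ` J = {} \<and> DX = J \<union> prod.swap ` J \<and>
      card J = card ((\<lambda>d. {fst d, snd d}) ` DX)"
  proof (rule half_darts)
    show "finite DX" using finD by (simp add: DX_def)
    show "prod.swap d \<in> DX" if "d \<in> DX" for d using that by (simp add: DX_def)
    show "fst d \<noteq> snd d" if "d \<in> DX" for d using that E_irr by (auto simp: DX_def D_iff)
  qed
  then obtain J where J: "J \<subseteq> DX" "J \<inter> prod.swap ` J = {}" "DX = J \<union> prod.swap ` J"
    "card J = card ((\<lambda>d. {fst d, snd d}) ` DX)" by (elim exE conjE) (rule that)
  have "(\<lambda>d. {fst d, snd d}) ` DX = induced_edges E X"
  proof (intro equalityI subsetI)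
    fix e assume "e \<in> (\<lambda>d. {fst d, snd d}) ` DX"
    then obtain d where "e = {fst d, snd d}" "d \<in> DX" by (rule imageE)
    then show "e \<in> induced_edges E X" unfolding induced_edges_def DX_def D_iff by blast
  next
    fix e assume "e \<in> induced_edges E X"
    then obtain u v where "e = {u, v}" "u \<in> X" "v \<in> X" "E u v" by (auto simp: induced_edges_def)
    then show "e \<in> (\<lambda>d. {fst d, snd d}) ` DX"
        by (intro image_eqI[of _ _ "(u, v)"]) (auto simp: DX_def)
  qed
  then have cJ: "card J + 3 > 2 * card X" using J(4) neg by simp
  have JD: "J \<subseteq> D" using J(1) by (auto simp: DX_def)
  have finJ: "finite J" using JD finD by (rule finite_subset)
  have JX: "fst d \<in> X \<and> snd d \<in> X" if "d \<in> J" for d using subsetD[OF J(1) that] by (simp add: DX_def)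
  obtain u0 v0 where uv0: "u0 \<in> X" "v0 \<in> X" "u0 \<noteq> v0"
  proof -
    have "\<not> card X \<le> Suc 0" using X(2) by simp
    then show thesis unfolding card_le_Suc0_iff_eq[OF finX] using that by blast
  qed
  define Y where "Y = X - {u0, v0}"
  have cY: "card Y + 2 = card X" unfolding Y_def using uv0 finX X(2) by (simp add: card_Diff_subset)
  have finY: "finite Y" using finX by (simp add: Y_def)
  define cf where "cf f v d = of_bool (snd d = v) * (f (fst d) - f (snd d)) + of_bool (fst d
      = v) * (f (snd d) - f (fst d) :: real)"
    for f :: "'a \<Rightarrow> real" and v and d :: "'a \<times> 'a"
  let ?R = "\<lambda>v. Re (p v)" and ?M = "\<lambda>v. Im (p v)"
  define M :: "('a + 'a) set" where "M = Inl ` Y \<union> Inr ` Y"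
  \<comment> \<open>Besides equilibrium on \<open>Y\<close>, one component at \<open>v0\<close> suffices: total force and torque vanish anyway.\<close>
  define Eq where "Eq = insert None (Some ` M)"
  define a where "a i d = (case i of None \<Rightarrow> (?R v0 - ?R u0) * cf ?R v0 d
      + (?M v0 - ?M u0) * cf ?M v0 d
     | Some (Inl v) \<Rightarrow> cf ?R v d | Some (Inr v) \<Rightarrow> cf ?M v d)" for i d
  have finEq: "finite Eq" using finY by (simp add: Eq_def M_def)
  have "card Eq \<le> card Y + card Y + 1"
  proof -
    have "card Eq \<le> Suc (card (Some ` M))" unfolding Eq_def by (rule card_insert_le_m1) auto
    also have "card (Some ` M) = card M" by (simp add: card_image)
    also have "card M \<le> card Y + card Y"
      unfolding M_def by (rule order.trans[OF card_Un_le]) (simp add: card_image)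
    finally show ?thesis by simp
  qed
  then have "card Eq < card J" using cJ cY by simp
  from homogeneous_system_nontrivial[OF finEq finJ this, of a] obtain x where
    x: "\<exists>d\<in>J. x d \<noteq> 0" "\<forall>i\<in>Eq. (\<Sum>d\<in>J. a i d * x d) = 0" by blast
  define \<omega> where "\<omega> d = (if d \<in> J then x d else if prod.swap d \<in> J then x (prod.swap d) else 0)" for d
  note notboth = not_both_halves[OF J(2)]
  have sym: "\<omega> (prod.swap d) = \<omega> d" for d using notboth[of d] by (auto simp: \<omega>_def)
  define F where "F f v = (\<Sum>d\<in>J. x d * cf f v d)" for f v
  have vsum: "(\<Sum>u\<in>N v. \<omega> (u, v) * (f u - f v)) = F f v" if v: "v \<in> V" for f v
  proof -
    let ?h = "\<lambda>d. \<omega> d * (f (fst d) - f (snd d))"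
    have "(\<Sum>u\<in>N v. ?h (u, v)) = (\<Sum>d\<in>J. of_bool (snd d = v) * ?h d + of_bool (fst d
        = v) * ?h (prod.swap d))"
    proof (rule half_sum[OF JD J(2) v])
      show "?h d = 0" if "d \<notin> J" "prod.swap d \<notin> J" for d using that by (simp add: \<omega>_def)
    qed
    also have "\<dots> = F f v"
      unfolding F_def
    proof (rule sum.cong)
      fix d assume d: "d \<in> J"
      then have "\<omega> d = x d" by (simp add: \<omega>_def)
      then show "of_bool (snd d = v) * ?h d + of_bool (fst d = v) * ?h (prod.swap d) = x d * cf f v d"
        using sym[of d] by (simp add: cf_def algebra_simps)
    qed simp
    finally show ?thesis by simp
  qed
  have Fout: "F f v = 0" if "v \<notin> X" for f v
    unfolding F_def using that JX by (intro sum.neutral) (auto simp: cf_def)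
  have sumX: "(\<Sum>v\<in>X. g v * F f v) = (\<Sum>d\<in>J. x d * ((g (snd d) - g (fst d)) * (f (fst d) - f (snd d))))"
      for f g
  proof -
    have "(\<Sum>v\<in>X. g v * F f v) = (\<Sum>d\<in>J. x d * (\<Sum>v\<in>X. g v * cf f v d))"
      unfolding F_def sum_distrib_left by (subst sum.swap) (simp add: mult_ac)
    also have "\<dots> = (\<Sum>d\<in>J. x d * ((g (snd d) - g (fst d)) * (f (fst d) - f (snd d))))"
    proof (rule sum.cong)
      fix d assume d: "d \<in> J"
      have "(\<Sum>v\<in>X. g v * cf f v d) = (\<Sum>v\<in>X. (if snd d = v then g v * (f (fst d) - f (snd d)) else 0)
          + (if fst d = v then g v * (f (snd d) - f (fst d)) else 0))"
        by (rule sum.cong) (auto simp: cf_def algebra_simps)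
      also have "\<dots> = g (snd d) * (f (fst d) - f (snd d)) + g (fst d) * (f (snd d) - f (fst d))"
        using JX[OF d] finX by (simp add: sum.distrib)
      finally have S: "(\<Sum>v\<in>X. g v * cf f v d) = g (snd d) * (f (fst d) - f (snd d))
          + g (fst d) * (f (snd d) - f (fst d))" .
      show "x d * (\<Sum>v\<in>X. g v * cf f v d) = x d * ((g (snd d) - g (fst d)) * (f (fst d) - f (snd d)))"
        unfolding S by (simp add: algebra_simps)
    qed simp
    finally show ?thesis .
  qed
  have FY: "F ?R v = 0" "F ?M v = 0" if "v \<in> Y" for v
  proof -
    have "Some (Inl v) \<in> Eq" "Some (Inr v) \<in> Eq" using that by (auto simp: Eq_def M_def)
    then have "(\<Sum>d\<in>J. a (Some (Inl v)) d * x d) = 0" "(\<Sum>d\<in>J. a (Some (Inr v)) d * x d) = 0"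
        using x(2) by blast+
    then show "F ?R v = 0" "F ?M v = 0" by (simp_all add: F_def a_def mult.commute)
  qed
  have Fs: "(?R v0 - ?R u0) * F ?R v0 + (?M v0 - ?M u0) * F ?M v0 = 0"
  proof -
    have "None \<in> Eq" by (simp add: Eq_def)
    then have "(\<Sum>d\<in>J. a None d * x d) = 0" using x(2) by blast
    then have "(\<Sum>d\<in>J. (?R v0 - ?R u0) * (x d * cf ?R v0 d) + (?M v0 - ?M u0) * (x d * cf ?M v0 d))
        = 0"
      by (simp add: a_def algebra_simps)
    then show ?thesis unfolding F_def sum_distrib_left sum.distrib .
  qed
  have sums: "(\<Sum>v\<in>X. g v * F f v) = g u0 * F f u0 + g v0 * F f v0" if "f = ?R \<or> f = ?M" for f g
  proof -
    have "(\<Sum>v\<in>X. g v * F f v) = (\<Sum>v\<in>{u0, v0}. g v * F f v)"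
      using uv0 finX FY that by (intro sum.mono_neutral_right) (auto simp: Y_def)
    then show ?thesis using uv0 by simp
  qed
  have tot: "F f u0 + F f v0 = 0" if "f = ?R \<or> f = ?M" for f
    using sums[OF that, of "\<lambda>_. 1"] sumX[of "\<lambda>_. 1" f] by simp
  \<comment> \<open>The torque about \<open>p u0\<close> vanishes since stresses act along edges.
    Only the force at \<open>v0\<close> contributes, so it has no component orthogonal to
    \<open>p v0 - p u0\<close>; the equation \<open>None\<close> removes the other
    component.\<close>
  have "(\<Sum>v\<in>X. (?R v - ?R u0) * F ?M v) = (\<Sum>v\<in>X. (?M v - ?M u0) * F ?R v)"
    unfolding sumX by (rule sum.cong) (simp_all add: algebra_simps)
  then have torque: "(?R v0 - ?R u0) * F ?M v0 = (?M v0 - ?M u0) * F ?R v0"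
    using sums[of ?M "\<lambda>v. ?R v - ?R u0"] sums[of ?R "\<lambda>v. ?M v - ?M u0"] by simp
  have nz: "(?R v0 - ?R u0)\<^sup>2 + (?M v0 - ?M u0)\<^sup>2 \<noteq> 0"
  proof -
    have "p v0 \<noteq> p u0" using p_ne uv0 X by blast
    then show ?thesis by (auto simp: complex_eq_iff sum_power2_eq_zero_iff)
  qed
  have "((?R v0 - ?R u0)\<^sup>2 + (?M v0 - ?M u0)\<^sup>2) * F ?R v0 = 0"
    "((?R v0 - ?R u0)\<^sup>2 + (?M v0 - ?M u0)\<^sup>2) * F ?M v0 = 0"
    using Fs torque by algebra+
  then have Fv0: "F ?R v0 = 0" "F ?M v0 = 0" using nz by auto
  then have Fu0: "F ?R u0 = 0" "F ?M u0 = 0" using tot[of ?R] tot[of ?M] by simp_all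
  have F0: "F ?R v = 0 \<and> F ?M v = 0" for v
  proof (cases "v \<in> X")
    case True
    then have "v \<in> Y \<or> v = u0 \<or> v = v0" by (auto simp: Y_def)
    then show ?thesis using FY Fv0 Fu0 by blast
  qed (simp add: Fout)
  have "\<omega> d = 0" if "d \<in> D" for d
  proof (rule no_stress[OF _ _ _ that])
    show "(\<Sum>u\<in>N v. \<omega> (u, v) * (?R u - ?R v)) = 0" if "v \<in> V" for v
      using vsum[OF that, of ?R] F0[of v] by simp
    show "(\<Sum>u\<in>N v. \<omega> (u, v) * (?M u - ?M v)) = 0" if "v \<in> V" for v
      using vsum[OF that, of ?M] F0[of v] by simp
  qed (rule sym)
  note \<omega>0 = this
  have "x d = 0" if "d \<in> J" for d using \<omega>0[OF subsetD[OF JD that]] that by (simp add: \<omega>_def)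
  then show False using x(1) by blast
qed

lemma laman: "generalized_laman V E reflex"
  unfolding generalized_laman_def Let_def
proof (intro allI impI)
  fix X assume X: "X \<subseteq> V"
    and two: "2 \<le> card {v \<in> X. \<not> pointed_vertex V E reflex v}
        + card {v \<in> X. pointed_vertex V E reflex v}"
  have "pointed_vertex V E reflex v" if "v \<in> X" for v
    using reflex_ex[of v] that X unfolding pointed_vertex_def by auto
  then have e: "{v \<in> X. \<not> pointed_vertex V E reflex v} = {}"
      "{v \<in> X. pointed_vertex V E reflex v} = X" by auto
  show "int (card (induced_edges E X)) \<le> 3 * int (card {v \<in> X. \<not> pointed_vertex V E reflex v}) +
     2 * int (card {v \<in> X. pointed_vertex V E reflex v}) - 3"
    using laman_count[OF X] two unfolding e by simp
qed

end

section \<open>The main theorem\<close>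

text \<open>Without loops a face shorter than three has exactly two darts; both ends then have
  degree one, and connectivity leaves no other vertex. Both angles are \<open>2 * pi\<close>, since
  \<open>ccw_angle\<close> takes values in (0, \<open>2 * pi\<close>].\<close>

lemma (in plane_map) single_edge:
  assumes ppt: "comb_4ppt V E rot outer reflex" and h: "card (dart_face rot outer) < 3"
  shows "(\<exists>p. stretches_to_4ppt V E rot outer reflex p) \<and> generalized_laman V E reflex"
proof -
  let ?Ou = "dart_face rot outer"
  obtain u v where uv: "outer = (u, v)" by (cases outer)
  have Euv: "E u v" "E v u" "u \<noteq> v" using outer_D E_sym E_irr uv by auto
  note e = face_enum[OF outer_D refl]
  have "card ?Ou \<noteq> 1"
  proof
    assume "card ?Ou = 1"
    then have "fs outer = outer" using e(1) by simp
    then show False using uv Euv by simp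
  qed
  then have "card ?Ou = 2" using h e(4) by linarith
  then have "fs (fs outer) = outer" using e(1) by (simp add: numeral_2_eq_2)
  then have rr: "(rot v u, rot (rot v u) v) = (u, v)" unfolding uv fs_pair .
  have r1: "rot v u = u" by (rule conjunct1[OF rr[unfolded prod.inject]])
  have r2: "rot (rot v u) v = v" by (rule conjunct2[OF rr[unfolded prod.inject]])
  note r = r1 r2[unfolded r1]
  have Nv: "w = u" if "E v w" for w
    by (rule rot_closed[of v "\<lambda>w. w = u" u w]) (use r that Euv in \<open>auto simp: N_iff\<close>)
  have Nu: "w = v" if "E u w" for w
    by (rule rot_closed[of u "\<lambda>w. w = v" v w]) (use r that Euv in \<open>auto simp: N_iff\<close>)
  have uvV: "u \<in> V" "v \<in> V" using Euv E_V by auto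
  have "w = u \<or> w = v" if "w \<in> V" for w
  proof (rule connected_V[of "\<lambda>w. w = u \<or> w = v" u w])
    show "y = u \<or> y = v" if "E x y" "x = u \<or> x = v" for x y using Nu[of y] Nv[of y] that by blast
  qed (use uvV that in simp_all)
  then have V: "V = {u, v}" using uvV by auto
  have E: "E a b \<longleftrightarrow> a = u \<and> b = v \<or> a = v \<and> b = u" for a b
  proof
    assume ab: "E a b"
    then have "a = u \<or> a = v" using E_V[of a b] V by blast
    then show "a = u \<and> b = v \<or> a = v \<and> b = u" using Nu[of b] Nv[of b] ab by blast
  qed (use Euv in auto)
  have Ou: "(u, v) \<in> ?Ou" "(v, u) \<in> ?Ou"
      using face_self[of outer] face_fs[OF face_self, of outer] uv r by auto
  have D: "d \<in> D \<longleftrightarrow> d = (u, v) \<or> d = (v, u)" for d using E by (cases d) simp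
  have Deq: "?Ou = D"
  proof
    show "?Ou \<subseteq> D" by (rule face_D[OF outer_D])
    show "D \<subseteq> ?Ou" using Ou D by auto
  qed
  have Fs: "F = ?Ou" if F: "F \<in> Fs" for F
  proof -
    from F obtain d where "d \<in> D" "F = dart_face rot d" by (auto simp: faces_def)
    then show ?thesis using face_eq[OF outer_D, of d] Deq by blast
  qed
  have refl: "reflex d" if "d \<in> D" for d
    using ppt that Deq by (simp add: comb_4ppt_def comb_pt_def)
  define p where "p w = (if w = u then 0 else 1 :: complex)" for w
  have puv: "p u \<noteq> p v" using Euv by (simp add: p_def)
  have ccw: "ccw_angle a a = 2 * pi" if "a \<noteq> 0" for a using that by (simp add: ccw_angle_def)
  have ang: "corner_angle p rot d > pi" if "d \<in> D" for d
    using that r puv by (auto simp: D corner_angle_def ccw)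
  have "straight_line_plane_embedding V E p"
    unfolding straight_line_plane_embedding_def using puv Euv V E
    by (auto simp: doubleton_eq_iff)
  moreover have "realizes_rotation V E rot p"
    unfolding realizes_rotation_def using r E by auto
  moreover have "geometric_ppt V E rot outer p"
    unfolding geometric_ppt_def
  proof (intro conjI ballI impI)
    have "v \<in> snd ` ?Ou" by (rule image_eqI[OF _ Ou(1)]) simp
    moreover have "u \<in> snd ` ?Ou" by (rule image_eqI[OF _ Ou(2)]) simp
    ultimately have "V \<subseteq> snd ` ?Ou" unfolding V by simp
    then have "p ` V \<subseteq> p ` snd ` ?Ou" by (rule image_mono)
    also have "\<dots> \<subseteq> convex hull (p ` snd ` ?Ou)" by (rule hull_subset)
    finally show "p ` V \<subseteq> convex hull (p ` snd ` ?Ou)" .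
    show "corner_angle p rot d > pi" if "d \<in> ?Ou" for d using ang that Deq by simp
    show "\<exists>d\<in>D. snd d = w \<and> corner_angle p rot d > pi" if "w \<in> V" for w
    proof -
      have "w = u \<or> w = v" using that V by blast
      then show ?thesis
      proof
        assume "w = u"
        then show ?thesis using ang[of "(v, u)"] Euv by (intro bexI[of _ "(v, u)"]) simp_all
      next
        assume "w = v"
        then show ?thesis using ang[of "(u, v)"] Euv by (intro bexI[of _ "(u, v)"]) simp_all
      qed
    qed
  qed (use Fs in blast)+
  moreover have "\<forall>F\<in>Fs. F \<noteq> ?Ou \<longrightarrow> card F = 3 \<or> card F = 4" using Fs by blast
  moreover have "\<forall>d\<in>D. reflex d \<longleftrightarrow> corner_angle p rot d > pi" using refl ang by blast
  ultimately have "stretches_to_4ppt V E rot outer reflex p" unfolding stretches_to_4ppt_def by blast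
  moreover have "generalized_laman V E reflex"
    unfolding generalized_laman_def Let_def
  proof (intro allI impI)
    fix X assume X: "X \<subseteq> V"
      and two: "2 \<le> card {v \<in> X. \<not> pointed_vertex V E reflex v}
          + card {v \<in> X. pointed_vertex V E reflex v}"
    have "pointed_vertex V E reflex w" if "w \<in> V" for w
      using ppt that by (simp add: comb_4ppt_def)
    then have eX: "{v \<in> X. \<not> pointed_vertex V E reflex v} = {}"
        "{v \<in> X. pointed_vertex V E reflex v} = X"
      using X by auto
    have cX: "card X \<ge> 2" using two unfolding eX by simp
    have "induced_edges E X \<subseteq> {{u, v}}" by (auto simp: induced_edges_def E)
    then have "card (induced_edges E X) \<le> card {{u, v}}" by (rule card_mono[rotated]) simp
    then show "int (card (induced_edges E X)) \<le> 3 * int (card {v \<in> X. \<not> pointed_vertex V E reflex v}) +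
       2 * int (card {v \<in> X. pointed_vertex V E reflex v}) - 3"
      using cX unfolding eX by simp
  qed
  ultimately show ?thesis by blast
qed

theorem theorem1:
  fixes V :: "'a set" and E :: "'a \<Rightarrow> 'a \<Rightarrow> bool" and rot :: "'a \<Rightarrow> 'a \<Rightarrow> 'a"
    and outer :: "'a \<times> 'a" and reflex :: "'a \<times> 'a \<Rightarrow> bool"
  assumes "comb_4ppt V E rot outer reflex"
  shows "(\<exists>p. stretches_to_4ppt V E rot outer reflex p) \<and> generalized_laman V E reflex"
proof -
  interpret plane_map V E rot outer
    by unfold_locales (use assms in \<open>simp add: comb_4ppt_def comb_pt_def\<close>)
  show ?thesis
  proof (cases "card (dart_face rot outer) < 3")
    case True
    then show ?thesis using single_edge[OF assms] by blast
  next
    case False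
    then interpret four_ppt V E rot outer reflex
      by unfold_locales (use assms in auto)
    obtain p la lb lc where p: "weights la lb lc" "positive la lb lc"
      "\<And>v. v \<in> I \<Longrightarrow> p v = la v *\<^sub>R p (fa v) + lb v *\<^sub>R p (fb v) + lc v *\<^sub>R p (fc v)"
      "\<And>u v w. (u, v) \<in> Ou \<Longrightarrow> w \<in> B \<Longrightarrow> w \<noteq> u \<Longrightarrow> w \<noteq> v \<Longrightarrow> det3 (p v) (p u) (p w) > 0"
      "\<And>x y z. {x, y, z} \<subseteq> V \<Longrightarrow> card {x, y, z} = 3 \<Longrightarrow> det3 (p x) (p y) (p z) \<noteq> 0"
      "\<And>u v. (u, v) \<in> Ou \<Longrightarrow> ccw_angle (p (rot v u) - p v) (p u - p v) = pi
          + 2 * pi / real (card (dart_face rot outer))"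
      by (rule positions_exist) (rule that, assumption+)
    interpret placed V E rot outer reflex p la lb lc
      by unfold_locales (fact p)+
    show ?thesis using stretches laman by blast
  qed
qed

end
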